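(* Let $\Omega\subset\mathbb C^n$ be open and let $\mathcal F$ be a plain sheaf over $\Omega$. Then every finitely generated $\mathcal O$-submodule of $\mathcal F$ is coherent.
   Context: For a complex Banach space $E$, $\mathcal O^E=\mathcal O^E_\Omega$ denotes the sheaf over $\Omega$ of germs of holomorphic functions with values in $E$; $\mathcal O=\mathcal O^{\mathbb C}$. Each $\mathcal O^E$ is a sheaf of $\mathcal O$-modules (simply "an $\mathcal O$-module"). The sheaves $\mathcal O^E$, $E$ any complex Banach space, are called plain sheaves. An $\mathcal O$-module is finitely generated if it is generated by finitely many sections, i.e. it is the image of a homomorphism from some $\mathcal O^{\oplus k}$, $k<\infty$. *)

theory Defs
  imports "HOL-Analysis.Analysis" "HOL-Algebra.Module"
begin

section \<open>Complex Banach spaces and holomorphic maps\<close>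

class complex_banach = banach +
  fixes scaleC :: "complex \<Rightarrow> 'a \<Rightarrow> 'a"  (infixr \<open>*\<^sub>C\<close> 75)
  assumes scaleC_add_right: "c *\<^sub>C (x + y) = c *\<^sub>C x + c *\<^sub>C y"
    and scaleC_add_left: "(c + d) *\<^sub>C x = c *\<^sub>C x + d *\<^sub>C x"
    and scaleC_scaleC: "c *\<^sub>C (d *\<^sub>C x) = (c * d) *\<^sub>C x"
    and scaleR_scaleC: "r *\<^sub>R x = complex_of_real r *\<^sub>C x"
    and norm_scaleC: "norm (c *\<^sub>C x) = cmod c * norm x"

instantiation complex :: complex_banach
begin

definition scaleC_complex :: "complex \<Rightarrow> complex \<Rightarrow> complex" where
  "scaleC_complex c z = c * z"

instance
  by standard (auto simp: scaleC_complex_def algebra_simps norm_mult scaleR_conv_of_real)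

end

lemma scaleC_one: "1 *\<^sub>C (x::'e::complex_banach) = x"
  using scaleR_scaleC[of 1 x] by simp

lemma bounded_bilinear_scaleC:
  "bounded_bilinear (scaleC :: complex \<Rightarrow> 'e::complex_banach \<Rightarrow> 'e)"
proof
  fix r :: real and c :: complex and x :: 'e
  show "(r *\<^sub>R c) *\<^sub>C x = r *\<^sub>R (c *\<^sub>C x)"
    by (simp add: scaleR_conv_of_real[of r c] scaleR_scaleC[of r "c *\<^sub>C x"] scaleC_scaleC)
  show "c *\<^sub>C (r *\<^sub>R x) = r *\<^sub>R (c *\<^sub>C x)"
    by (simp add: scaleR_scaleC scaleC_scaleC mult.commute)
  show "\<exists>K. \<forall>a b. norm (a *\<^sub>C (b::'e)) \<le> norm a * norm b * K"
    by (rule exI[of _ 1]) (simp add: norm_scaleC)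
qed (simp_all add: scaleC_add_left scaleC_add_right)

text \<open>Holomorphy is Frechet differentiability with complex-linear differential.\<close>

definition holomorphic_map :: "(complex^'n) set \<Rightarrow> (complex^'n \<Rightarrow> 'e::complex_banach) \<Rightarrow> bool" where
  "holomorphic_map U f \<longleftrightarrow>
     (\<forall>z\<in>U. \<exists>D. (f has_derivative D) (at z within U) \<and> (\<forall>c v. D (c *s v) = c *\<^sub>C D v))"

text \<open>Sections over \<open>U\<close> are functions on \<open>U\<close>; since HOL functions are total, they are
  normalised to be \<^const>\<open>undefined\<close> off \<open>U\<close>, so that equality of sections is equality on \<open>U\<close>.\<close>

definition hol_maps :: "(complex^'n) set \<Rightarrow> (complex^'n \<Rightarrow> 'e::complex_banach) set" where
  "hol_maps U = {f \<in> extensional U. holomorphic_map U f}"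

definition hol_ring :: "(complex^'n) set \<Rightarrow> (complex^'n \<Rightarrow> complex) ring" where
  "hol_ring U =
    \<lparr>carrier = hol_maps U,
     monoid.mult = (\<lambda>f g. \<lambda>z\<in>U. f z * g z),
     one = (\<lambda>z\<in>U. 1),
     zero = (\<lambda>z\<in>U. 0),
     add = (\<lambda>f g. \<lambda>z\<in>U. f z + g z)\<rparr>"


section \<open>Sheaves of \<open>\<O>\<close>-modules\<close>

text \<open>A sheaf is given by its modules of sections over open sets together with the restriction
  maps; \<open>restr F U V\<close> restricts from \<open>U\<close> to \<open>V\<close>. The base is an argument of the predicates
  below rather than part of the record, so a sheaf over \<open>\<Omega>\<close> restricted to an open
  \<open>V \<subseteq> \<Omega>\<close> is the same record considered over \<open>V\<close>.\<close>

record ('z, 'a) module_sheaf =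
  sections :: "'z set \<Rightarrow> ('z \<Rightarrow> complex, 'a) module"
  restr :: "'z set \<Rightarrow> 'z set \<Rightarrow> 'a \<Rightarrow> 'a"

locale O_module =
  fixes \<Omega> :: "(complex^'n) set" and F :: "(complex^'n, 'a) module_sheaf"
  assumes open_base: "open \<Omega>"
    and module_sections: "\<lbrakk>open U; U \<subseteq> \<Omega>\<rbrakk> \<Longrightarrow> Module.module (hol_ring U) (sections F U)"
    and restr_closed: "\<lbrakk>open U; U \<subseteq> \<Omega>; open V; V \<subseteq> U; s \<in> carrier (sections F U)\<rbrakk>
      \<Longrightarrow> restr F U V s \<in> carrier (sections F V)"
    and restr_add: "\<lbrakk>open U; U \<subseteq> \<Omega>; open V; V \<subseteq> U;
        s \<in> carrier (sections F U); t \<in> carrier (sections F U)\<rbrakk>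
      \<Longrightarrow> restr F U V (s \<oplus>\<^bsub>sections F U\<^esub> t) = restr F U V s \<oplus>\<^bsub>sections F V\<^esub> restr F U V t"
    and restr_smult: "\<lbrakk>open U; U \<subseteq> \<Omega>; open V; V \<subseteq> U;
        f \<in> carrier (hol_ring U); s \<in> carrier (sections F U)\<rbrakk>
      \<Longrightarrow> restr F U V (f \<odot>\<^bsub>sections F U\<^esub> s) = restrict f V \<odot>\<^bsub>sections F V\<^esub> restr F U V s"
    and restr_id: "\<lbrakk>open U; U \<subseteq> \<Omega>; s \<in> carrier (sections F U)\<rbrakk> \<Longrightarrow> restr F U U s = s"
    and restr_restr: "\<lbrakk>open U; U \<subseteq> \<Omega>; open V; V \<subseteq> U; open W; W \<subseteq> V;
        s \<in> carrier (sections F U)\<rbrakk> \<Longrightarrow> restr F V W (restr F U V s) = restr F U W s"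
    and gluing: "\<lbrakk>\<And>U. U \<in> \<U> \<Longrightarrow> open U \<and> U \<subseteq> \<Omega>;
        \<And>U. U \<in> \<U> \<Longrightarrow> \<sigma> U \<in> carrier (sections F U);
        \<And>U V. \<lbrakk>U \<in> \<U>; V \<in> \<U>\<rbrakk> \<Longrightarrow> restr F U (U \<inter> V) (\<sigma> U) = restr F V (U \<inter> V) (\<sigma> V)\<rbrakk>
      \<Longrightarrow> \<exists>!t. t \<in> carrier (sections F (\<Union>\<U>)) \<and> (\<forall>U\<in>\<U>. restr F (\<Union>\<U>) U t = \<sigma> U)"

text \<open>The plain sheaf \<open>\<O>\<^sup>E\<close>, with \<open>E\<close> the type \<open>'e\<close>; \<open>\<O>\<close> is the instance \<open>'e = complex\<close>.
  The multiplicative fields of the library's module record play no role.\<close>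

definition plain_sheaf :: "(complex^'n, complex^'n \<Rightarrow> 'e::complex_banach) module_sheaf" where
  "plain_sheaf =
    \<lparr>sections = (\<lambda>U.
       \<lparr>carrier = hol_maps U,
        monoid.mult = undefined,
        one = undefined,
        zero = (\<lambda>z\<in>U. 0),
        add = (\<lambda>f g. \<lambda>z\<in>U. f z + g z),
        smult = (\<lambda>a f. \<lambda>z\<in>U. a z *\<^sub>C f z)\<rparr>),
     restr = (\<lambda>U V f. restrict f V)\<rparr>"

definition direct_power ::
    "nat \<Rightarrow> ('z, 'a) module_sheaf \<Rightarrow> ('z, nat \<Rightarrow> 'a) module_sheaf" where
  "direct_power k F =
    \<lparr>sections = (\<lambda>U.
       \<lparr>carrier = (\<Pi>\<^sub>E i\<in>{..<k}. carrier (sections F U)),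
        monoid.mult = undefined,
        one = undefined,
        zero = (\<lambda>i\<in>{..<k}. \<zero>\<^bsub>sections F U\<^esub>),
        add = (\<lambda>s t. \<lambda>i\<in>{..<k}. s i \<oplus>\<^bsub>sections F U\<^esub> t i),
        smult = (\<lambda>a s. \<lambda>i\<in>{..<k}. a \<odot>\<^bsub>sections F U\<^esub> s i)\<rparr>),
     restr = (\<lambda>U V s. \<lambda>i\<in>{..<k}. restr F U V (s i))\<rparr>"

definition free_sheaf :: "nat \<Rightarrow> (complex^'n, nat \<Rightarrow> complex^'n \<Rightarrow> complex) module_sheaf" where
  "free_sheaf k = direct_power k plain_sheaf"


section \<open>Submodules and homomorphisms\<close>

definition O_submodule ::
    "(complex^'n) set \<Rightarrow> (complex^'n, 'a) module_sheaf \<Rightarrow> ((complex^'n) set \<Rightarrow> 'a set) \<Rightarrow> bool" where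
  "O_submodule \<Omega> F S \<longleftrightarrow>
     (\<forall>U. open U \<and> U \<subseteq> \<Omega> \<longrightarrow> submodule (S U) (hol_ring U) (sections F U)) \<and>
     (\<forall>U V s. open U \<and> U \<subseteq> \<Omega> \<and> open V \<and> V \<subseteq> U \<and> s \<in> S U \<longrightarrow> restr F U V s \<in> S V) \<and>
     (\<forall>U s. open U \<and> U \<subseteq> \<Omega> \<and> s \<in> carrier (sections F U) \<and>
        (\<forall>x\<in>U. \<exists>V. open V \<and> x \<in> V \<and> V \<subseteq> U \<and> restr F U V s \<in> S V) \<longrightarrow> s \<in> S U)"

definition subsheaf ::
    "('z, 'a) module_sheaf \<Rightarrow> ('z set \<Rightarrow> 'a set) \<Rightarrow> ('z, 'a) module_sheaf" where
  "subsheaf F S = \<lparr>sections = (\<lambda>U. (sections F U)\<lparr>carrier := S U\<rparr>), restr = restr F\<rparr>"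

definition O_hom ::
    "(complex^'n) set \<Rightarrow> (complex^'n, 'a) module_sheaf \<Rightarrow> (complex^'n, 'b) module_sheaf
      \<Rightarrow> ((complex^'n) set \<Rightarrow> 'a \<Rightarrow> 'b) \<Rightarrow> bool" where
  "O_hom \<Omega> F G \<phi> \<longleftrightarrow>
     (\<forall>U. open U \<and> U \<subseteq> \<Omega> \<longrightarrow>
        \<phi> U \<in> carrier (sections F U) \<rightarrow> carrier (sections G U) \<and>
        (\<forall>s\<in>carrier (sections F U). \<forall>t\<in>carrier (sections F U).
           \<phi> U (s \<oplus>\<^bsub>sections F U\<^esub> t) = \<phi> U s \<oplus>\<^bsub>sections G U\<^esub> \<phi> U t) \<and>
        (\<forall>a\<in>carrier (hol_ring U). \<forall>s\<in>carrier (sections F U).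
           \<phi> U (a \<odot>\<^bsub>sections F U\<^esub> s) = a \<odot>\<^bsub>sections G U\<^esub> \<phi> U s) \<and>
        (\<forall>V. open V \<and> V \<subseteq> U \<longrightarrow>
           (\<forall>s\<in>carrier (sections F U). \<phi> V (restr F U V s) = restr G U V (\<phi> U s))))"

definition hom_kernel ::
    "(complex^'n, 'a) module_sheaf \<Rightarrow> (complex^'n, 'b) module_sheaf
      \<Rightarrow> ((complex^'n) set \<Rightarrow> 'a \<Rightarrow> 'b) \<Rightarrow> (complex^'n) set \<Rightarrow> 'a set" where
  "hom_kernel F G \<phi> U = {s \<in> carrier (sections F U). \<phi> U s = \<zero>\<^bsub>sections G U\<^esub>}"

text \<open>The sheaf image: sections that are locally, not necessarily globally, in the image.\<close>

definition hom_image ::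
    "(complex^'n, 'a) module_sheaf \<Rightarrow> (complex^'n, 'b) module_sheaf
      \<Rightarrow> ((complex^'n) set \<Rightarrow> 'a \<Rightarrow> 'b) \<Rightarrow> (complex^'n) set \<Rightarrow> 'b set" where
  "hom_image F G \<phi> U = {s \<in> carrier (sections G U).
     \<forall>x\<in>U. \<exists>V. open V \<and> x \<in> V \<and> V \<subseteq> U \<and> restr G U V s \<in> \<phi> V ` carrier (sections F V)}"


section \<open>Finite generation and coherence\<close>

definition finitely_generated ::
    "(complex^'n) set \<Rightarrow> (complex^'n, 'a) module_sheaf \<Rightarrow> bool" where
  "finitely_generated \<Omega> F \<longleftrightarrow>
     (\<exists>k \<phi>. O_hom \<Omega> (free_sheaf k) F \<phi> \<and>
        (\<forall>U. open U \<and> U \<subseteq> \<Omega> \<longrightarrow> hom_image (free_sheaf k) F \<phi> U = carrier (sections F U)))"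

definition locally_finitely_generated ::
    "(complex^'n) set \<Rightarrow> (complex^'n, 'a) module_sheaf \<Rightarrow> bool" where
  "locally_finitely_generated \<Omega> F \<longleftrightarrow>
     (\<forall>x\<in>\<Omega>. \<exists>V. open V \<and> x \<in> V \<and> V \<subseteq> \<Omega> \<and> finitely_generated V F)"

definition coherent_sheaf ::
    "(complex^'n) set \<Rightarrow> (complex^'n, 'a) module_sheaf \<Rightarrow> bool" where
  "coherent_sheaf \<Omega> F \<longleftrightarrow>
     O_module \<Omega> F \<and>
     locally_finitely_generated \<Omega> F \<and>
     (\<forall>U k \<phi>. open U \<and> U \<subseteq> \<Omega> \<and> O_hom U (free_sheaf k) F \<phi> \<longrightarrow>
        locally_finitely_generated U (subsheaf (free_sheaf k) (hom_kernel (free_sheaf k) F \<phi>)))"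


section \<open>The constructions above are sheaves of \<open>\<O>\<close>-modules\<close>

lemma holomorphic_map_add:
  fixes f g :: "complex^'n \<Rightarrow> 'e::complex_banach"
  assumes "holomorphic_map U f" "holomorphic_map U g"
  shows "holomorphic_map U (\<lambda>z. f z + g z)"
  unfolding holomorphic_map_def
proof
  fix z assume z: "z \<in> U"
  obtain D where D: "(f has_derivative D) (at z within U)" "\<And>c v. D (c *s v) = c *\<^sub>C D v"
    using assms(1) z unfolding holomorphic_map_def by blast
  obtain D' where D': "(g has_derivative D') (at z within U)" "\<And>c v. D' (c *s v) = c *\<^sub>C D' v"
    using assms(2) z unfolding holomorphic_map_def by blast
  show "\<exists>D. ((\<lambda>z. f z + g z) has_derivative D) (at z within U) \<and> (\<forall>c v. D (c *s v) = c *\<^sub>C D v)"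
    by (rule exI[of _ "\<lambda>v. D v + D' v"])
      (use D D' in \<open>auto intro!: has_derivative_add simp: scaleC_add_right\<close>)
qed

lemma holomorphic_map_scaleC:
  fixes f :: "complex^'n \<Rightarrow> 'e::complex_banach" and a :: "complex^'n \<Rightarrow> complex"
  assumes "holomorphic_map U a" "holomorphic_map U f"
  shows "holomorphic_map U (\<lambda>z. a z *\<^sub>C f z)"
  unfolding holomorphic_map_def
proof
  fix z assume z: "z \<in> U"
  obtain D where D: "(a has_derivative D) (at z within U)" "\<And>c v. D (c *s v) = c *\<^sub>C D v"
    using assms(1) z unfolding holomorphic_map_def by blast
  obtain D' where D': "(f has_derivative D') (at z within U)" "\<And>c v. D' (c *s v) = c *\<^sub>C D' v"
    using assms(2) z unfolding holomorphic_map_def by blast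
  have "((\<lambda>z. a z *\<^sub>C f z) has_derivative (\<lambda>v. a z *\<^sub>C D' v + D v *\<^sub>C f z)) (at z within U)"
    by (rule bounded_bilinear.FDERIV[OF bounded_bilinear_scaleC D(1) D'(1)])
  moreover have "a z *\<^sub>C D' (c *s v) + D (c *s v) *\<^sub>C f z = c *\<^sub>C (a z *\<^sub>C D' v + D v *\<^sub>C f z)" for c v
    by (simp add: D(2) D'(2) scaleC_add_right scaleC_scaleC mult.commute scaleC_complex_def)
  ultimately show "\<exists>D. ((\<lambda>z. a z *\<^sub>C f z) has_derivative D) (at z within U) \<and> (\<forall>c v. D (c *s v) = c *\<^sub>C D v)"
    by blast
qed

lemma holomorphic_map_const: "holomorphic_map U (\<lambda>z. (c::'e::complex_banach))"
  unfolding holomorphic_map_def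
proof
  fix z assume "z \<in> U"
  have "c *\<^sub>C (0::'e) = 0" for c
    using norm_scaleC[of c "0::'e"] by simp
  then show "\<exists>D. ((\<lambda>z. c) has_derivative D) (at z within U) \<and> (\<forall>c v. D (c *s v) = c *\<^sub>C D v)"
    by (intro exI[of _ "\<lambda>_. 0"]) auto
qed

lemma holomorphic_map_cong:
  assumes "\<And>z. z \<in> U \<Longrightarrow> f z = g z"
  shows "holomorphic_map U f \<longleftrightarrow> holomorphic_map U g"
proof -
  have "(f has_derivative D) (at z within U) = (g has_derivative D) (at z within U)" if "z \<in> U" for z D
    using has_derivative_transform[OF that, of f g D] has_derivative_transform[OF that, of g f D] assms by metis
  then show ?thesis unfolding holomorphic_map_def by auto
qed

lemma holomorphic_map_subset: "holomorphic_map U f \<Longrightarrow> V \<subseteq> U \<Longrightarrow> holomorphic_map V f"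
  unfolding holomorphic_map_def by (meson has_derivative_subset subsetD)

lemma hol_maps_restrict: "(\<lambda>z\<in>U. f z) \<in> hol_maps U \<longleftrightarrow> holomorphic_map U f"
  unfolding hol_maps_def using holomorphic_map_cong[of U "restrict f U" f] by auto

lemma hol_mapsD: "f \<in> hol_maps U \<Longrightarrow> holomorphic_map U f"
  by (simp add: hol_maps_def)

lemma hol_maps_eqI: "f \<in> hol_maps U \<Longrightarrow> g \<in> hol_maps U \<Longrightarrow> (\<And>z. z \<in> U \<Longrightarrow> f z = g z) \<Longrightarrow> f = g"
  by (auto simp: hol_maps_def intro: extensionalityI)

lemma holomorphic_map_uminus:
  fixes f :: "complex^'n \<Rightarrow> 'e::complex_banach"
  assumes "holomorphic_map U f" shows "holomorphic_map U (\<lambda>z. - f z)"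
proof -
  have "(-1) *\<^sub>C x = - x" for x :: 'e
    using scaleR_scaleC[of "-1" x] by simp
  then show ?thesis
    using holomorphic_map_scaleC[OF holomorphic_map_const[of U "-1"] assms] by simp
qed

lemma hol_maps_intros:
  "f \<in> hol_maps U \<Longrightarrow> g \<in> hol_maps U \<Longrightarrow> (\<lambda>z\<in>U. f z + g z) \<in> hol_maps U"
  "f \<in> hol_maps U \<Longrightarrow> (\<lambda>z\<in>U. - f z) \<in> hol_maps U"
  "a \<in> hol_maps U \<Longrightarrow> f \<in> hol_maps U \<Longrightarrow> (\<lambda>z\<in>U. a z *\<^sub>C f z) \<in> hol_maps U"
  "a \<in> hol_maps U \<Longrightarrow> b \<in> hol_maps U \<Longrightarrow> (\<lambda>z\<in>U. a z * (b z :: complex)) \<in> hol_maps U"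
  "(\<lambda>z\<in>U. c) \<in> hol_maps U"
  unfolding hol_maps_restrict
  using holomorphic_map_scaleC[of U a b]
  by (auto intro!: holomorphic_map_add holomorphic_map_uminus holomorphic_map_scaleC
    holomorphic_map_const dest!: hol_mapsD simp: scaleC_complex_def)

lemma hol_maps_ext: "f \<in> hol_maps U \<Longrightarrow> restrict f U = f"
  by (simp add: hol_maps_def extensional_restrict)

lemma hol_ring_cring: "cring (hol_ring U)"
proof (rule cringI)
  show "abelian_group (hol_ring U)"
  proof (rule abelian_groupI)
    fix x assume "x \<in> carrier (hol_ring U)"
    then show "\<exists>y\<in>carrier (hol_ring U). y \<oplus>\<^bsub>hol_ring U\<^esub> x = \<zero>\<^bsub>hol_ring U\<^esub>"
      by (intro bexI[of _ "\<lambda>z\<in>U. - x z"]) (auto simp: hol_ring_def intro!: hol_maps_intros)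
  qed (auto simp: hol_ring_def hol_maps_ext algebra_simps intro!: hol_maps_intros cong: restrict_cong)
  show "comm_monoid (hol_ring U)"
    by (rule comm_monoidI)
      (auto simp: hol_ring_def hol_maps_ext algebra_simps intro!: hol_maps_intros cong: restrict_cong)
qed (auto simp: hol_ring_def algebra_simps cong: restrict_cong)

lemma holomorphic_map_local:
  assumes "\<And>x. x \<in> U \<Longrightarrow> \<exists>V. open V \<and> x \<in> V \<and> holomorphic_map (U \<inter> V) f"
  shows "holomorphic_map U f"
  unfolding holomorphic_map_def
proof
  fix z assume z: "z \<in> U"
  obtain V where V: "open V" "z \<in> V" "holomorphic_map (U \<inter> V) f" using assms z by blast
  have "at z within (U \<inter> V) = at z within U"
    using V z by (intro at_within_nhd[of z V]) auto
  moreover obtain D where "(f has_derivative D) (at z within (U \<inter> V))" "\<And>c v. D (c *s v) = c *\<^sub>C D v"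
    using V z unfolding holomorphic_map_def by blast
  ultimately show "\<exists>D. (f has_derivative D) (at z within U) \<and> (\<forall>c v. D (c *s v) = c *\<^sub>C D v)"
    by auto
qed

lemma plain_sections_module:
  "Module.module (hol_ring U)
    (sections (plain_sheaf :: (complex^'n, complex^'n \<Rightarrow> 'e::complex_banach) module_sheaf) U)"
    (is "Module.module _ ?M")
proof (rule moduleI[OF hol_ring_cring])
  show "abelian_group ?M"
  proof (rule abelian_groupI)
    fix x assume "x \<in> carrier ?M"
    then show "\<exists>y\<in>carrier ?M. y \<oplus>\<^bsub>?M\<^esub> x = \<zero>\<^bsub>?M\<^esub>"
      by (intro bexI[of _ "\<lambda>z\<in>U. - x z"]) (auto simp: plain_sheaf_def intro!: hol_maps_intros)
  qed (auto simp: plain_sheaf_def hol_maps_ext algebra_simps intro!: hol_maps_intros cong: restrict_cong)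
qed (auto simp: plain_sheaf_def hol_ring_def hol_maps_ext scaleC_add_left scaleC_add_right
       scaleC_scaleC scaleC_one intro!: hol_maps_intros cong: restrict_cong)

lemma O_submoduleI:
  assumes "\<And>U. open U \<Longrightarrow> U \<subseteq> \<Omega> \<Longrightarrow> submodule (S U) (hol_ring U) (sections F U)"
    and "\<And>U V s. \<lbrakk>open U; U \<subseteq> \<Omega>; open V; V \<subseteq> U; s \<in> S U\<rbrakk> \<Longrightarrow> restr F U V s \<in> S V"
    and "\<And>U s. \<lbrakk>open U; U \<subseteq> \<Omega>; s \<in> carrier (sections F U);
        \<forall>x\<in>U. \<exists>V. open V \<and> x \<in> V \<and> V \<subseteq> U \<and> restr F U V s \<in> S V\<rbrakk> \<Longrightarrow> s \<in> S U"
  shows "O_submodule \<Omega> F S"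
  unfolding O_submodule_def by (intro conjI allI impI; (elim conjE)?; rule assms; assumption)

lemma O_submoduleD:
  assumes "O_submodule \<Omega> F S"
  shows "\<lbrakk>open U; U \<subseteq> \<Omega>\<rbrakk> \<Longrightarrow> submodule (S U) (hol_ring U) (sections F U)"
    and "\<lbrakk>open U; U \<subseteq> \<Omega>; open V; V \<subseteq> U; s \<in> S U\<rbrakk> \<Longrightarrow> restr F U V s \<in> S V"
    and "\<lbrakk>open U; U \<subseteq> \<Omega>; s \<in> carrier (sections F U);
        \<forall>x\<in>U. \<exists>V. open V \<and> x \<in> V \<and> V \<subseteq> U \<and> restr F U V s \<in> S V\<rbrakk> \<Longrightarrow> s \<in> S U"
  using assms unfolding O_submodule_def by metis+

lemma O_homD:
  assumes "O_hom \<Omega> F G \<phi>" "open U" "U \<subseteq> \<Omega>"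
  shows "\<phi> U \<in> carrier (sections F U) \<rightarrow> carrier (sections G U)"
    and "\<lbrakk>s \<in> carrier (sections F U); t \<in> carrier (sections F U)\<rbrakk>
      \<Longrightarrow> \<phi> U (s \<oplus>\<^bsub>sections F U\<^esub> t) = \<phi> U s \<oplus>\<^bsub>sections G U\<^esub> \<phi> U t"
    and "\<lbrakk>a \<in> carrier (hol_ring U); s \<in> carrier (sections F U)\<rbrakk>
      \<Longrightarrow> \<phi> U (a \<odot>\<^bsub>sections F U\<^esub> s) = a \<odot>\<^bsub>sections G U\<^esub> \<phi> U s"
    and "\<lbrakk>open V; V \<subseteq> U; s \<in> carrier (sections F U)\<rbrakk>
      \<Longrightarrow> \<phi> V (restr F U V s) = restr G U V (\<phi> U s)"
  using assms unfolding O_hom_def by simp_all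

lemma plain_sheaf_O_module:
  assumes "open \<Omega>"
  shows "O_module \<Omega> (plain_sheaf :: (complex^'n, complex^'n \<Rightarrow> 'e::complex_banach) module_sheaf)"
    (is "O_module _ ?P")
proof (rule O_module.intro)
  show "open \<Omega>" by fact
  show "Module.module (hol_ring U) (sections ?P U)" if "open U" "U \<subseteq> \<Omega>" for U
    by (rule plain_sections_module)
next
  fix \<U> :: "(complex^'n) set set" and \<sigma> :: "(complex^'n) set \<Rightarrow> complex^'n \<Rightarrow> 'e"
  assume op: "\<And>U. U \<in> \<U> \<Longrightarrow> open U \<and> U \<subseteq> \<Omega>"
    and sec: "\<And>U. U \<in> \<U> \<Longrightarrow> \<sigma> U \<in> carrier (sections ?P U)"
    and comp: "\<And>U V. \<lbrakk>U \<in> \<U>; V \<in> \<U>\<rbrakk> \<Longrightarrow> restr ?P U (U \<inter> V) (\<sigma> U) = restr ?P V (U \<inter> V) (\<sigma> V)"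
  have eq: "\<sigma> U z = \<sigma> V z" if "U \<in> \<U>" "V \<in> \<U>" "z \<in> U" "z \<in> V" for U V z
    using fun_cong[OF comp[OF that(1,2)], of z] that(3,4) by (simp add: plain_sheaf_def)
  define t where "t = (\<lambda>z\<in>\<Union>\<U>. \<sigma> (SOME U. U \<in> \<U> \<and> z \<in> U) z)"
  have t: "t z = \<sigma> U z" if "U \<in> \<U>" "z \<in> U" for U z
    using someI[of "\<lambda>U. U \<in> \<U> \<and> z \<in> U", OF conjI[OF that]] that unfolding t_def
    by (auto intro!: eq)
  have hol: "holomorphic_map (\<Union>\<U>) t"
  proof (rule holomorphic_map_local)
    fix x assume "x \<in> \<Union>\<U>"
    then obtain U where U: "U \<in> \<U>" "x \<in> U" by blast
    then have "holomorphic_map U (\<sigma> U)" using sec[of U] by (auto simp: plain_sheaf_def hol_maps_def)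
    then have "holomorphic_map U t" using holomorphic_map_cong[of U t "\<sigma> U"] t U by auto
    moreover have "\<Union>\<U> \<inter> U = U" using U by auto
    ultimately show "\<exists>V. open V \<and> x \<in> V \<and> holomorphic_map (\<Union>\<U> \<inter> V) t"
      using U op by metis
  qed
  show "\<exists>!t. t \<in> carrier (sections ?P (\<Union>\<U>)) \<and> (\<forall>U\<in>\<U>. restr ?P (\<Union>\<U>) U t = \<sigma> U)"
  proof (rule ex1I[of _ t], intro conjI ballI)
    show "t \<in> carrier (sections ?P (\<Union>\<U>))"
      using hol by (simp add: plain_sheaf_def hol_maps_def t_def)
    fix U assume U: "U \<in> \<U>"
    show "restr ?P (\<Union>\<U>) U t = \<sigma> U"
      using sec[OF U] t[OF U] by (auto simp: plain_sheaf_def hol_maps_def extensional_def fun_eq_iff)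
  next
    fix t' assume t': "t' \<in> carrier (sections ?P (\<Union>\<U>)) \<and> (\<forall>U\<in>\<U>. restr ?P (\<Union>\<U>) U t' = \<sigma> U)"
    have v: "t' z = \<sigma> U z" if "U \<in> \<U>" "z \<in> U" for U z
    proof -
      have "restrict t' U = \<sigma> U" using t' that by (auto simp: plain_sheaf_def)
      then show ?thesis using that by (metis restrict_apply')
    qed
    show "t' = t"
    proof (rule extensionalityI[of _ "\<Union>\<U>"])
      show "t' \<in> extensional (\<Union>\<U>)" using t' by (auto simp: plain_sheaf_def hol_maps_def)
      show "t \<in> extensional (\<Union>\<U>)" by (simp add: t_def)
      show "t' z = t z" if "z \<in> \<Union>\<U>" for z using that v t by force
    qed
  qed
qed (auto simp: plain_sheaf_def hol_ring_def hol_maps_restrict fun_eq_iff hol_maps_ext subset_iff Int_absorb1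
    intro: holomorphic_map_subset dest: hol_mapsD, (auto simp: hol_maps_def extensional_def)?)

lemma subsheaf_O_module:
  assumes "O_module \<Omega> F" "O_submodule \<Omega> F S"
  shows "O_module \<Omega> (subsheaf F S)"
proof -
  interpret O_module \<Omega> F by fact
  have sm: "\<And>U. open U \<Longrightarrow> U \<subseteq> \<Omega> \<Longrightarrow> submodule (S U) (hol_ring U) (sections F U)"
    and rc: "\<And>U V s. open U \<Longrightarrow> U \<subseteq> \<Omega> \<Longrightarrow> open V \<Longrightarrow> V \<subseteq> U \<Longrightarrow> s \<in> S U \<Longrightarrow> restr F U V s \<in> S V"
    and loc: "\<And>U s. open U \<Longrightarrow> U \<subseteq> \<Omega> \<Longrightarrow> s \<in> carrier (sections F U) \<Longrightarrow>
        (\<And>x. x\<in>U \<Longrightarrow> \<exists>V. open V \<and> x \<in> V \<and> V \<subseteq> U \<and> restr F U V s \<in> S V) \<Longrightarrow> s \<in> S U"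
    using O_submoduleD[OF assms(2)] by metis+
  have sub: "s \<in> carrier (sections F U)" if "open U" "U \<subseteq> \<Omega>" "s \<in> S U" for U s
    using module.submoduleE(1)[OF module_sections[OF that(1,2)] sm[OF that(1,2)]] that(3) by blast
  show ?thesis
  proof (rule O_module.intro)
    show "open \<Omega>" by (rule open_base)
    show "Module.module (hol_ring U) (sections (subsheaf F S) U)" if "open U" "U \<subseteq> \<Omega>" for U
      using submodule.submodule_is_module[OF sm[OF that] module_sections[OF that]]
      by (simp add: subsheaf_def)
  next
    fix \<U> \<sigma>
    assume op: "\<And>U. U \<in> \<U> \<Longrightarrow> open U \<and> U \<subseteq> \<Omega>"
      and sec: "\<And>U. U \<in> \<U> \<Longrightarrow> \<sigma> U \<in> carrier (sections (subsheaf F S) U)"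
      and comp: "\<And>U V. \<lbrakk>U \<in> \<U>; V \<in> \<U>\<rbrakk> \<Longrightarrow>
        restr (subsheaf F S) U (U \<inter> V) (\<sigma> U) = restr (subsheaf F S) V (U \<inter> V) (\<sigma> V)"
    have sec': "\<And>U. U \<in> \<U> \<Longrightarrow> \<sigma> U \<in> S U" using sec by (simp add: subsheaf_def)
    have ex1: "\<exists>!t. t \<in> carrier (sections F (\<Union>\<U>)) \<and> (\<forall>U\<in>\<U>. restr F (\<Union>\<U>) U t = \<sigma> U)"
      by (rule gluing) (use op sec' sub comp in \<open>auto simp: subsheaf_def\<close>)
    have o: "open (\<Union>\<U>)" "\<Union>\<U> \<subseteq> \<Omega>" using op by auto
    have "t \<in> S (\<Union>\<U>)" if "t \<in> carrier (sections F (\<Union>\<U>))" "\<forall>U\<in>\<U>. restr F (\<Union>\<U>) U t = \<sigma> U" for t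
    proof (rule loc[OF o that(1)])
      fix x assume "x \<in> \<Union>\<U>"
      then obtain U where "U \<in> \<U>" "x \<in> U" by blast
      then show "\<exists>V. open V \<and> x \<in> V \<and> V \<subseteq> \<Union>\<U> \<and> restr F (\<Union>\<U>) V t \<in> S V"
        using op sec' that(2) by (intro exI[of _ U]) auto
    qed
    then have "(t \<in> S (\<Union>\<U>) \<and> (\<forall>U\<in>\<U>. restr F (\<Union>\<U>) U t = \<sigma> U)) \<longleftrightarrow>
        (t \<in> carrier (sections F (\<Union>\<U>)) \<and> (\<forall>U\<in>\<U>. restr F (\<Union>\<U>) U t = \<sigma> U))" for t
      using sub[OF o, of t] by metis
    then show "\<exists>!t. t \<in> carrier (sections (subsheaf F S) (\<Union>\<U>)) \<and>
        (\<forall>U\<in>\<U>. restr (subsheaf F S) (\<Union>\<U>) U t = \<sigma> U)"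
      using ex1 by (simp add: subsheaf_def)
  qed (auto simp: subsheaf_def restr_add restr_smult restr_id restr_restr rc sub)
qed

lemma hom_kernel_submodule:
  assumes F: "O_module \<Omega> F" and G: "O_module \<Omega> G" and "O_hom \<Omega> F G \<phi>"
  shows "O_submodule \<Omega> F (hom_kernel F G \<phi>)"
proof -
  interpret F: O_module \<Omega> F by fact
  interpret G: O_module \<Omega> G by fact
  have z: "restr G U V \<zero>\<^bsub>sections G U\<^esub> = \<zero>\<^bsub>sections G V\<^esub>" if "open U" "U \<subseteq> \<Omega>" "open V" "V \<subseteq> U" for U V
  proof -
    interpret a: Module.module "hol_ring U" "sections G U" using G.module_sections that by blast
    interpret b: Module.module "hol_ring V" "sections G V" using G.module_sections that by (meson order_trans)
    have "restr G U V (\<zero>\<^bsub>sections G U\<^esub> \<oplus>\<^bsub>sections G U\<^esub> \<zero>\<^bsub>sections G U\<^esub>) = restr G U V \<zero>\<^bsub>sections G U\<^esub> \<oplus>\<^bsub>sections G V\<^esub> restr G U V \<zero>\<^bsub>sections G U\<^esub>"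
      using that by (intro G.restr_add) auto
    moreover have "restr G U V \<zero>\<^bsub>sections G U\<^esub> \<in> carrier (sections G V)"
      using that by (intro G.restr_closed) auto
    ultimately show ?thesis by (simp add: b.M.add.l_cancel_one')
  qed
  show ?thesis
  proof (rule O_submoduleI)
    fix U assume U: "open U" "U \<subseteq> \<Omega>"
    interpret a: Module.module "hol_ring U" "sections F U" by (rule F.module_sections[OF U])
    interpret b: Module.module "hol_ring U" "sections G U" by (rule G.module_sections[OF U])
    have h: "\<phi> U \<in> carrier (sections F U) \<rightarrow> carrier (sections G U)"
      "\<And>s t. s\<in>carrier (sections F U) \<Longrightarrow> t \<in> carrier (sections F U) \<Longrightarrow>
           \<phi> U (s \<oplus>\<^bsub>sections F U\<^esub> t) = \<phi> U s \<oplus>\<^bsub>sections G U\<^esub> \<phi> U t"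
      "\<And>a s. a\<in>carrier (hol_ring U) \<Longrightarrow> s\<in>carrier (sections F U) \<Longrightarrow>
           \<phi> U (a \<odot>\<^bsub>sections F U\<^esub> s) = a \<odot>\<^bsub>sections G U\<^esub> \<phi> U s"
      using O_homD[OF assms(3) U] by metis+
    have h0: "\<phi> U \<zero>\<^bsub>sections F U\<^esub> = \<zero>\<^bsub>sections G U\<^esub>"
      using h(3)[of "\<zero>\<^bsub>hol_ring U\<^esub>" "\<zero>\<^bsub>sections F U\<^esub>"] funcset_mem[OF h(1)] by simp
    show "submodule (hom_kernel F G \<phi> U) (hol_ring U) (sections F U)"
    proof (rule a.submoduleI)
      fix s assume s: "s \<in> hom_kernel F G \<phi> U"
      then have sc: "s \<in> carrier (sections F U)" "\<phi> U s = \<zero>\<^bsub>sections G U\<^esub>" by (auto simp: hom_kernel_def)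
      have "\<phi> U (s \<oplus>\<^bsub>sections F U\<^esub> (\<ominus>\<^bsub>sections F U\<^esub> s)) = \<phi> U (\<ominus>\<^bsub>sections F U\<^esub> s)"
        using sc h(1) by (subst h(2)) (auto simp: Pi_iff)
      then show "\<ominus>\<^bsub>sections F U\<^esub> s \<in> hom_kernel F G \<phi> U"
        using sc h0 by (auto simp: hom_kernel_def a.M.r_neg)
    qed (auto simp: hom_kernel_def h h0)
  next
    fix U V s assume "open U" "U \<subseteq> \<Omega>" "open V" "V \<subseteq> U" "s \<in> hom_kernel F G \<phi> U"
    then show "restr F U V s \<in> hom_kernel F G \<phi> V"
      using z by (auto simp: hom_kernel_def F.restr_closed O_homD(4)[OF assms(3)])
  next
    fix U s assume U: "open U" "U \<subseteq> \<Omega>" "s \<in> carrier (sections F U)"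
      and loc: "\<forall>x\<in>U. \<exists>V. open V \<and> x \<in> V \<and> V \<subseteq> U \<and> restr F U V s \<in> hom_kernel F G \<phi> V"
    let ?C = "{V. open V \<and> V \<subseteq> U \<and> restr F U V s \<in> hom_kernel F G \<phi> V}"
    have un: "\<Union>?C = U" using loc by blast
    have m: "Module.module (hol_ring V) (sections G V)" if "open V" "V \<subseteq> U" for V
      using G.module_sections that U by auto
    have ps: "\<phi> U s \<in> carrier (sections G U)" "\<And>V. open V \<Longrightarrow> V \<subseteq> U \<Longrightarrow> \<phi> V (restr F U V s) = restr G U V (\<phi> U s)"
      using O_homD(1,4)[OF assms(3) U(1,2)] U(3) by (auto simp: Pi_iff)
    have zc: "\<And>V. open V \<Longrightarrow> V \<subseteq> U \<Longrightarrow> \<zero>\<^bsub>sections G V\<^esub> \<in> carrier (sections G V)"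
      using m by (meson abelian_group.axioms(1) abelian_monoid.zero_closed module.axioms(2))
    have "\<exists>!t. t \<in> carrier (sections G (\<Union>?C)) \<and> (\<forall>V\<in>?C. restr G (\<Union>?C) V t = \<zero>\<^bsub>sections G V\<^esub>)"
    proof (rule G.gluing)
      fix V W assume vw: "V \<in> ?C" "W \<in> ?C"
      have "restr G V (V \<inter> W) \<zero>\<^bsub>sections G V\<^esub> = \<zero>\<^bsub>sections G (V \<inter> W)\<^esub>"
       "restr G W (V \<inter> W) \<zero>\<^bsub>sections G W\<^esub> = \<zero>\<^bsub>sections G (V \<inter> W)\<^esub>"
        by (rule z; use vw U in auto)+
      then show "restr G V (V \<inter> W) \<zero>\<^bsub>sections G V\<^esub> = restr G W (V \<inter> W) \<zero>\<^bsub>sections G W\<^esub>" by simp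
    qed (use U zc in auto)
    moreover have "\<forall>V\<in>?C. restr G U V (\<phi> U s) = \<zero>\<^bsub>sections G V\<^esub>"
      using ps(2) by (auto simp: hom_kernel_def)
    moreover have "\<forall>V\<in>?C. restr G U V \<zero>\<^bsub>sections G U\<^esub> = \<zero>\<^bsub>sections G V\<^esub>"
      using z U by auto
    ultimately have "\<phi> U s = \<zero>\<^bsub>sections G U\<^esub>"
      unfolding un using ps(1) zc[OF U(1)] by blast
    then show "s \<in> hom_kernel F G \<phi> U" using U by (simp add: hom_kernel_def)
  qed
qed


lemma direct_power_O_module:
  fixes F :: "(complex^'n, 'b) module_sheaf"
  assumes "O_module \<Omega> F"
  shows "O_module \<Omega> (direct_power k F)"
proof -
  interpret O_module \<Omega> F by fact
  have mem: "x i \<in> carrier (sections F U)"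
    if "x \<in> {..<k} \<rightarrow>\<^sub>E carrier (sections F U)" "i < k" for x i U
    using PiE_mem[OF that(1)] that(2) by simp
  show ?thesis
  proof (rule O_module.intro)
    show "open \<Omega>" by (rule open_base)
  next
    fix U assume U: "open U" "U \<subseteq> \<Omega>"
    interpret a: Module.module "hol_ring U" "sections F U" by (rule module_sections[OF U])
    let ?M = "sections (direct_power k F) U"
    show "Module.module (hol_ring U) ?M"
    proof (rule moduleI[OF a.R.is_cring])
      show "abelian_group ?M"
      proof (rule abelian_groupI)
        fix x assume "x \<in> carrier ?M"
        then have x: "i < k \<Longrightarrow> x i \<in> carrier (sections F U)" for i
          by (auto simp: direct_power_def)
        show "\<exists>y\<in>carrier ?M. y \<oplus>\<^bsub>?M\<^esub> x = \<zero>\<^bsub>?M\<^esub>"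
          by (rule bexI[of _ "\<lambda>i\<in>{..<k}. \<ominus>\<^bsub>sections F U\<^esub> x i"])
            (simp_all add: direct_power_def a.M.l_neg x cong: restrict_cong)
      next
        fix x assume "x \<in> carrier ?M"
        then have "x \<in> extensional {..<k}" "\<And>i. i < k \<Longrightarrow> x i \<in> carrier (sections F U)"
          by (auto simp: direct_power_def PiE_def)
        then show "\<zero>\<^bsub>?M\<^esub> \<oplus>\<^bsub>?M\<^esub> x = x"
          by (intro extensionalityI[of _ "{..<k}"]) (simp_all add: direct_power_def)
      qed (simp_all add: direct_power_def mem restrict_PiE_iff a.M.a_ac cong: restrict_cong)
    next
      fix x assume "x \<in> carrier ?M"
      then have "x \<in> extensional {..<k}" "\<And>i. i < k \<Longrightarrow> x i \<in> carrier (sections F U)"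
        by (auto simp: direct_power_def PiE_def)
      then show "\<one>\<^bsub>hol_ring U\<^esub> \<odot>\<^bsub>?M\<^esub> x = x"
        by (intro extensionalityI[of _ "{..<k}"]) (simp_all add: direct_power_def)
    qed (simp_all add: direct_power_def mem restrict_PiE_iff a.smult_l_distr a.smult_r_distr
         a.smult_assoc1 cong: restrict_cong)
  next
    fix \<U> \<sigma>
    let ?P = "direct_power k F"
    assume op: "\<And>U. U \<in> \<U> \<Longrightarrow> open U \<and> U \<subseteq> \<Omega>"
      and sec: "\<And>U. U \<in> \<U> \<Longrightarrow> \<sigma> U \<in> carrier (sections ?P U)"
      and comp: "\<And>U V. \<lbrakk>U \<in> \<U>; V \<in> \<U>\<rbrakk> \<Longrightarrow> restr ?P U (U \<inter> V) (\<sigma> U) = restr ?P V (U \<inter> V) (\<sigma> V)"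
    have c: "restr F U (U \<inter> V) (\<sigma> U i) = restr F V (U \<inter> V) (\<sigma> V i)" if "U \<in> \<U>" "V \<in> \<U>" "i < k" for U V i
      using fun_cong[OF comp[OF that(1,2)], of i] that(3) by (simp add: direct_power_def)
    have ex: "\<exists>!t. t \<in> carrier (sections F (\<Union>\<U>)) \<and> (\<forall>U\<in>\<U>. restr F (\<Union>\<U>) U t = \<sigma> U i)" if "i < k" for i
      by (rule gluing) (use op sec c that in \<open>auto simp: direct_power_def mem\<close>)
    define t where "t = (\<lambda>i\<in>{..<k}. THE t. t \<in> carrier (sections F (\<Union>\<U>)) \<and> (\<forall>U\<in>\<U>. restr F (\<Union>\<U>) U t = \<sigma> U i))"
    have t: "t i \<in> carrier (sections F (\<Union>\<U>)) \<and> (\<forall>U\<in>\<U>. restr F (\<Union>\<U>) U (t i) = \<sigma> U i)" if "i < k" for i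
      using theI'[OF ex[OF that]] that unfolding t_def by simp
    show "\<exists>!t. t \<in> carrier (sections ?P (\<Union>\<U>)) \<and> (\<forall>U\<in>\<U>. restr ?P (\<Union>\<U>) U t = \<sigma> U)"
    proof (rule ex1I[of _ t], intro conjI ballI)
      show "t \<in> carrier (sections ?P (\<Union>\<U>))" using t by (auto simp: direct_power_def t_def)
      fix U assume U: "U \<in> \<U>"
      show "restr ?P (\<Union>\<U>) U t = \<sigma> U"
        by (rule extensionalityI[of _ "{..<k}"])
         (use sec[OF U] t U in \<open>auto simp: direct_power_def PiE_def\<close>)
    next
      fix t' assume t': "t' \<in> carrier (sections ?P (\<Union>\<U>)) \<and> (\<forall>U\<in>\<U>. restr ?P (\<Union>\<U>) U t' = \<sigma> U)"
      show "t' = t"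
      proof (rule extensionalityI[of _ "{..<k}"])
        show "t' \<in> extensional {..<k}" using t' by (auto simp: direct_power_def PiE_def)
        show "t \<in> extensional {..<k}" by (simp add: t_def)
        fix i assume i: "i \<in> {..<k}"
        have "restr F (\<Union>\<U>) U (t' i) = \<sigma> U i" if "U \<in> \<U>" for U
        proof -
          have "restr ?P (\<Union>\<U>) U t' = \<sigma> U" using t' that by blast
          from fun_cong[OF this, of i] i show ?thesis by (simp add: direct_power_def)
        qed
        moreover have "t' i \<in> carrier (sections F (\<Union>\<U>))"
          by (rule mem) (use t' i in \<open>simp_all add: direct_power_def\<close>)
        ultimately show "t' i = t i" using ex[of i] t[of i] i by (metis lessThan_iff)
      qed
    qed
  next
    fix U V s t assume a: "open U" "U \<subseteq> \<Omega>" "open V" "V \<subseteq> U" "s \<in> carrier (sections (direct_power k F) U)"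
      "t \<in> carrier (sections (direct_power k F) U)"
    show "restr (direct_power k F) U V (s \<oplus>\<^bsub>sections (direct_power k F) U\<^esub> t) =
       restr (direct_power k F) U V s \<oplus>\<^bsub>sections (direct_power k F) V\<^esub> restr (direct_power k F) U V t"
      using a by (simp add: direct_power_def mem restr_add cong: restrict_cong)
  next
    fix U V s f assume a: "open U" "U \<subseteq> \<Omega>" "open V" "V \<subseteq> U" "s \<in> carrier (sections (direct_power k F) U)"
      "f \<in> carrier (hol_ring U)"
    show "restr (direct_power k F) U V (f \<odot>\<^bsub>sections (direct_power k F) U\<^esub> s) =
       restrict f V \<odot>\<^bsub>sections (direct_power k F) V\<^esub> restr (direct_power k F) U V s"
      using a by (simp add: direct_power_def mem restr_smult cong: restrict_cong)
  next
    fix U s assume a: "open U" "U \<subseteq> \<Omega>" "s \<in> carrier (sections (direct_power k F) U)"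
    then show "restr (direct_power k F) U U s = s"
      by (simp add: direct_power_def mem restr_id PiE_iff extensional_restrict cong: restrict_cong)
  next
    fix U V W s assume a: "open U" "U \<subseteq> \<Omega>" "open V" "V \<subseteq> U" "open W" "W \<subseteq> V"
      "s \<in> carrier (sections (direct_power k F) U)"
    then show "restr (direct_power k F) V W (restr (direct_power k F) U V s) = restr (direct_power k F) U W s"
      by (simp add: direct_power_def mem restr_restr cong: restrict_cong)
  next
    fix U V s assume a: "open U" "U \<subseteq> \<Omega>" "open V" "V \<subseteq> U" "s \<in> carrier (sections (direct_power k F) U)"
    then show "restr (direct_power k F) U V s \<in> carrier (sections (direct_power k F) V)"
      by (simp add: direct_power_def mem restr_closed restrict_PiE_iff)
  qed
qed

end

theory Submission
  imports Defs "HOL-Complex_Analysis.Complex_Analysis"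
begin

text \<open>A relation \<open>\<Sum> a\<^sub>j g\<^sub>j = 0\<close> between Banach valued functions is equivalent, on a ball, to finitely
  many scalar ones: pick a functional \<open>\<lambda>\<close> (Hahn-Banach) with \<open>\<lambda> g\<^sub>k \<noteq> 0\<close> and eliminate \<open>g\<^sub>k\<close>; the
  division by \<open>\<lambda> g\<^sub>k\<close> that this involves is harmless since its zero set has no interior. So the claim
  reduces to Oka's theorem for scalar functions, which is proved by induction on the set \<open>I\<close> of variables
  on which the functions depend. After a shear, Weierstrass division makes one function a monic
  polynomial in a variable \<open>z\<^sub>i\<close> and the others polynomials of smaller degree. Modulo Koszul relations
  every germ of a relation near the point is then a combination of relations with polynomial
  coefficients of bounded degree, and these are the solutions of finitely many linear equations whose
  coefficients depend only on the variables in \<open>I - {i}\<close>.\<close>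

no_notation fps_nth (infixl \<open>$\<close> 75)

section \<open>Holomorphic maps and germs\<close>

text \<open>Coherence asks for one finite list of generators that works at all points near
  \<open>x\<close>, while a Weierstrass polynomial belongs to one point: at a nearby
  \<open>y\<close> the polynomial found at \<open>x\<close> splits, and its local factor may have
  smaller degree. So division is repeated at every \<open>y\<close>, always against the polynomial
  chosen at \<open>x\<close>, and only a degree bound common to all \<open>y\<close> leaves finitely
  many unknowns. Division itself rests on estimates instead of integrals. On a polydisc of radius
  \<rho> in the coordinate \<open>z $ i\<close>, the quotient of a function bounded by M by
  \<open>(z $ i - y $ i) ^ d\<close> is bounded by \<open>(d + 1) * M / \<rho> ^ d\<close>; a
  perturbation of the monomial that is small against this factor is absorbed by a geometric series.
  The same estimate gives uniqueness of the quotient, and uniqueness is what later shows that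
  certain quotients are units and certain remainders vanish. For Banach values the obstacle is that
  the pivot may vanish at \<open>x\<close>. The functional is therefore chosen at a nearby point,
  and the identity theorem along complex lines shows that the scalar pivot vanishes on no open
  subset of a ball around \<open>x\<close>.\<close>

lemma holomorphic_map_open:
  assumes "open U"
  shows "holomorphic_map U f \<longleftrightarrow>
    (\<forall>z\<in>U. \<exists>D. (f has_derivative D) (at z) \<and> (\<forall>c v. D (c *s v) = c *\<^sub>C D v))"
  unfolding holomorphic_map_def using at_within_open[OF _ assms] by (metis (no_types, lifting))

lemma holomorphic_map_continuous_on: "holomorphic_map U f \<Longrightarrow> continuous_on U f"
  unfolding holomorphic_map_def continuous_on_eq_continuous_within
  by (meson has_derivative_continuous)

lemma holomorphic_map_mult:
  fixes a b :: "complex^'n \<Rightarrow> complex"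
  assumes "holomorphic_map U a" "holomorphic_map U b"
  shows "holomorphic_map U (\<lambda>z. a z * b z)"
  using holomorphic_map_scaleC[OF assms] by (simp add: scaleC_complex_def)

lemma holomorphic_map_sum:
  "(\<And>i. i \<in> A \<Longrightarrow> holomorphic_map U (f i)) \<Longrightarrow> holomorphic_map U (\<lambda>z. \<Sum>i\<in>A. f i z)"
  by (induction A rule: infinite_finite_induct)
    (auto intro!: holomorphic_map_add holomorphic_map_const)

lemma holomorphic_map_diff:
  "holomorphic_map U f \<Longrightarrow> holomorphic_map U g \<Longrightarrow> holomorphic_map U (\<lambda>z. f z - g z)"
  using holomorphic_map_add[of U f "\<lambda>z. - g z"] holomorphic_map_uminus[of U g] by simp

lemma holomorphic_map_power:
  fixes a :: "complex^'n \<Rightarrow> complex"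
  shows "holomorphic_map U a \<Longrightarrow> holomorphic_map U (\<lambda>z. a z ^ n)"
  by (induction n) (auto intro!: holomorphic_map_const holomorphic_map_mult)

lemma holomorphic_map_component: "holomorphic_map U (\<lambda>z. z $ i)"
  unfolding holomorphic_map_def
  by (auto intro!: exI[of _ "\<lambda>z. z $ i"] bounded_linear_imp_has_derivative bounded_linear_vec_nth
      simp: scaleC_complex_def)

lemma holomorphic_map_inverse:
  fixes a :: "complex^'n \<Rightarrow> complex"
  assumes "holomorphic_map U a" "\<And>z. z \<in> U \<Longrightarrow> a z \<noteq> 0"
  shows "holomorphic_map U (\<lambda>z. inverse (a z))"
  unfolding holomorphic_map_def
proof
  fix z assume z: "z \<in> U"
  obtain D where D: "(a has_derivative D) (at z within U)" "\<And>c v. D (c *s v) = c *\<^sub>C D v"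
    using assms(1) z unfolding holomorphic_map_def by blast
  have "((\<lambda>z. inverse (a z)) has_derivative (\<lambda>h. - (inverse (a z) * D h * inverse (a z)))) (at z within U)"
    by (rule Deriv.has_derivative_inverse[OF assms(2)[OF z] D(1)])
  then show "\<exists>D. ((\<lambda>z. inverse (a z)) has_derivative D) (at z within U) \<and> (\<forall>c v. D (c *s v) = c *\<^sub>C D v)"
    using D(2) by (auto simp: scaleC_complex_def intro!: exI)
qed

text \<open>One \<open>D\<close> serves all points, so \<open>L\<close> is affine: the maps meant
  are \<open>upd\<close>, \<open>freeze\<close> and \<open>shear\<close>.\<close>

lemma holomorphic_map_compose:
  fixes L :: "complex^'m \<Rightarrow> complex^'n"
  assumes f: "holomorphic_map V f" and "open V" and im: "\<And>z. z \<in> U \<Longrightarrow> L z \<in> V"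
    and L: "\<And>z. (L has_derivative D) (at z)" "\<And>c v. D (c *s v) = c *s D v"
  shows "holomorphic_map U (\<lambda>z. f (L z))"
  unfolding holomorphic_map_def
proof
  fix z assume z: "z \<in> U"
  obtain E where E: "(f has_derivative E) (at (L z))" "\<And>c v. E (c *s v) = c *\<^sub>C E v"
    using f im[OF z] unfolding holomorphic_map_open[OF \<open>open V\<close>] by blast
  have "((\<lambda>z. f (L z)) has_derivative (\<lambda>v. E (D v))) (at z)"
    using diff_chain_at[OF L(1) E(1)] by (simp add: o_def)
  then show "\<exists>D. ((\<lambda>z. f (L z)) has_derivative D) (at z within U) \<and> (\<forall>c v. D (c *s v) = c *\<^sub>C D v)"
    by (intro exI[of _ "\<lambda>v. E (D v)"]) (auto simp: L(2) E(2) intro: has_derivative_at_withinI)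
qed

lemma holomorphic_map_bounded_linear:
  fixes l :: "'e::complex_banach \<Rightarrow> complex"
  assumes f: "holomorphic_map U f"
    and L: "bounded_linear l" "\<And>c v. l (c *\<^sub>C v) = c * l v"
  shows "holomorphic_map U (\<lambda>z. l (f z))"
  unfolding holomorphic_map_def
proof
  fix z assume z: "z \<in> U"
  obtain E where E: "(f has_derivative E) (at z within U)" "\<And>c v. E (c *s v) = c *\<^sub>C E v"
    using f z unfolding holomorphic_map_def by blast
  show "\<exists>D. ((\<lambda>z. l (f z)) has_derivative D) (at z within U) \<and> (\<forall>c v. D (c *s v) = c *\<^sub>C D v)"
    using bounded_linear.has_derivative[OF L(1) E(1)]
    by (intro exI[of _ "\<lambda>v. l (E v)"]) (auto simp: L(2) E(2) scaleC_complex_def)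
qed

section \<open>Restriction to complex lines\<close>

lemma norm_vector_smult: "norm (c *s (v::complex^'n)) = cmod c * norm v"
  unfolding norm_vec_def by (simp add: norm_mult L2_set_right_distrib)

lemma bounded_linear_smult_left: "bounded_linear (\<lambda>t. t *s (v::complex^'n))"
  by (rule bounded_linear_intro[of _ "norm v"])
    (auto simp: vector_sadd_rdistrib norm_vector_smult vec_eq_iff)

text \<open>Complex linearity of \<open>D\<close> makes the real derivative of the slice
  multiplication by the number \<open>D v\<close>, hence a complex derivative. One-variable function
  theory enters through such slices.\<close>

lemma holomorphic_map_line_deriv:
  fixes f :: "complex^'n \<Rightarrow> complex"
  assumes D: "(f has_derivative D) (at (z + t *s v))" "\<And>c v. D (c *s v) = c *\<^sub>C D v"
  shows "((\<lambda>t. f (z + t *s v)) has_field_derivative D v) (at t)"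
proof -
  have "((\<lambda>t. z + t *s v) has_derivative (\<lambda>t. t *s v)) (at t)"
    using has_derivative_add[OF has_derivative_const bounded_linear_imp_has_derivative[OF bounded_linear_smult_left[of v]], of z "at t"]
    by simp
  from diff_chain_at[OF this D(1)] show ?thesis
    by (simp add: o_def has_field_derivative_def D(2) scaleC_complex_def mult_commute_abs)
qed

lemma holomorphic_map_line:
  fixes f :: "complex^'n \<Rightarrow> complex"
  assumes f: "holomorphic_map U f" "open U" and S: "\<And>t. t \<in> S \<Longrightarrow> z + t *s v \<in> U"
  shows "(\<lambda>t. f (z + t *s v)) holomorphic_on S"
  unfolding holomorphic_on_def field_differentiable_def
proof
  fix t assume "t \<in> S"
  then obtain D where "(f has_derivative D) (at (z + t *s v))" "\<And>c v. D (c *s v) = c *\<^sub>C D v"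
    using f S unfolding holomorphic_map_open[OF f(2)] by blast
  from holomorphic_map_line_deriv[OF this]
  show "\<exists>f'. ((\<lambda>t. f (z + t *s v)) has_field_derivative f') (at t within S)"
    by (blast intro: has_field_derivative_at_within)
qed

text \<open>A germ is represented by a total function that is holomorphic around \<open>x\<close>;
  equality of germs is written as eventual equality in \<open>nhds x\<close>, so no quotient type
  occurs.\<close>

definition hol_at :: "complex^'n \<Rightarrow> (complex^'n \<Rightarrow> 'e::complex_banach) \<Rightarrow> bool" where
  "hol_at x f \<longleftrightarrow> (\<exists>U. open U \<and> x \<in> U \<and> holomorphic_map U f)"

lemma hol_atI: "open U \<Longrightarrow> x \<in> U \<Longrightarrow> holomorphic_map U f \<Longrightarrow> hol_at x f"
  unfolding hol_at_def by blast

lemma holomorphic_map_iff_hol_at: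
  assumes "open U"
  shows "holomorphic_map U f \<longleftrightarrow> (\<forall>x\<in>U. hol_at x f)"
proof
  assume r: "\<forall>x\<in>U. hol_at x f"
  show "holomorphic_map U f"
  proof (rule holomorphic_map_local)
    fix x assume "x \<in> U"
    then obtain V where "open V" "x \<in> V" "holomorphic_map V f" using r unfolding hol_at_def by blast
    then show "\<exists>V. open V \<and> x \<in> V \<and> holomorphic_map (U \<inter> V) f"
      using holomorphic_map_subset[of V f "U \<inter> V"] by blast
  qed
qed (use assms hol_atI in blast)

lemma hol_at_nhds: "hol_at x f \<Longrightarrow> \<forall>\<^sub>F y in nhds x. hol_at y f"
  unfolding hol_at_def eventually_nhds by blast

lemma hol_at_isCont: "hol_at x f \<Longrightarrow> isCont f x"
  unfolding hol_at_def using holomorphic_map_continuous_on continuous_on_eq_continuous_at by blast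

lemma hol_at_binary:
  assumes "hol_at x f" "hol_at x g"
    and "\<And>U. holomorphic_map U f \<Longrightarrow> holomorphic_map U g \<Longrightarrow> holomorphic_map U h"
  shows "hol_at x h"
proof -
  obtain U V where "open U" "x \<in> U" "holomorphic_map U f" "open V" "x \<in> V" "holomorphic_map V g"
    using assms(1,2) unfolding hol_at_def by blast
  then show ?thesis
    by (intro hol_atI[of "U \<inter> V"] assms(3)) (auto intro: holomorphic_map_subset)
qed

lemma hol_at_const [simp]: "hol_at x (\<lambda>z. c)"
  by (rule hol_atI[of UNIV]) (auto intro: holomorphic_map_const)

lemma hol_at_component [simp]: "hol_at x (\<lambda>z. z $ i)"
  by (rule hol_atI[of UNIV]) (auto intro: holomorphic_map_component)

lemma hol_at_add: "hol_at x f \<Longrightarrow> hol_at x g \<Longrightarrow> hol_at x (\<lambda>z. f z + g z)"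
  by (rule hol_at_binary[of x f g]) (auto intro: holomorphic_map_add)

lemma hol_at_diff: "hol_at x f \<Longrightarrow> hol_at x g \<Longrightarrow> hol_at x (\<lambda>z. f z - g z)"
  by (rule hol_at_binary[of x f g]) (auto intro: holomorphic_map_diff)

lemma hol_at_uminus: "hol_at x f \<Longrightarrow> hol_at x (\<lambda>z. - f z)"
  by (rule hol_at_binary[of x f f]) (auto intro: holomorphic_map_uminus)

lemma hol_at_scaleC: "hol_at x f \<Longrightarrow> hol_at x g \<Longrightarrow> hol_at x (\<lambda>z. f z *\<^sub>C g z)"
  by (rule hol_at_binary[of x f g]) (auto intro: holomorphic_map_scaleC)

lemma hol_at_mult:
  fixes f g :: "complex^'n \<Rightarrow> complex"
  shows "hol_at x f \<Longrightarrow> hol_at x g \<Longrightarrow> hol_at x (\<lambda>z. f z * g z)"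
  by (rule hol_at_binary[of x f g]) (auto intro: holomorphic_map_mult)

lemma hol_at_sum:
  "(\<And>i. i \<in> A \<Longrightarrow> hol_at x (f i)) \<Longrightarrow> hol_at x (\<lambda>z. \<Sum>i\<in>A. f i z)"
  by (induction A rule: infinite_finite_induct) (auto intro!: hol_at_add)

lemma hol_at_power:
  fixes f :: "complex^'n \<Rightarrow> complex"
  shows "hol_at x f \<Longrightarrow> hol_at x (\<lambda>z. f z ^ n)"
  by (induction n) (auto intro!: hol_at_mult)

lemmas hol_at_intros = hol_at_add hol_at_diff hol_at_uminus hol_at_scaleC hol_at_mult
  hol_at_sum hol_at_power hol_at_const hol_at_component

lemma hol_at_nonzero_nhds:
  fixes f :: "complex^'n \<Rightarrow> 'e::complex_banach"
  assumes "hol_at x f" "f x \<noteq> 0"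
  shows "\<forall>\<^sub>F z in nhds x. f z \<noteq> 0"
proof -
  have "f \<midarrow>x\<rightarrow> f x" using hol_at_isCont[OF assms(1)] by (simp add: isCont_def)
  then have "\<forall>\<^sub>F z in at x. f z \<noteq> 0" by (rule tendsto_imp_eventually_ne[OF _ assms(2)])
  then show ?thesis using assms(2) by (simp add: eventually_nhds_conv_at)
qed

lemma hol_at_inverse:
  fixes f :: "complex^'n \<Rightarrow> complex"
  assumes "hol_at x f" "f x \<noteq> 0"
  shows "hol_at x (\<lambda>z. inverse (f z))"
proof -
  obtain U where U: "open U" "x \<in> U" "holomorphic_map U f" using assms(1) unfolding hol_at_def by blast
  obtain V where V: "open V" "x \<in> V" "\<And>z. z \<in> V \<Longrightarrow> f z \<noteq> 0"
    using hol_at_nonzero_nhds[OF assms] unfolding eventually_nhds by blast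
  show ?thesis
    by (rule hol_atI[of "U \<inter> V"])
      (use U V in \<open>auto intro!: holomorphic_map_inverse intro: holomorphic_map_subset\<close>)
qed

lemma hol_at_compose:
  fixes L :: "complex^'m \<Rightarrow> complex^'n"
  assumes f: "hol_at (L x) f"
    and L: "\<And>z. (L has_derivative D) (at z)" "\<And>c v. D (c *s v) = c *s D v"
  shows "hol_at x (\<lambda>z. f (L z))"
proof -
  obtain U where U: "open U" "L x \<in> U" "holomorphic_map U f" using f unfolding hol_at_def by blast
  have "continuous_on UNIV L"
    using has_derivative_continuous[OF L(1)] by (simp add: continuous_on_eq_continuous_at)
  then have "open (L -` U)" using U(1) by (simp add: open_vimage)
  then show ?thesis
    by (rule hol_atI) (use U L in \<open>auto intro!: holomorphic_map_compose[of U f _ L D]\<close>)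
qed

lemma eventually_nhds_compose:
  assumes "isCont L x" "\<forall>\<^sub>F w in nhds (L x). P w"
  shows "\<forall>\<^sub>F z in nhds x. P (L z)"
proof -
  have "filterlim L (nhds (L x)) (nhds x)"
    using assms(1) by (simp add: isCont_def tendsto_at_iff_tendsto_nhds)
  then show ?thesis using assms(2) by (simp add: filterlim_iff)
qed

section \<open>Uniform limits of holomorphic functions\<close>

text \<open>Cauchy's inequality of order one on the complex line through \<open>z\<close> in
  direction \<open>h\<close>, normalised so that the parameter disc of radius \<open>r\<close> stays
  in the ball.\<close>

lemma holomorphic_map_deriv_bound:
  fixes f :: "complex^'n \<Rightarrow> complex"
  assumes f: "holomorphic_map U f" "open U" and r: "0 < r" "cball z r \<subseteq> U"
    and M: "\<And>w. w \<in> cball z r \<Longrightarrow> cmod (f w) \<le> M"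
    and D: "(f has_derivative D) (at z)" "\<And>c v. D (c *s v) = c *\<^sub>C D v"
  shows "cmod (D h) \<le> M / r * norm h"
proof (cases "h = 0")
  case True
  then show ?thesis using D(2)[of 0 h] by (simp add: scaleC_complex_def)
next
  case False
  define v where "v = complex_of_real (1 / norm h) *s h"
  have nv: "norm v = 1" using False by (simp add: v_def norm_vector_smult norm_divide)
  have h: "h = complex_of_real (norm h) *s v" using False by (simp add: v_def)
  have S: "z + t *s v \<in> cball z r" if "t \<in> cball 0 r" for t
    using that nv by (simp add: dist_norm norm_vector_smult)
  have hol: "(\<lambda>t. f (z + t *s v)) holomorphic_on cball 0 r"
    by (rule holomorphic_map_line[OF f]) (use S r in auto)
  have "norm ((deriv ^^ 1) (\<lambda>t. f (z + t *s v)) 0) \<le> fact 1 * M / r ^ 1"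
    by (rule Cauchy_inequality)
      (use hol r S M in \<open>auto intro: holomorphic_on_subset holomorphic_on_imp_continuous_on simp: dist_norm\<close>)
  moreover have "deriv (\<lambda>t. f (z + t *s v)) 0 = D v"
    by (rule DERIV_imp_deriv) (use holomorphic_map_line_deriv[of f D z 0 v] D in simp)
  ultimately have Dv: "cmod (D v) \<le> M / r" by simp
  have "D h = complex_of_real (norm h) * D v"
    by (subst h) (simp add: D(2) scaleC_complex_def)
  then show ?thesis using mult_left_mono[OF Dv, of "norm h"] by (simp add: norm_mult mult.commute)
qed

text \<open>The Cauchy bound for the differences \<open>f n - f m\<close> makes the differentials
  uniformly Cauchy on a smaller ball, so limit and differential may be interchanged; complex
  linearity survives the pointwise limit of the differentials.\<close>

lemma holomorphic_map_uniform_limit: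
  fixes f :: "nat \<Rightarrow> complex^'n \<Rightarrow> complex"
  assumes f: "\<And>n. holomorphic_map U (f n)" "open U" and lim: "uniform_limit U f g sequentially"
  shows "holomorphic_map U g"
  unfolding holomorphic_map_open[OF \<open>open U\<close>]
proof
  fix x assume "x \<in> U"
  then obtain r0 where "r0 > 0" "cball x r0 \<subseteq> U" using \<open>open U\<close> open_contains_cball by blast
  \<comment> \<open>Half the radius: a closed ball of radius \<open>r\<close> around any point of
    \<open>ball x r\<close> still lies in \<open>U\<close>, so one estimate serves all these
    points.\<close>
  define r where "r = r0 / 2"
  have r: "r > 0" using \<open>r0 > 0\<close> by (simp add: r_def)
  have sub: "cball z r \<subseteq> U" if "z \<in> ball x r" for z
  proof
    fix w assume "w \<in> cball z r"
    then have "dist x w \<le> r0" using that dist_triangle[of x w z] by (simp add: r_def)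
    then show "w \<in> U" using \<open>cball x r0 \<subseteq> U\<close> by auto
  qed
  have subU: "ball x r \<subseteq> U"
    using sub r by (meson centre_in_cball less_imp_le subsetD subsetI)
  define P where "P n z D \<longleftrightarrow> (f n has_derivative D) (at z) \<and> (\<forall>c v. D (c *s v) = c *\<^sub>C D v)" for n z D
  define f' where "f' n z = (SOME D. P n z D)" for n z
  have "\<exists>D. P n z D" if "z \<in> ball x r" for n z
    using f(1)[of n] that subU unfolding P_def holomorphic_map_open[OF \<open>open U\<close>] by blast
  then have f'_spec: "P n z (f' n z)" if "z \<in> ball x r" for n z
    unfolding f'_def using that by (metis someI_ex)
  have f': "(f n has_derivative f' n z) (at z)" "f' n z (c *s v) = c *\<^sub>C f' n z v"
    if "z \<in> ball x r" for n z c v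
    using f'_spec[OF that] by (auto simp: P_def)
  have bound: "cmod (f' n z h - f' m z h) \<le> e / r * norm h"
    if z: "z \<in> ball x r" and e: "\<And>w. w \<in> U \<Longrightarrow> cmod (f n w - f m w) \<le> e" for n m z h e
  proof (rule holomorphic_map_deriv_bound[of U "\<lambda>z. f n z - f m z" r z])
    show "holomorphic_map U (\<lambda>z. f n z - f m z)" by (intro holomorphic_map_diff f)
    show "((\<lambda>z. f n z - f m z) has_derivative (\<lambda>h. f' n z h - f' m z h)) (at z)"
      by (intro has_derivative_diff f' z)
  qed (use f(2) r sub[OF z] e f'(2)[OF z] in \<open>auto simp: scaleC_complex_def algebra_simps\<close>)
  have cau: "\<exists>N. \<forall>n\<ge>N. \<forall>m\<ge>N. \<forall>z\<in>ball x r. \<forall>h. cmod (f' n z h - f' m z h) \<le> e * norm h" if "e > 0" for e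
  proof -
    have "\<forall>\<^sub>F n in sequentially. \<forall>w\<in>U. dist (f n w) (g w) < e * r / 2"
      using lim that r unfolding uniform_limit_iff by (auto dest: spec[of _ "e * r / 2"])
    then obtain N where N: "\<And>n w. n \<ge> N \<Longrightarrow> w \<in> U \<Longrightarrow> dist (f n w) (g w) < e * r / 2"
      unfolding eventually_sequentially by blast
    have "cmod (f n w - f m w) \<le> e * r" if "n \<ge> N" "m \<ge> N" "w \<in> U" for n m w
      using N[OF that(1,3)] N[OF that(2,3)] dist_triangle_half_r[of "g w" "f n w" "e * r" "f m w"]
      by (simp add: dist_norm norm_minus_commute less_imp_le)
    then have "cmod (f' n z h - f' m z h) \<le> e * norm h" if "n \<ge> N" "m \<ge> N" "z \<in> ball x r" for n m z h
      using bound[of z n m "e * r" h] that r by simp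
    then show ?thesis by blast
  qed
  have conv: "convergent (\<lambda>n. f' n z h)" if "z \<in> ball x r" for z h
  proof (rule Cauchy_convergent, rule CauchyI)
    fix e :: real assume "e > 0"
    define e' where "e' = e / (norm h + 1)"
    have e': "e' > 0" "e' * norm h < e" using \<open>e > 0\<close> by (auto simp: e'_def field_simps add_pos_nonneg)
    from cau[OF e'(1)] obtain N where
      N: "\<And>n m. n \<ge> N \<Longrightarrow> m \<ge> N \<Longrightarrow> cmod (f' n z h - f' m z h) \<le> e' * norm h"
      using \<open>z \<in> ball x r\<close> by blast
    then show "\<exists>M. \<forall>m\<ge>M. \<forall>n\<ge>M. cmod (f' m z h - f' n z h) < e"
      using e'(2) by (meson le_less_trans)
  qed
  define g' where "g' z h = lim (\<lambda>n. f' n z h)" for z h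
  have g': "(\<lambda>n. f' n z h) \<longlonglongrightarrow> g' z h" if "z \<in> ball x r" for z h
    using conv[OF that] unfolding g'_def by (simp add: convergent_LIMSEQ_iff)
  have unif: "\<forall>\<^sub>F n in sequentially. \<forall>z\<in>ball x r. \<forall>h. norm (f' n z h - g' z h) \<le> e * norm h" if e: "e > 0" for e
  proof -
    obtain N where N: "\<forall>n\<ge>N. \<forall>m\<ge>N. \<forall>z\<in>ball x r. \<forall>h. cmod (f' n z h - f' m z h) \<le> e * norm h"
      using cau[OF e] by blast
    have "norm (f' n z h - g' z h) \<le> e * norm h" if "n \<ge> N" "z \<in> ball x r" for n z h
    proof (rule tendsto_upperbound)
      show "(\<lambda>m. norm (f' n z h - f' m z h)) \<longlonglongrightarrow> norm (f' n z h - g' z h)"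
        by (intro tendsto_intros g' that)
      show "\<forall>\<^sub>F m in sequentially. norm (f' n z h - f' m z h) \<le> e * norm h"
        using N that unfolding eventually_sequentially by blast
    qed simp
    then show ?thesis unfolding eventually_sequentially by blast
  qed
  have ptw: "(\<lambda>n. f n z) \<longlonglongrightarrow> g z" if "z \<in> ball x r" for z
    using tendsto_uniform_limitI[OF lim] subU that by blast
  have "\<exists>g0. \<forall>z\<in>ball x r. (\<lambda>n. f n z) \<longlonglongrightarrow> g0 z \<and> (g0 has_derivative g' z) (at z within ball x r)"
    by (rule has_derivative_sequence[of _ _ f' g' x "g x"])
      (use f' unif ptw r in \<open>auto intro: has_derivative_at_withinI\<close>)
  then obtain g0 where g0: "\<And>z. z \<in> ball x r \<Longrightarrow> (\<lambda>n. f n z) \<longlonglongrightarrow> g0 z"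
     "\<And>z. z \<in> ball x r \<Longrightarrow> (g0 has_derivative g' z) (at z within ball x r)" by blast
  have xr: "x \<in> ball x r" using r by simp
  have "(g has_derivative g' x) (at x)"
    using has_derivative_transform[OF xr, of g g0 "g' x"] g0(2)[OF xr] LIMSEQ_unique[OF ptw g0(1)]
      at_within_open[OF xr] by simp
  moreover have "g' x (c *s v) = c *\<^sub>C g' x v" for c v
  proof (rule LIMSEQ_unique[OF g'[OF xr]])
    show "(\<lambda>n. f' n x (c *s v)) \<longlonglongrightarrow> c *\<^sub>C g' x v"
      unfolding f'(2)[OF xr] scaleC_complex_def by (intro tendsto_intros g' xr)
  qed
  ultimately show "\<exists>D. (g has_derivative D) (at x) \<and> (\<forall>c v. D (c *s v) = c *\<^sub>C D v)" by blast
qed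

lemma holomorphic_map_uniform_limit_local:
  fixes f :: "nat \<Rightarrow> complex^'n \<Rightarrow> complex"
  assumes f: "\<And>n. holomorphic_map U (f n)"
    and lim: "\<And>x. x \<in> U \<Longrightarrow> \<exists>V. open V \<and> x \<in> V \<and> V \<subseteq> U \<and> uniform_limit V f g sequentially"
  shows "holomorphic_map U g"
proof (rule holomorphic_map_local)
  fix x assume "x \<in> U"
  then obtain V where V: "open V" "x \<in> V" "V \<subseteq> U" "uniform_limit V f g sequentially" using lim by blast
  then have "holomorphic_map V g"
    using holomorphic_map_uniform_limit[of V f g] f holomorphic_map_subset by blast
  moreover have "U \<inter> V = V" using V by blast
  ultimately show "\<exists>V. open V \<and> x \<in> V \<and> holomorphic_map (U \<inter> V) g" using V by metis
qed

section \<open>Taylor expansion in one coordinate\<close>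

definition upd :: "complex^'n \<Rightarrow> 'n \<Rightarrow> complex \<Rightarrow> complex^'n" where
  "upd z i t = (\<chi> j. if j = i then t else z $ j)"

lemma upd_nth [simp]: "upd z i t $ j = (if j = i then t else z $ j)"
  by (simp add: upd_def)

lemma upd_upd [simp]: "upd (upd z i s) i t = upd z i t"
  by (simp add: vec_eq_iff)

lemma upd_same [simp]: "upd z i (z $ i) = z"
  by (simp add: vec_eq_iff)

lemma upd_line: "upd z i t = z + (t - z $ i) *s axis i 1"
  by (simp add: vec_eq_iff axis_def)

lemma upd_has_derivative: "((\<lambda>z. upd z i t) has_derivative (\<lambda>v. upd v i 0)) (at z)"
proof -
  have "bounded_linear (\<lambda>v. upd v i 0)"
  proof (rule bounded_linear_intro[of _ 1])
    show "norm (upd x i 0) \<le> norm x * 1" for x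
      unfolding norm_vec_def by (auto intro: L2_set_mono)
  qed (auto simp: vec_eq_iff)
  then have "((\<lambda>z. upd z i 0 + t *s axis i 1) has_derivative (\<lambda>v. upd v i 0 + 0)) (at z)"
    by (intro has_derivative_add bounded_linear_imp_has_derivative has_derivative_const)
  moreover have "upd z i t = upd z i 0 + t *s axis i 1" for z
    by (simp add: vec_eq_iff axis_def)
  ultimately show ?thesis by simp
qed

lemma upd_smult: "upd (c *s v) i 0 = c *s upd v i 0"
  by (simp add: vec_eq_iff)

text \<open>Two radii, because Weierstrass division fixes the radius \<rho> of the distinguished
  coordinate first and then shrinks the others to make the perturbation small.\<close>

definition pdisc :: "complex^'n \<Rightarrow> 'n \<Rightarrow> real \<Rightarrow> real \<Rightarrow> (complex^'n) set" where
  "pdisc y i \<rho> \<delta> = {z. cmod (z $ i - y $ i) < \<rho> \<and> (\<forall>j. j \<noteq> i \<longrightarrow> cmod (z $ j - y $ j) < \<delta>)}"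

lemma open_pdisc: "open (pdisc y i \<rho> \<delta>)"
proof -
  have "pdisc y i \<rho> \<delta> = {z. cmod (z $ i - y $ i) < \<rho>} \<inter> (\<Inter>j\<in>UNIV-{i}. {z. cmod (z $ j - y $ j) < \<delta>})"
    by (auto simp: pdisc_def)
  also have "open \<dots>"
    by (intro open_Int open_INT) (auto intro!: open_Collect_less continuous_intros)
  finally show ?thesis .
qed

lemma pdisc_center: "\<rho> > 0 \<Longrightarrow> \<delta> > 0 \<Longrightarrow> y \<in> pdisc y i \<rho> \<delta>"
  by (simp add: pdisc_def)

lemma upd_in_pdisc: "z \<in> pdisc y i \<rho> \<delta> \<Longrightarrow> cmod (t - y $ i) < \<rho> \<Longrightarrow> upd z i t \<in> pdisc y i \<rho> \<delta>"
  by (auto simp: pdisc_def)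

lemma pdisc_subset_open:
  fixes y :: "complex^'n"
  assumes "open W" "y \<in> W"
  obtains r where "r > 0" "\<And>i \<rho> \<delta>. \<rho> \<le> r \<Longrightarrow> \<delta> \<le> r \<Longrightarrow> pdisc y i \<rho> \<delta> \<subseteq> W"
proof -
  obtain e where e: "e > 0" "ball y e \<subseteq> W" using assms open_contains_ball by blast
  \<comment> \<open>The Euclidean norm is at most the sum of the \<open>CARD('n)\<close> component
    norms, each below \<open>r\<close>.\<close>
  define r where "r = e / real CARD('n)"
  have r: "r > 0" using e by (simp add: r_def)
  have "pdisc y i \<rho> \<delta> \<subseteq> W" if le: "\<rho> \<le> r" "\<delta> \<le> r" for i \<rho> \<delta>
  proof
    fix z assume z: "z \<in> pdisc y i \<rho> \<delta>"
    have "cmod ((z - y) $ j) < r" for j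
      using z le by (cases "j = i") (force simp: pdisc_def)+
    then have "(\<Sum>j\<in>UNIV. cmod ((z - y) $ j)) < (\<Sum>j\<in>(UNIV::'n set). r)"
      by (intro sum_strict_mono) auto
    also have "\<dots> = e" by (simp add: r_def)
    finally have "norm (z - y) < e"
      unfolding norm_vec_def using L2_set_le_sum[of UNIV "\<lambda>j. cmod ((z - y) $ j)"] by simp
    then show "z \<in> W" using e(2) by (auto simp: dist_norm norm_minus_commute)
  qed
  then show thesis using r that by blast
qed

definition taylor_coeff :: "'n \<Rightarrow> complex \<Rightarrow> nat \<Rightarrow> (complex^'n \<Rightarrow> complex) \<Rightarrow> complex^'n \<Rightarrow> complex" where
  "taylor_coeff i p l g z = (deriv ^^ l) (\<lambda>t. g (upd z i t)) p / fact l"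

lemma taylor_coeff_upd [simp]: "taylor_coeff i p l g (upd z i t) = taylor_coeff i p l g z"
  by (simp add: taylor_coeff_def)

context
  fixes y :: "complex^'n" and i :: 'n and \<rho> \<delta> :: real and D and p
  assumes \<rho>: "\<rho> > 0" and \<delta>: "\<delta> > 0"
  defines "D \<equiv> pdisc y i \<rho> \<delta>" and "p \<equiv> y $ i"
begin

lemma slice_holomorphic:
  assumes "holomorphic_map D g" "z \<in> D"
  shows "(\<lambda>t. g (upd z i t)) holomorphic_on ball p \<rho>"
proof -
  have "(\<lambda>t. g (upd z i 0 + t *s axis i 1)) holomorphic_on ball p \<rho>"
  proof (rule holomorphic_map_line[of D])
    fix t assume "t \<in> ball p \<rho>"
    moreover have "upd z i 0 + t *s axis i 1 = upd z i t" by (simp add: vec_eq_iff axis_def)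
    ultimately show "upd z i 0 + t *s axis i 1 \<in> D"
      using upd_in_pdisc[of z y i \<rho> \<delta> t] assms(2)
      by (simp add: D_def p_def dist_norm norm_minus_commute)
  qed (use assms open_pdisc in \<open>auto simp: D_def\<close>)
  moreover have "upd z i 0 + t *s axis i 1 = upd z i t" for t by (simp add: vec_eq_iff axis_def)
  ultimately show ?thesis by simp
qed

text \<open>Cauchy's inequality on circles of radius s < \<rho>, where the slice is continuous up to
  the boundary; then s tends to \<rho>.\<close>

lemma taylor_coeff_bound:
  assumes g: "holomorphic_map D g" "\<And>z. z \<in> D \<Longrightarrow> cmod (g z) \<le> M" and z: "z \<in> D"
  shows "cmod (taylor_coeff i p l g z) \<le> M / \<rho> ^ l"
proof (rule tendsto_lowerbound)
  show "((\<lambda>s. M / s ^ l) \<longlongrightarrow> M / \<rho> ^ l) (at_left \<rho>)"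
    using \<rho> by (auto intro!: tendsto_intros)
  have "cmod (taylor_coeff i p l g z) \<le> M / s ^ l" if s: "0 < s" "s < \<rho>" for s
  proof -
    have sub: "cball p s \<subseteq> ball p \<rho>" using s by auto
    have "norm ((deriv ^^ l) (\<lambda>t. g (upd z i t)) p) \<le> fact l * M / s ^ l"
    proof (rule Cauchy_inequality)
      show "(\<lambda>t. g (upd z i t)) holomorphic_on ball p s"
        using slice_holomorphic[OF g(1) z] sub ball_subset_cball holomorphic_on_subset by blast
      show "continuous_on (cball p s) (\<lambda>t. g (upd z i t))"
        using slice_holomorphic[OF g(1) z] sub holomorphic_on_subset holomorphic_on_imp_continuous_on by blast
      show "norm (g (upd z i t)) \<le> M" if "norm (p - t) = s" for t
        using that s z upd_in_pdisc[of z y i \<rho> \<delta> t]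
        by (intro g) (simp add: D_def p_def norm_minus_commute)
    qed (use s in auto)
    then show ?thesis by (simp add: taylor_coeff_def norm_divide field_simps)
  qed
  then show "\<forall>\<^sub>F s in at_left \<rho>. cmod (taylor_coeff i p l g z) \<le> M / s ^ l"
    using eventually_at_left_real[OF \<rho>] by (auto elim: eventually_mono)
qed simp

lemma taylor_coeff_sums:
  assumes g: "holomorphic_map D g" and z: "z \<in> D"
  shows "(\<lambda>l. taylor_coeff i p l g z * (z $ i - p) ^ l) sums g z"
proof -
  have "z $ i \<in> ball p \<rho>" using z by (simp add: D_def p_def pdisc_def dist_norm norm_minus_commute)
  from holomorphic_power_series[OF slice_holomorphic[OF g z] this]
  show ?thesis by (simp add: taylor_coeff_def)
qed

lemma taylor_tail_bound:
  assumes g: "holomorphic_map D g" "\<And>z. z \<in> D \<Longrightarrow> cmod (g z) \<le> M" and z: "z \<in> D"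
  defines "x \<equiv> cmod (z $ i - p) / \<rho>"
  shows "cmod (g z - (\<Sum>l<k. taylor_coeff i p l g z * (z $ i - p) ^ l)) \<le> M * x ^ k / (1 - x)"
proof -
  have x: "0 \<le> x" "x < 1" using z \<rho> by (auto simp: x_def D_def p_def pdisc_def)
  let ?a = "\<lambda>l. taylor_coeff i p (l + k) g z * (z $ i - p) ^ (l + k)"
  have sm: "?a sums (g z - (\<Sum>l<k. taylor_coeff i p l g z * (z $ i - p) ^ l))"
    using sums_split_initial_segment[OF taylor_coeff_sums[OF g(1) z], of k] .
  have le: "norm (?a l) \<le> M * x ^ k * x ^ l" for l
  proof -
    have "norm (?a l) \<le> M / \<rho> ^ (l + k) * cmod (z $ i - p) ^ (l + k)"
      unfolding norm_mult norm_power by (intro mult_right_mono taylor_coeff_bound g z) auto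
    also have "\<dots> = M * x ^ k * x ^ l" by (simp add: x_def power_divide power_add field_simps)
    finally show ?thesis .
  qed
  have gs: "(\<lambda>l. M * x ^ k * x ^ l) sums (M * x ^ k * (1 / (1 - x)))"
    by (intro sums_mult geometric_sums) (use x in auto)
  have "cmod (suminf ?a) \<le> suminf (\<lambda>l. M * x ^ k * x ^ l)"
    using norm_suminf_le[OF le sums_summable[OF gs]] .
  then show ?thesis using sums_unique[OF sm] sums_unique[OF gs] by simp
qed

text \<open>Strong induction on \<open>l\<close>: subtracting the lower Taylor terms from the value
  of \<open>g\<close> at \<open>p + t\<close> in the slice and dividing by \<open>t ^ l\<close>
  gives the coefficient up to O(t), uniformly on \<open>D\<close>. So the coefficient is a uniform
  limit of functions already known to be holomorphic.\<close>

lemma taylor_coeff_holomorphic: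
  assumes g: "holomorphic_map D g" "\<And>z. z \<in> D \<Longrightarrow> cmod (g z) \<le> M"
  shows "holomorphic_map D (taylor_coeff i p l g)"
proof (induction l rule: less_induct)
  case (less l)
  \<comment> \<open>Nonzero points of the disc tending to 0; with this choice the ratio
    \<open>x\<close> below is \<open>1 / (n + 2)\<close> and the error factor
    \<open>x / (1 - x)\<close> is \<open>1 / (n + 1)\<close>.\<close>
  define t where "t n = complex_of_real (\<rho> / real (n + 2))" for n
  have nt: "cmod (t n) = \<rho> / real (n + 2)" for n
    using \<rho> by (simp only: t_def norm_of_real) simp
  have t: "cmod (t n) < \<rho>" "t n \<noteq> 0" for n
  proof -
    have "0 < \<rho> / real (n + 2)" "\<rho> / real (n + 2) < \<rho>" using \<rho> by (auto simp: field_simps add_pos_nonneg)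
    then show "cmod (t n) < \<rho>" "t n \<noteq> 0" unfolding nt[symmetric] by auto
  qed
  have ud: "upd z i (p + t n) \<in> D" if "z \<in> D" for z n
    using upd_in_pdisc[of z y i \<rho> \<delta> "p + t n"] that t by (simp add: D_def p_def)
  define G where "G n z = (g (upd z i (p + t n)) - (\<Sum>m<l. taylor_coeff i p m g z * t n ^ m)) * inverse (t n ^ l)" for n z
  have hG: "holomorphic_map D (G n)" for n
    unfolding G_def
    by (intro holomorphic_map_mult holomorphic_map_diff holomorphic_map_sum less holomorphic_map_const
        holomorphic_map_compose[OF g(1) _ _ upd_has_derivative upd_smult])
      (use ud open_pdisc in \<open>auto simp: D_def\<close>)
  have GL: "cmod (G n z - taylor_coeff i p l g z) \<le> M / \<rho> ^ l * (1 / real (n + 1))" if z: "z \<in> D" for n z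
  proof -
    define x where "x = cmod (t n) / \<rho>"
    have x: "x = 1 / real (n + 2)" using \<rho> by (simp add: x_def nt)
    let ?R = "g (upd z i (p + t n)) - (\<Sum>m<Suc l. taylor_coeff i p m g z * t n ^ m)"
    have R: "cmod ?R \<le> M * x ^ Suc l / (1 - x)"
      using taylor_tail_bound[OF g ud[OF z], of n "Suc l"] by (simp add: x_def)
    have "G n z - taylor_coeff i p l g z = ?R * inverse (t n ^ l)"
      using t(2)[of n] by (simp add: G_def field_simps)
    then have "cmod (G n z - taylor_coeff i p l g z) = cmod ?R / cmod (t n) ^ l"
      by (simp add: norm_mult norm_inverse norm_power divide_inverse)
    also have "\<dots> \<le> (M * x ^ Suc l / (1 - x)) / cmod (t n) ^ l"
      by (intro divide_right_mono R) auto
    also have "\<dots> = M / \<rho> ^ l * (x / (1 - x))"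
    proof -
      have "cmod (t n) = x * \<rho>" using \<rho> by (simp add: x_def)
      moreover have "x > 0" by (simp add: x)
      moreover have "M * (x * a) / (1 - x) / (a * b) = M / b * (x / (1 - x))" if "a \<noteq> 0" "b \<noteq> 0" for a b
        using that by (cases "1 - x = 0") (simp_all add: divide_simps)
      ultimately show ?thesis using \<rho> by (simp add: power_mult_distrib)
    qed
    also have "x / (1 - x) = 1 / real (n + 1)" by (simp add: x field_simps)
    finally show ?thesis .
  qed
  have "uniform_limit D G (taylor_coeff i p l g) sequentially"
  proof (rule uniform_limitI)
    fix e :: real assume "e > 0"
    have "(\<lambda>n. M / \<rho> ^ l * (1 / real (n + 1))) \<longlonglongrightarrow> M / \<rho> ^ l * 0"
      by (intro tendsto_intros LIMSEQ_ignore_initial_segment[OF lim_1_over_n])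
    then have "\<forall>\<^sub>F n in sequentially. M / \<rho> ^ l * (1 / real (n + 1)) < e"
      using \<open>e > 0\<close> by (simp add: order_tendsto_iff)
    then show "\<forall>\<^sub>F n in sequentially. \<forall>z\<in>D. dist (G n z) (taylor_coeff i p l g z) < e"
      by eventually_elim (use GL in \<open>auto simp: dist_norm intro: le_less_trans\<close>)
  qed
  then show ?case
    by (intro holomorphic_map_uniform_limit[OF hG]) (auto simp: D_def open_pdisc)
qed

text \<open>The quotient in Weierstrass division by the monomial \<open>(z $ i - p) ^ d\<close>; the
  remainder consists of the first \<open>d\<close> Taylor terms.\<close>

definition taylor_quot :: "nat \<Rightarrow> (complex^'n \<Rightarrow> complex) \<Rightarrow> complex^'n \<Rightarrow> complex" where
  "taylor_quot d g z = (\<Sum>l. taylor_coeff i p (l + d) g z * (z $ i - p) ^ l)"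

lemma taylor_quot_term_bound:
  assumes g: "holomorphic_map D g" "\<And>z. z \<in> D \<Longrightarrow> cmod (g z) \<le> M" and z: "z \<in> D" "cmod (z $ i - p) \<le> s"
  shows "norm (taylor_coeff i p (l + d) g z * (z $ i - p) ^ l) \<le> M / \<rho> ^ d * (s / \<rho>) ^ l"
proof -
  have "norm (taylor_coeff i p (l + d) g z * (z $ i - p) ^ l) \<le> M / \<rho> ^ (l + d) * s ^ l"
    unfolding norm_mult norm_power
    using order_trans[OF norm_ge_zero taylor_coeff_bound[OF g z(1)]]
    by (intro mult_mono taylor_coeff_bound g z power_mono) auto
  also have "\<dots> = M / \<rho> ^ d * (s / \<rho>) ^ l" by (simp add: power_divide power_add)
  finally show ?thesis .
qed

lemma taylor_quot_eq:
  assumes g: "holomorphic_map D g" "\<And>z. z \<in> D \<Longrightarrow> cmod (g z) \<le> M" and z: "z \<in> D"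
  shows "g z = (z $ i - p) ^ d * taylor_quot d g z + (\<Sum>l<d. taylor_coeff i p l g z * (z $ i - p) ^ l)"
proof -
  have lt: "cmod (z $ i - p) / \<rho> < 1" using z \<rho> by (auto simp: D_def p_def pdisc_def)
  have "summable (\<lambda>l. taylor_coeff i p (l + d) g z * (z $ i - p) ^ l)"
    by (rule summable_comparison_test'[OF _ taylor_quot_term_bound[OF g z order_refl]])
      (use lt \<rho> in \<open>auto intro!: summable_mult summable_geometric\<close>)
  from summable_mult[OF this, of "(z $ i - p) ^ d"] suminf_mult[OF this, of "(z $ i - p) ^ d"]
  have "(\<lambda>l. taylor_coeff i p (l + d) g z * (z $ i - p) ^ (l + d)) sums ((z $ i - p) ^ d * taylor_quot d g z)"
    by (simp add: taylor_quot_def summable_sums power_add algebra_simps sums_iff)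
  moreover have "(\<lambda>l. taylor_coeff i p (l + d) g z * (z $ i - p) ^ (l + d)) sums
      (g z - (\<Sum>l<d. taylor_coeff i p l g z * (z $ i - p) ^ l))"
    using sums_split_initial_segment[OF taylor_coeff_sums[OF g(1) z], of d] .
  ultimately show ?thesis using sums_unique2 by fastforce
qed

text \<open>The geometric majorant is uniform only where \<open>z $ i\<close> stays at distance s <
  \<rho> from \<open>p\<close>, hence the local form of the limit theorem.\<close>

lemma taylor_quot_holomorphic:
  assumes g: "holomorphic_map D g" "\<And>z. z \<in> D \<Longrightarrow> cmod (g z) \<le> M"
  shows "holomorphic_map D (taylor_quot d g)"
proof (rule holomorphic_map_uniform_limit_local)
  show "holomorphic_map D (\<lambda>z. \<Sum>l<n. taylor_coeff i p (l + d) g z * (z $ i - p) ^ l)" for n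
    by (intro holomorphic_map_sum holomorphic_map_mult taylor_coeff_holomorphic[OF g]
        holomorphic_map_power holomorphic_map_diff holomorphic_map_component holomorphic_map_const)
  fix x assume x: "x \<in> D"
  then have "cmod (x $ i - p) < \<rho>" by (simp add: D_def p_def pdisc_def)
  then obtain s where s: "cmod (x $ i - p) < s" "s < \<rho>" using dense by blast
  have s0: "0 \<le> s" using s norm_ge_zero order.strict_trans1 less_imp_le by blast
  have sub: "pdisc y i s \<delta> \<subseteq> D" using s by (auto simp: D_def pdisc_def)
  have "uniform_limit (pdisc y i s \<delta>) (\<lambda>n z. \<Sum>l<n. taylor_coeff i p (l + d) g z * (z $ i - p) ^ l)
     (taylor_quot d g) sequentially"
    unfolding taylor_quot_def
  proof (rule Weierstrass_m_test)
    show "norm (taylor_coeff i p (l + d) g z * (z $ i - p) ^ l) \<le> M / \<rho> ^ d * (s / \<rho>) ^ l"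
      if "z \<in> pdisc y i s \<delta>" for l z
      by (rule taylor_quot_term_bound[OF g]) (use that sub in \<open>auto simp: pdisc_def p_def\<close>)
    show "summable (\<lambda>l. M / \<rho> ^ d * (s / \<rho>) ^ l)"
      using s s0 \<rho> by (intro summable_mult summable_geometric) auto
  qed
  then show "\<exists>V. open V \<and> x \<in> V \<and> V \<subseteq> D \<and> uniform_limit V (\<lambda>n z. \<Sum>l<n. taylor_coeff i p (l + d) g z * (z $ i - p) ^ l)
     (taylor_quot d g) sequentially"
    using x s sub open_pdisc by (intro exI[of _ "pdisc y i s \<delta>"]) (auto simp: D_def pdisc_def p_def)
qed

text \<open>On a circle of radius s the monomial has modulus \<open>s ^ d\<close>, and
  \<open>g\<close> minus \<open>d\<close> Taylor terms is at most \<open>(d + 1) * M\<close>; the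
  maximum principle carries the bound inside. Summing the series of moduli instead would bring in a
  factor that blows up at the boundary.\<close>

lemma taylor_quot_bound:
  assumes g: "holomorphic_map D g" "\<And>z. z \<in> D \<Longrightarrow> cmod (g z) \<le> M" and z: "z \<in> D"
  shows "cmod (taylor_quot d g z) \<le> real (Suc d) * M / \<rho> ^ d"
proof -
  let ?\<phi> = "\<lambda>t. taylor_quot d g (upd z i t)"
  let ?x = "cmod (z $ i - p)"
  have M: "0 \<le> M" using g(2)[OF z] norm_ge_zero order_trans by blast
  have lt: "?x < \<rho>" using z by (auto simp: D_def p_def pdisc_def)
  have hol: "?\<phi> holomorphic_on ball p \<rho>"
    by (rule slice_holomorphic[OF taylor_quot_holomorphic[OF g] z])
  have main: "cmod (taylor_quot d g z) \<le> real (Suc d) * M / s ^ d" if s: "?x < s" "s < \<rho>" for s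
  proof -
    have s0: "0 < s" using s norm_ge_zero order.strict_trans1 by blast
    have sub: "cball p s \<subseteq> ball p \<rho>" using s by auto
    have "norm (?\<phi> (z $ i)) \<le> real (Suc d) * M / s ^ d"
    proof (rule maximum_modulus_frontier[of ?\<phi> "ball p s"])
      show "?\<phi> holomorphic_on interior (ball p s)"
        using hol sub ball_subset_cball holomorphic_on_subset by (metis interior_ball order_trans)
      show "continuous_on (closure (ball p s)) ?\<phi>"
        using hol sub s0 holomorphic_on_subset holomorphic_on_imp_continuous_on by (metis closure_ball)
      show "z $ i \<in> ball p s" using s by (simp add: dist_norm norm_minus_commute)
      fix t assume "t \<in> frontier (ball p s)"
      then have t: "cmod (t - p) = s" using s0 by (simp add: dist_norm norm_minus_commute)
      have u: "upd z i t \<in> D" using upd_in_pdisc[of z y i \<rho> \<delta> t] z t s by (simp add: D_def p_def)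
      have "(t - p) ^ d * ?\<phi> t = g (upd z i t) - (\<Sum>l<d. taylor_coeff i p l g z * (t - p) ^ l)"
        using taylor_quot_eq[OF g u, of d] by simp
      then have "s ^ d * cmod (?\<phi> t) = cmod (g (upd z i t) - (\<Sum>l<d. taylor_coeff i p l g z * (t - p) ^ l))"
        using t by (metis norm_mult norm_power)
      also have "\<dots> \<le> M + (\<Sum>l<d. M)"
      proof (rule order_trans[OF norm_triangle_ineq4 add_mono[OF g(2)[OF u] sum_norm_le]])
        fix l
        have "norm (taylor_coeff i p l g z * (t - p) ^ l) \<le> M / \<rho> ^ l * s ^ l"
          unfolding norm_mult norm_power t by (intro mult_right_mono taylor_coeff_bound g z) (use s0 in auto)
        also have "\<dots> = M * (s / \<rho>) ^ l" by (simp add: power_divide)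
        also have "\<dots> \<le> M * 1"
          using s s0 \<rho> M by (intro mult_left_mono power_le_one) auto
        finally show "norm (taylor_coeff i p l g z * (t - p) ^ l) \<le> M" by simp
      qed
      also have "\<dots> = real (Suc d) * M" by (simp add: algebra_simps)
      finally show "norm (?\<phi> t) \<le> real (Suc d) * M / s ^ d"
        using s0 by (simp add: field_simps)
    qed auto
    then show ?thesis by simp
  qed
  show ?thesis
  proof (rule tendsto_lowerbound)
    show "((\<lambda>s. real (Suc d) * M / s ^ d) \<longlongrightarrow> real (Suc d) * M / \<rho> ^ d) (at_left \<rho>)"
      using \<rho> by (auto intro!: tendsto_intros)
    show "\<forall>\<^sub>F s in at_left \<rho>. cmod (taylor_quot d g z) \<le> real (Suc d) * M / s ^ d"
      using eventually_at_left_real[OF lt] by (rule eventually_mono) (use main in auto)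
  qed simp
qed

end

section \<open>Weierstrass division\<close>

text \<open>By continuity the equation may be evaluated at 0, where only \<open>c 0\<close>
  survives; then one factor t cancels and induction on \<open>d\<close> applies.\<close>

lemma power_times_plus_low_degree_zero:
  fixes \<phi> :: "complex \<Rightarrow> complex"
  assumes "isCont \<phi> 0" "\<forall>\<^sub>F t in at 0. t ^ d * \<phi> t + (\<Sum>l<d. c l * t ^ l) = 0"
  shows "l < d \<Longrightarrow> c l = 0"
  using assms(2)
proof (induction d arbitrary: c l)
  case (Suc d)
  let ?f = "\<lambda>t. t ^ Suc d * \<phi> t + (\<Sum>l<Suc d. c l * t ^ l)"
  have "isCont ?f 0" 
    unfolding isCont_def by (intro tendsto_intros assms(1)[unfolded isCont_def])
  then have "?f \<midarrow>0\<rightarrow> ?f 0" by (simp only: isCont_def)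
  moreover have "?f \<midarrow>0\<rightarrow> 0" using Suc.prems(2) by (rule tendsto_eventually)
  ultimately have "?f 0 = 0" by (rule LIM_unique)
  then have c0: "c 0 = 0" by (simp add: sum.lessThan_Suc_shift)
  have "\<forall>\<^sub>F t in at 0. t ^ d * \<phi> t + (\<Sum>l<d. c (Suc l) * t ^ l) = 0"
    using Suc.prems(2) eventually_neq_at_within[of 0 0 UNIV]
  proof eventually_elim
    case (elim t)
    have "t * (t ^ d * \<phi> t + (\<Sum>l<d. c (Suc l) * t ^ l)) = 0"
      using elim(1) c0 unfolding sum.lessThan_Suc_shift
      by (simp add: algebra_simps sum_distrib_left)
    then show ?case using elim(2) by simp
  qed
  from Suc.IH[OF _ this] c0 Suc.prems(1) show ?case by (cases l) auto
qed simp

text \<open>The norm estimate makes multiplication by \<open>F = (z\<^sub>i - y\<^sub>i)\<^sup>d + e\<close> a small perturbation of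
  multiplication by \<open>(z\<^sub>i - y\<^sub>i)\<^sup>d\<close>, so division by \<open>F\<close> converges as a geometric series.\<close>

context
  fixes y :: "complex^'n" and i :: 'n and \<rho> \<delta> \<epsilon> :: real and D and p and d :: nat and e
  assumes \<rho>: "\<rho> > 0" and \<delta>: "\<delta> > 0"
  defines "D \<equiv> pdisc y i \<rho> \<delta>" and "p \<equiv> y $ i"
  assumes e: "holomorphic_map D e" "\<And>z. z \<in> D \<Longrightarrow> cmod (e z) \<le> \<epsilon>"
    and small: "real (Suc d) / \<rho> ^ d * \<epsilon> \<le> 1 / 2"
begin

lemma \<epsilon>_nonneg: "0 \<le> \<epsilon>"
  using e(2)[of y] pdisc_center[OF \<rho> \<delta>] norm_ge_zero order_trans unfolding D_def by blast

lemma perturbed_division_exists: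
  assumes g: "holomorphic_map D g" "\<And>z. z \<in> D \<Longrightarrow> cmod (g z) \<le> M"
  obtains q c where "holomorphic_map D q" "\<And>l. holomorphic_map D (c l)"
    "\<And>z. z \<in> D \<Longrightarrow> cmod (q z) \<le> 2 * (real (Suc d) * M / \<rho> ^ d)"
    "\<And>l z t. c l (upd z i t) = c l z"
    "\<And>z. z \<in> D \<Longrightarrow> g z = ((z $ i - p) ^ d + e z) * q z + (\<Sum>l<d. c l z * (z $ i - p) ^ l)"
proof -
  define Q where "Q = taylor_quot y i d"
  \<comment> \<open>Replacing the monomial by \<open>F\<close> in the Taylor division of
    \<open>h n\<close> costs \<open>e * Q (h n)\<close>, so \<open>h (Suc n)\<close> is what remains
    to be divided. By the quotient bound and \<open>small\<close>, each step halves the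
    bound.\<close>
  define h where "h n = ((\<lambda>u z. - e z * Q u z) ^^ n) g" for n
  have h0: "h 0 = g" and hS: "h (Suc n) z = - e z * Q (h n) z" for n z
    by (auto simp: h_def)
  have M: "0 \<le> M" using g(2)[of y] pdisc_center[OF \<rho> \<delta>] norm_ge_zero order_trans unfolding D_def by blast
  have h: "holomorphic_map D (h n) \<and> (\<forall>z\<in>D. cmod (h n z) \<le> M * (1 / 2) ^ n)" for n
  proof (induction n)
    case 0
    then show ?case using g by (simp add: h0)
  next
    case (Suc n)
    have hn: "holomorphic_map (pdisc y i \<rho> \<delta>) (h n)" "\<And>z. z \<in> pdisc y i \<rho> \<delta> \<Longrightarrow> cmod (h n z) \<le> M * (1 / 2) ^ n"
      using Suc by (auto simp: D_def)
    have "holomorphic_map D (\<lambda>z. - e z * Q (h n) z)"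
      unfolding Q_def by (intro holomorphic_map_mult holomorphic_map_uminus e)
        (use taylor_quot_holomorphic[OF \<rho> \<delta> hn] in \<open>simp add: D_def\<close>)
    moreover have "cmod (h (Suc n) z) \<le> M * (1 / 2) ^ Suc n" if "z \<in> D" for z
    proof -
      have "cmod (h (Suc n) z) \<le> \<epsilon> * (real (Suc d) * (M * (1 / 2) ^ n) / \<rho> ^ d)"
        unfolding hS norm_mult norm_minus_cancel Q_def
        by (intro mult_mono e that taylor_quot_bound[OF \<rho> \<delta> hn] \<epsilon>_nonneg) (use that in \<open>auto simp: D_def\<close>)
      also have "\<dots> = (real (Suc d) / \<rho> ^ d * \<epsilon>) * (M * (1 / 2) ^ n)" by simp
      also have "\<dots> \<le> 1 / 2 * (M * (1 / 2) ^ n)" using M small by (intro mult_right_mono) auto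
      finally show ?thesis by simp
    qed
    moreover have "h (Suc n) = (\<lambda>z. - e z * Q (h n) z)" using hS by blast
    ultimately show ?case by simp
  qed
  have hn: "holomorphic_map (pdisc y i \<rho> \<delta>) (h n)"
    "\<And>z. z \<in> pdisc y i \<rho> \<delta> \<Longrightarrow> cmod (h n z) \<le> M * (1 / 2) ^ n" for n
    using h by (auto simp: D_def)
  define C where "C = real (Suc d) * M / \<rho> ^ d"
  have qn: "holomorphic_map D (Q (h n))" "z \<in> D \<Longrightarrow> norm (Q (h n) z) \<le> C * (1 / 2) ^ n" for n z
    using taylor_quot_holomorphic[OF \<rho> \<delta> hn(1)[of n] hn(2), where d = d] taylor_quot_bound[OF \<rho> \<delta> hn(1)[of n] hn(2), where d = d and z = z]
    by (simp_all add: D_def Q_def C_def)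
  let ?c = "\<lambda>l n. taylor_coeff i p l (h n)"
  have cn: "holomorphic_map D (?c l n)" "z \<in> D \<Longrightarrow> norm (?c l n z) \<le> M / \<rho> ^ l * (1 / 2) ^ n" for l n z
    using taylor_coeff_holomorphic[OF \<rho> \<delta> hn(1)[of n] hn(2), where l = l] taylor_coeff_bound[OF \<rho> \<delta> hn(1)[of n] hn(2), where z = z and l = l]
    by (simp_all add: D_def p_def)
  define q where "q z = (\<Sum>n. Q (h n) z)" for z
  define c where "c l z = (\<Sum>n. ?c l n z)" for l z
  have geo: "summable (\<lambda>n. K * (1 / 2 :: real) ^ n)" for K
    by (intro summable_mult summable_geometric) simp
  have uq: "uniform_limit D (\<lambda>N z. \<Sum>n<N. Q (h n) z) q sequentially"
    unfolding q_def by (rule Weierstrass_m_test[OF qn(2) geo])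
  have uc: "uniform_limit D (\<lambda>N z. \<Sum>n<N. ?c l n z) (c l) sequentially" for l
    unfolding c_def by (rule Weierstrass_m_test[OF cn(2) geo])
  show thesis
  proof
    show "holomorphic_map D q"
      by (rule holomorphic_map_uniform_limit[OF holomorphic_map_sum[OF qn(1)] _ uq])
        (simp add: D_def open_pdisc)
    show "holomorphic_map D (c l)" for l
      by (rule holomorphic_map_uniform_limit[OF holomorphic_map_sum[OF cn(1)] _ uc])
        (simp add: D_def open_pdisc)
    show "c l (upd z i t) = c l z" for l z t by (simp add: c_def)
  next
    fix z assume z: "z \<in> D"
    have "cmod (q z) \<le> (\<Sum>n. C * (1 / 2) ^ n)"
      unfolding q_def by (rule norm_suminf_le[OF qn(2)[OF z] geo])
    also have "\<dots> = C * 2"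
      by (subst suminf_mult) (auto simp: suminf_geometric intro!: summable_geometric)
    finally show "cmod (q z) \<le> 2 * (real (Suc d) * M / \<rho> ^ d)" by (simp add: C_def ac_simps)
  next
    fix z assume z: "z \<in> D"
    let ?F = "(z $ i - p) ^ d + e z"
    have step: "h n z = ?F * Q (h n) z + h (Suc n) z + (\<Sum>l<d. ?c l n z * (z $ i - p) ^ l)" for n
      using taylor_quot_eq[OF \<rho> \<delta> hn(1)[of n] hn(2), where z = z and d = d] z
      by (simp add: D_def Q_def hS p_def algebra_simps)
    have part: "g z - h N z = ?F * (\<Sum>n<N. Q (h n) z) + (\<Sum>l<d. (\<Sum>n<N. ?c l n z) * (z $ i - p) ^ l)" for N
    proof (induction N)
      case (Suc N)
      have "g z - h (Suc N) z = (g z - h N z) + (?F * Q (h N) z + (\<Sum>l<d. ?c l N z * (z $ i - p) ^ l))"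
        using step[of N] by simp
      then show ?case unfolding Suc by (simp add: algebra_simps sum.distrib)
    qed (simp add: h0)
    have "(\<lambda>N. M * (1 / 2) ^ N) \<longlonglongrightarrow> M * 0" by (intro tendsto_intros LIMSEQ_realpow_zero) auto
    then have "(\<lambda>N. h N z) \<longlonglongrightarrow> 0"
      using h z by (intro Lim_null_comparison[of "\<lambda>N. h N z" "\<lambda>N. M * (1 / 2) ^ N"]) auto
    then have "(\<lambda>N. g z - h N z) \<longlonglongrightarrow> g z - 0" by (intro tendsto_intros)
    moreover have "(\<lambda>N. g z - h N z) \<longlonglongrightarrow> ?F * q z + (\<Sum>l<d. c l z * (z $ i - p) ^ l)"
      unfolding part by (intro tendsto_intros tendsto_uniform_limitI[OF uq z] tendsto_uniform_limitI[OF uc z])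
    ultimately show "g z = ?F * q z + (\<Sum>l<d. c l z * (z $ i - p) ^ l)"
      using LIMSEQ_unique by fastforce
  qed
qed

text \<open>On each slice \<open>power_times_plus_low_degree_zero\<close> kills the remainder; then
  \<open>q\<close> vanishes off the centre of the slice, and continuity adds the centre.\<close>

lemma monomial_division_unique:
  assumes q: "holomorphic_map D q" and c: "\<And>l z t. c l (upd z i t) = c l z"
    and eq: "\<And>z. z \<in> D \<Longrightarrow> (z $ i - p) ^ d * q z + (\<Sum>l<d. c l z * (z $ i - p) ^ l) = 0"
    and z: "z \<in> D"
  shows "q z = 0"
proof -
  let ?\<phi> = "\<lambda>t. q (upd z i (p + t))"
  have "(\<lambda>t. q (upd z i t)) holomorphic_on ball p \<rho>"
    using slice_holomorphic[OF \<rho> \<delta>] q z unfolding D_def p_def by blast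
  then have cont: "continuous_on (ball p \<rho>) (\<lambda>t. q (upd z i t))"
    by (rule holomorphic_on_imp_continuous_on)
  have "isCont ?\<phi> t" if "cmod t < \<rho>" for t
  proof -
    have "isCont (\<lambda>t. q (upd z i t)) (p + t)"
      using cont that by (simp add: continuous_on_eq_continuous_at dist_norm)
    then show ?thesis by (rule isCont_o2[where f = "\<lambda>t. p + t", rotated]) simp
  qed
  note isC = this
  have ev: "\<forall>\<^sub>F t in at 0. t ^ d * ?\<phi> t + (\<Sum>l<d. c l z * t ^ l) = 0"
  proof -
    have "t ^ d * ?\<phi> t + (\<Sum>l<d. c l z * t ^ l) = 0" if "cmod t < \<rho>" for t
      using eq[of "upd z i (p + t)"] upd_in_pdisc[of z y i \<rho> \<delta> "p + t"] that z
      by (simp add: D_def p_def c)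
    then show ?thesis unfolding eventually_at using \<rho> by (auto simp: dist_norm)
  qed
  have c0: "c l z = 0" if "l < d" for l
    by (rule power_times_plus_low_degree_zero[OF isC ev that]) (use \<rho> in simp)
  have qz: "q (upd z i (p + t)) = 0" if "cmod t < \<rho>" "t \<noteq> 0" for t
    using eq[of "upd z i (p + t)"] upd_in_pdisc[of z y i \<rho> \<delta> "p + t"] that z
    by (simp add: D_def p_def c c0)
  have "?\<phi> \<midarrow>0\<rightarrow> 0"
    by (rule tendsto_eventually) (use qz \<rho> in \<open>auto simp: eventually_at dist_norm intro!: exI[of _ \<rho>]\<close>)
  moreover have "?\<phi> \<midarrow>0\<rightarrow> ?\<phi> 0" using isC[of 0] \<rho> by (simp add: isCont_def)
  ultimately have "?\<phi> 0 = 0" using LIM_unique by blast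
  then have "q (upd z i (p + t)) = 0" if "cmod t < \<rho>" for t using that qz by (cases "t = 0") auto
  from this[of "z $ i - p"] show ?thesis using z by (simp add: D_def p_def pdisc_def)
qed

text \<open>Moving \<open>e * q\<close> to the other side exhibits \<open>q\<close> as the quotient
  of \<open>- e * q\<close> by the monomial, so every bound of \<open>q\<close> may be halved;
  repeating this leaves 0.\<close>

lemma perturbed_division_unique:
  assumes q: "holomorphic_map D q" "\<And>z. z \<in> D \<Longrightarrow> cmod (q z) \<le> B"
    and c: "\<And>l z t. c l (upd z i t) = c l z"
    and eq: "\<And>z. z \<in> D \<Longrightarrow> ((z $ i - p) ^ d + e z) * q z + (\<Sum>l<d. c l z * (z $ i - p) ^ l) = 0"
    and z: "z \<in> D"
  shows "q z = 0"
proof -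
  have eps: "0 \<le> \<epsilon>" using e(2)[OF z] norm_ge_zero order_trans by blast
  have step: "cmod (q z) \<le> b / 2" if z: "z \<in> D" and b: "\<And>z. z \<in> D \<Longrightarrow> cmod (q z) \<le> b" for b z
  proof -
    have b0: "0 \<le> b" using b[OF z] norm_ge_zero order_trans by blast
    let ?g = "\<lambda>z. - e z * q z"
    have g: "holomorphic_map (pdisc y i \<rho> \<delta>) ?g" "z \<in> pdisc y i \<rho> \<delta> \<Longrightarrow> cmod (?g z) \<le> \<epsilon> * b" for z
      using e q b eps unfolding D_def norm_mult norm_minus_cancel
      by (auto intro!: holomorphic_map_mult holomorphic_map_uminus mult_mono)
    let ?Q = "taylor_quot y i d ?g"
    have "q z - ?Q z = 0"
    proof (rule monomial_division_unique[where c = "\<lambda>l z. c l z - taylor_coeff i p l ?g z"])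
      show "holomorphic_map D (\<lambda>z. q z - ?Q z)"
        using taylor_quot_holomorphic[OF \<rho> \<delta> g] q by (intro holomorphic_map_diff) (auto simp: D_def)
      fix z assume "z \<in> D"
      then have "(z $ i - p) ^ d * q z + (\<Sum>l<d. c l z * (z $ i - p) ^ l) = ?g z"
        using eq[of z] by (simp add: algebra_simps eq_neg_iff_add_eq_0)
      moreover have "?g z = (z $ i - p) ^ d * ?Q z + (\<Sum>l<d. taylor_coeff i p l ?g z * (z $ i - p) ^ l)"
        using taylor_quot_eq[OF \<rho> \<delta> g, of z d] \<open>z \<in> D\<close> by (simp add: D_def p_def)
      ultimately show "(z $ i - p) ^ d * (q z - ?Q z) + (\<Sum>l<d. (c l z - taylor_coeff i p l ?g z) * (z $ i - p) ^ l) = 0"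
        by (simp only: left_diff_distrib right_diff_distrib sum_subtractf) (simp add: algebra_simps)
    qed (use c z in auto)
    then have "cmod (q z) = cmod (?Q z)" by simp
    also have "\<dots> \<le> real (Suc d) * (\<epsilon> * b) / \<rho> ^ d"
      using taylor_quot_bound[OF \<rho> \<delta> g, of z d] z by (simp add: D_def)
    also have "\<dots> = (real (Suc d) / \<rho> ^ d * \<epsilon>) * b" by simp
    also have "\<dots> \<le> 1 / 2 * b" by (rule mult_right_mono[OF small b0])
    finally show ?thesis by simp
  qed
  have "\<forall>z\<in>D. cmod (q z) \<le> B * (1 / 2) ^ n" for n
  proof (induction n)
    case (Suc n)
    then show ?case using step[of _ "B * (1 / 2) ^ n"] by auto
  qed (use q in auto)
  moreover have "(\<lambda>n. B * (1 / 2) ^ n) \<longlonglongrightarrow> B * 0" by (intro tendsto_intros LIMSEQ_realpow_zero) auto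
  ultimately have "cmod (q z) \<le> 0"
    using z by (intro tendsto_lowerbound[of "\<lambda>n. B * (1 / 2) ^ n" 0 sequentially]) auto
  then show ?thesis by simp
qed

end

section \<open>Division by a function that is regular in one coordinate\<close>

lemma isCont_nhds_less:
  fixes g :: "'a::t2_space \<Rightarrow> real"
  assumes "isCont g x"
  shows "g x < c \<Longrightarrow> \<forall>\<^sub>F z in nhds x. g z < c" "c < g x \<Longrightarrow> \<forall>\<^sub>F z in nhds x. c < g z"
proof -
  have "(g \<longlongrightarrow> g x) (nhds x)" using assms by (simp add: isCont_def tendsto_at_iff_tendsto_nhds)
  from order_tendstoD[OF this] show "g x < c \<Longrightarrow> \<forall>\<^sub>F z in nhds x. g z < c" "c < g x \<Longrightarrow> \<forall>\<^sub>F z in nhds x. c < g z"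
    by auto
qed

lemma hol_at_bounded_nhd:
  assumes "hol_at y g"
  obtains W M where "open W" "y \<in> W" "holomorphic_map W g" "\<And>z. z \<in> W \<Longrightarrow> norm (g z) \<le> M"
proof -
  obtain U where U: "open U" "y \<in> U" "holomorphic_map U g" using assms unfolding hol_at_def by blast
  have "\<forall>\<^sub>F z in nhds y. norm (g z) < norm (g y) + 1"
    by (rule isCont_nhds_less[OF continuous_norm[OF hol_at_isCont[OF assms]]]) simp
  then obtain V where V: "open V" "y \<in> V" "\<And>z. z \<in> V \<Longrightarrow> norm (g z) < norm (g y) + 1"
    unfolding eventually_nhds by blast
  show thesis
    by (rule that[of "U \<inter> V" "norm (g y) + 1"])
      (use U V in \<open>auto intro: holomorphic_map_subset less_imp_le\<close>)
qed

text \<open>Let \<open>d\<close> be the order of vanishing at \<open>y\<close> of the slice.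
  Splitting off the first \<open>d\<close> Taylor terms writes \<open>f\<close> as a unit
  \<open>u\<close> times \<open>(z $ i - y $ i) ^ d + e\<close>, where \<open>e\<close> vanishes on
  the slice through \<open>y\<close>. So \<open>e\<close> is small on thin polydiscs, and division
  by \<open>f\<close> is perturbed division up to the unit.\<close>

theorem weierstrass_division:
  fixes f :: "complex^'n \<Rightarrow> complex"
  assumes f: "hol_at y f" and nz: "\<not> (\<forall>\<^sub>F t in nhds 0. f (upd y i (y $ i + t)) = 0)"
  obtains d u where "hol_at y u" "u y \<noteq> 0"
    "\<forall>\<^sub>F t in nhds 0. f (upd y i (y $ i + t)) = t ^ d * u (upd y i (y $ i + t))"
    "\<And>g. hol_at y g \<Longrightarrow> \<exists>q c. hol_at y q \<and> (\<forall>l. hol_at y (c l)) \<and> (\<forall>l z t. c l (upd z i t) = c l z) \<and>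
        (\<forall>\<^sub>F z in nhds y. g z = f z * q z + (\<Sum>l<d. c l z * (z $ i - y $ i) ^ l))"
    "\<And>q c. hol_at y q \<Longrightarrow> (\<And>l z t. c l (upd z i t) = c l z) \<Longrightarrow>
        \<forall>\<^sub>F z in nhds y. f z * q z + (\<Sum>l<d. c l z * (z $ i - y $ i) ^ l) = (0::complex) \<Longrightarrow>
        \<forall>\<^sub>F z in nhds y. q z = 0"
proof -
  define p where "p = y $ i"
  obtain W0 M where W0: "open W0" "y \<in> W0" "holomorphic_map W0 f" "\<And>z. z \<in> W0 \<Longrightarrow> cmod (f z) \<le> M"
    using hol_at_bounded_nhd[OF f] by blast
  obtain r where r: "r > 0" and rs: "\<And>\<rho> \<delta>. \<rho> \<le> r \<Longrightarrow> \<delta> \<le> r \<Longrightarrow> pdisc y i \<rho> \<delta> \<subseteq> W0"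
    using pdisc_subset_open[OF W0(1,2)] by metis
  define D0 where "D0 = pdisc y i r r"
  have fD: "holomorphic_map (pdisc y i r r) f" "\<And>z. z \<in> pdisc y i r r \<Longrightarrow> cmod (f z) \<le> M"
    using W0 rs[of r r] holomorphic_map_subset by auto
  have yD0: "y \<in> pdisc y i r r" using pdisc_center r by blast
  let ?c = "\<lambda>l. taylor_coeff i p l f"
  have ex: "\<exists>l. ?c l y \<noteq> 0"
  proof (rule ccontr)
    assume "\<not> (\<exists>l. ?c l y \<noteq> 0)"
    then have "f (upd y i (y $ i + t)) = 0" if "cmod t < r" for t
      using taylor_coeff_sums[OF r r fD(1), of "upd y i (y $ i + t)"] that upd_in_pdisc[OF yD0, of "y $ i + t"]
      by (simp add: p_def sums_unique[symmetric] sums_iff)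
    then have "\<forall>\<^sub>F t in nhds 0. f (upd y i (y $ i + t)) = 0"
      using r by (auto simp: eventually_nhds_metric dist_norm)
    then show False using nz by blast
  qed
  define d where "d = (LEAST l. ?c l y \<noteq> 0)"
  have d: "?c d y \<noteq> 0" "l < d \<Longrightarrow> ?c l y = 0" for l
    using LeastI_ex[OF ex] not_less_Least[of l "\<lambda>l. ?c l y \<noteq> 0"] by (auto simp: d_def)
  define u where "u = taylor_quot y i d f"
  have hu: "holomorphic_map D0 u" using taylor_quot_holomorphic[OF r r fD] by (simp add: u_def D0_def)
  have feq: "f z = (z $ i - p) ^ d * u z + (\<Sum>l<d. ?c l z * (z $ i - p) ^ l)" if "z \<in> D0" for z
    using taylor_quot_eq[OF r r fD, of z d] that by (simp add: u_def p_def D0_def)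
  have hau: "hol_at y u" using hu open_pdisc yD0 hol_atI unfolding D0_def by blast
  have hc: "holomorphic_map D0 (?c l)" for l
    using taylor_coeff_holomorphic[OF r r fD] by (simp add: p_def D0_def)
  have uy: "u y = ?c d y"
    unfolding u_def taylor_quot_def[OF r r] using powser_zero[of "\<lambda>l. taylor_coeff i (y $ i) (l + d) f y"]
    by (simp add: p_def)
  have uy0: "u y \<noteq> 0" using uy d by simp
  \<comment> \<open>Bounds \<open>inverse (u z)\<close> wherever \<open>u\<close> keeps at least
    half the modulus of \<open>u y\<close>.\<close>
  define K where "K = 2 / cmod (u y)"
  have K: "K > 0" using uy0 by (simp add: K_def)
  have "\<forall>\<^sub>F z in nhds y. cmod (u y) / 2 < cmod (u z)"
    by (rule isCont_nhds_less[OF continuous_norm[OF hol_at_isCont[OF hau]]]) (use uy0 in simp)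
  then obtain V1 where V1: "open V1" "y \<in> V1" "\<And>z. z \<in> V1 \<Longrightarrow> cmod (u y) / 2 < cmod (u z)"
    unfolding eventually_nhds by blast
  define e where "e z = (\<Sum>l<d. ?c l z * (z $ i - p) ^ l) * inverse (u z)" for z
  \<comment> \<open>The factorisation is wanted inside every neighbourhood \<open>W\<close>, because
    each dividend and each candidate quotient brings a domain of its own.\<close>
  have key: "\<exists>\<rho> \<delta> \<epsilon>. \<rho> > 0 \<and> \<delta> > 0 \<and> pdisc y i \<rho> \<delta> \<subseteq> W \<and> holomorphic_map (pdisc y i \<rho> \<delta>) e \<and>
      holomorphic_map (pdisc y i \<rho> \<delta>) u \<and> (\<forall>z\<in>pdisc y i \<rho> \<delta>. cmod (e z) \<le> \<epsilon>) \<and>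
      real (Suc d) / \<rho> ^ d * \<epsilon> \<le> 1 / 2 \<and>
      (\<forall>z\<in>pdisc y i \<rho> \<delta>. u z \<noteq> 0 \<and> f z = u z * ((z $ i - p) ^ d + e z))"
    if W: "open W" "y \<in> W" for W
  proof -
    have "open (W \<inter> V1 \<inter> D0)" "y \<in> W \<inter> V1 \<inter> D0" using W V1 yD0 by (auto simp: D0_def open_pdisc)
    from pdisc_subset_open[OF this] obtain \<rho> where \<rho>: "\<rho> > 0"
      "\<And>\<rho>' \<delta>. \<rho>' \<le> \<rho> \<Longrightarrow> \<delta> \<le> \<rho> \<Longrightarrow> pdisc y i \<rho>' \<delta> \<subseteq> W \<inter> V1 \<inter> D0" by metis
    \<comment> \<open>The largest bound that perturbed division allows:
      \<open>real (Suc d) / \<rho> ^ d * \<epsilon>\<close> is exactly 1/2.\<close>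
    define \<epsilon> where "\<epsilon> = \<rho> ^ d / (2 * real (Suc d))"
    have eps: "\<epsilon> > 0" using \<rho> by (simp add: \<epsilon>_def)
    \<comment> \<open>A bound for the numerator of \<open>e\<close> that ignores the coordinate
      \<open>i\<close> and vanishes at \<open>y\<close>; so \<delta> can be shrunk while \<rho>
      stays fixed.\<close>
    define s where "s z = (\<Sum>l<d. cmod (?c l z) * \<rho> ^ l)" for z
    have "isCont s y"
      unfolding s_def
      by (intro continuous_intros hol_at_isCont hol_atI[OF open_pdisc yD0]) (use hc in \<open>simp add: D0_def\<close>)
    moreover have "s y = 0" using d by (simp add: s_def)
    ultimately have "\<forall>\<^sub>F z in nhds y. s z < \<epsilon> / K"
      using isCont_nhds_less(1)[where g = s and x = y and c = "\<epsilon> / K"] eps K by simp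
    then obtain V2 where V2: "open V2" "y \<in> V2" "\<And>z. z \<in> V2 \<Longrightarrow> s z < \<epsilon> / K"
      unfolding eventually_nhds by blast
    from pdisc_subset_open[OF V2(1,2)] obtain \<delta>0 where \<delta>0: "\<delta>0 > 0"
      "\<And>\<rho>' \<delta>. \<rho>' \<le> \<delta>0 \<Longrightarrow> \<delta> \<le> \<delta>0 \<Longrightarrow> pdisc y i \<rho>' \<delta> \<subseteq> V2" by metis
    define \<delta> where "\<delta> = min \<delta>0 \<rho>"
    let ?D = "pdisc y i \<rho> \<delta>"
    have sub: "?D \<subseteq> W \<inter> V1 \<inter> D0" by (rule \<rho>) (auto simp: \<delta>_def)
    have un: "u z \<noteq> 0" "cmod (inverse (u z)) \<le> K" if "z \<in> ?D" for z
    proof -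
      have lt: "cmod (u y) / 2 < cmod (u z)" using that sub V1 by blast
      then show "u z \<noteq> 0" using norm_ge_zero[of "u y"] by auto
      show "cmod (inverse (u z)) \<le> K"
        using le_imp_inverse_le[of "cmod (u y) / 2" "cmod (u z)"] lt uy0 by (simp add: norm_inverse K_def)
    qed
    have hu': "holomorphic_map ?D u" using hu sub holomorphic_map_subset by blast
    have "cmod (e z) \<le> \<epsilon>" if z: "z \<in> ?D" for z
    proof -
      \<comment> \<open>\<open>s\<close> ignores the coordinate \<open>i\<close>, so
        \<open>z\<close> may be moved to the centre there before \<open>V2\<close> is used, which is
        small in that coordinate too.\<close>
      have "upd z i (y $ i) \<in> pdisc y i \<delta> \<delta>" using z \<delta>0 \<rho> by (auto simp: pdisc_def \<delta>_def)
      then have "upd z i (y $ i) \<in> V2" using \<delta>0(2)[of \<delta> \<delta>] by (auto simp: \<delta>_def)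
      then have sz: "s z < \<epsilon> / K" using V2(3) by (fastforce simp: s_def)
      have "cmod (\<Sum>l<d. ?c l z * (z $ i - p) ^ l) \<le> s z"
        unfolding s_def using z
        by (intro sum_norm_le) (auto simp: norm_mult norm_power pdisc_def p_def intro!: mult_left_mono power_mono)
      then have "cmod (e z) \<le> \<epsilon> / K * K"
        unfolding e_def norm_mult using un[OF z] sz K eps by (intro mult_mono) auto
      then show ?thesis using K by simp
    qed
    moreover have "holomorphic_map ?D e"
      unfolding e_def
      by (intro holomorphic_map_mult holomorphic_map_sum holomorphic_map_inverse hu' un
          holomorphic_map_power holomorphic_map_diff holomorphic_map_component holomorphic_map_const)
        (use hc sub holomorphic_map_subset in blast)
    moreover have "f z = u z * ((z $ i - p) ^ d + e z)" if "z \<in> ?D" for z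
      using feq[of z] un[OF that] sub that by (auto simp: e_def algebra_simps)
    moreover have "real (Suc d) / \<rho> ^ d * \<epsilon> \<le> 1 / 2" using \<rho>(1) by (simp add: \<epsilon>_def)
    moreover have "\<delta> > 0" using \<delta>0 \<rho> by (simp add: \<delta>_def)
    ultimately show ?thesis using \<rho>(1) sub hu' un by blast
  qed
  show thesis
  proof (rule that[OF hau uy0])
    have "f (upd y i (y $ i + t)) = t ^ d * u (upd y i (y $ i + t))" if "cmod t < r" for t
      using feq[of "upd y i (y $ i + t)"] that upd_in_pdisc[OF yD0, of "y $ i + t"] d(2)
      by (simp add: p_def D0_def)
    then show "\<forall>\<^sub>F t in nhds 0. f (upd y i (y $ i + t)) = t ^ d * u (upd y i (y $ i + t))"
      using r by (auto simp: eventually_nhds_metric dist_norm)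
  next
    fix g :: "complex^'n \<Rightarrow> complex" assume "hol_at y g"
    then obtain W N where W: "open W" "y \<in> W" "holomorphic_map W g" "\<And>z. z \<in> W \<Longrightarrow> cmod (g z) \<le> N"
      using hol_at_bounded_nhd by blast
    obtain \<rho> \<delta> \<epsilon> where D: "\<rho> > 0" "\<delta> > 0" "pdisc y i \<rho> \<delta> \<subseteq> W" "holomorphic_map (pdisc y i \<rho> \<delta>) e"
      "holomorphic_map (pdisc y i \<rho> \<delta>) u" "\<forall>z\<in>pdisc y i \<rho> \<delta>. cmod (e z) \<le> \<epsilon>"
      "real (Suc d) / \<rho> ^ d * \<epsilon> \<le> 1 / 2"
      "\<forall>z\<in>pdisc y i \<rho> \<delta>. u z \<noteq> 0 \<and> f z = u z * ((z $ i - p) ^ d + e z)"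
      using key[OF W(1,2)] by (elim exE conjE) (rule that)
    have D8: "u z \<noteq> 0" "f z = u z * ((z $ i - p) ^ d + e z)" if "z \<in> pdisc y i \<rho> \<delta>" for z
      using D(8) that by auto
    let ?D = "pdisc y i \<rho> \<delta>"
    have gD: "holomorphic_map ?D g" "\<And>z. z \<in> ?D \<Longrightarrow> cmod (g z) \<le> N"
      using W D(3) holomorphic_map_subset by auto
    obtain q c where qc: "holomorphic_map ?D q" "\<And>l. holomorphic_map ?D (c l)"
      "\<And>l z t. c l (upd z i t) = c l z"
      "\<And>z. z \<in> ?D \<Longrightarrow> g z = ((z $ i - y $ i) ^ d + e z) * q z + (\<Sum>l<d. c l z * (z $ i - y $ i) ^ l)"
      by (rule perturbed_division_exists[OF D(1,2,4) bspec[OF D(6)] D(7) gD]) (assumption | rule that)+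
    have y: "y \<in> ?D" using pdisc_center D by blast
    have "holomorphic_map ?D (\<lambda>z. inverse (u z) * q z)"
      by (intro holomorphic_map_mult holomorphic_map_inverse D D8 qc)
    moreover have "\<forall>\<^sub>F z in nhds y. g z = f z * (inverse (u z) * q z) + (\<Sum>l<d. c l z * (z $ i - y $ i) ^ l)"
      unfolding eventually_nhds
    proof (intro exI[of _ ?D] conjI ballI)
      fix z assume z: "z \<in> ?D"
      have "f z * (inverse (u z) * q z) = ((z $ i - y $ i) ^ d + e z) * q z"
        using D8[OF z] by (simp add: p_def)
      then show "g z = f z * (inverse (u z) * q z) + (\<Sum>l<d. c l z * (z $ i - y $ i) ^ l)"
        by (simp only: qc(4)[OF z])
    qed (use y open_pdisc in auto)
    ultimately show "\<exists>q c. hol_at y q \<and> (\<forall>l. hol_at y (c l)) \<and> (\<forall>l z t. c l (upd z i t) = c l z) \<and>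
        (\<forall>\<^sub>F z in nhds y. g z = f z * q z + (\<Sum>l<d. c l z * (z $ i - y $ i) ^ l))"
      using qc hol_atI[OF open_pdisc y] by blast
  next
    fix q c assume q: "hol_at y q" and c: "\<And>l z t. c l (upd z i t) = c l z"
      and ev: "\<forall>\<^sub>F z in nhds y. f z * q z + (\<Sum>l<d. c l z * (z $ i - y $ i) ^ l) = (0::complex)"
    \<comment> \<open>The halving argument works with a bounded quotient; once the unit is moved
      over, this quotient is \<open>u * q\<close>.\<close>
    from hol_at_bounded_nhd[OF hol_at_mult[OF hau q]] obtain W1 N where
      W1: "open W1" "y \<in> W1" "holomorphic_map W1 (\<lambda>z. u z * q z)" "\<And>z. z \<in> W1 \<Longrightarrow> cmod (u z * q z) \<le> N" by blast
    obtain W2 where W2: "open W2" "y \<in> W2"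
      "\<And>z. z \<in> W2 \<Longrightarrow> f z * q z + (\<Sum>l<d. c l z * (z $ i - y $ i) ^ l) = 0"
      using ev unfolding eventually_nhds by blast
    have W: "open (W1 \<inter> W2)" "y \<in> W1 \<inter> W2" using W1 W2 by auto
    obtain \<rho> \<delta> \<epsilon> where D: "\<rho> > 0" "\<delta> > 0" "pdisc y i \<rho> \<delta> \<subseteq> W1 \<inter> W2" "holomorphic_map (pdisc y i \<rho> \<delta>) e"
      "holomorphic_map (pdisc y i \<rho> \<delta>) u" "\<forall>z\<in>pdisc y i \<rho> \<delta>. cmod (e z) \<le> \<epsilon>"
      "real (Suc d) / \<rho> ^ d * \<epsilon> \<le> 1 / 2"
      "\<forall>z\<in>pdisc y i \<rho> \<delta>. u z \<noteq> 0 \<and> f z = u z * ((z $ i - p) ^ d + e z)"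
      using key[OF W] by (elim exE conjE) (rule that)
    have D8: "u z \<noteq> 0" "f z = u z * ((z $ i - p) ^ d + e z)" if "z \<in> pdisc y i \<rho> \<delta>" for z
      using D(8) that by auto
    let ?D = "pdisc y i \<rho> \<delta>"
    have "u z * q z = 0" if "z \<in> ?D" for z
    proof (rule perturbed_division_unique[OF D(1,2,4) bspec[OF D(6)] D(7) _ _ c _ that, where B = N])
      show "holomorphic_map ?D (\<lambda>z. u z * q z)" using W1 D(3) holomorphic_map_subset by blast
      show "cmod (u z * q z) \<le> N" if "z \<in> ?D" for z using W1 D(3) that by blast
      show "((z $ i - y $ i) ^ d + e z) * (u z * q z) + (\<Sum>l<d. c l z * (z $ i - y $ i) ^ l) = 0"
        if z: "z \<in> ?D" for z
      proof -
        have "((z $ i - y $ i) ^ d + e z) * (u z * q z) = f z * q z"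
          unfolding D8(2)[OF z] by (simp add: p_def)
        moreover have "z \<in> W2" using z D(3) by blast
        ultimately show ?thesis using W2(3) by (simp only:)
      qed
    qed
    then have "q z = 0" if "z \<in> ?D" for z
      using that D8(1)[of z] by (metis mult_eq_0_iff)
    then show "\<forall>\<^sub>F z in nhds y. q z = 0"
      using pdisc_center[OF D(1,2)] open_pdisc
      unfolding eventually_nhds by (intro exI[of _ ?D] conjI ballI)
  qed
qed

section \<open>Weierstrass polynomials\<close>

text \<open>Stated by coefficients because \<open>degree 0 = 0\<close>: the zero polynomial must
  satisfy the bound 0 as well, since it is the remainder when the Weierstrass degree is 0.\<close>

definition deg_lt :: "nat \<Rightarrow> complex poly \<Rightarrow> bool" where
  "deg_lt m P \<longleftrightarrow> (\<forall>l\<ge>m. coeff P l = 0)"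

lemma deg_lt_degree: "deg_lt m P \<longleftrightarrow> P = 0 \<or> degree P < m"
proof
  assume "deg_lt m P"
  then show "P = 0 \<or> degree P < m" unfolding deg_lt_def by (metis leading_coeff_0_iff not_less)
next
  assume "P = 0 \<or> degree P < m"
  then show "deg_lt m P" unfolding deg_lt_def by (auto simp: coeff_eq_0)
qed

lemma deg_lt_poly: "deg_lt m P \<Longrightarrow> poly P x = (\<Sum>l<m. coeff P l * x ^ l)"
  unfolding deg_lt_degree
  by (cases "P = 0") (auto simp: poly_altdef coeff_eq_0 intro!: sum.mono_neutral_left intro: le_degree)

lemma deg_lt_mult: "deg_lt m P \<Longrightarrow> deg_lt n Q \<Longrightarrow> deg_lt (m + n - 1) (P * Q)"
  unfolding deg_lt_degree by (cases "P = 0 \<or> Q = 0") (auto simp: degree_mult_eq)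

lemma deg_lt_pcompose_linear: "deg_lt m P \<Longrightarrow> deg_lt m (pcompose P [:a, 1:])"
  unfolding deg_lt_degree by (auto simp: degree_pcompose)

text \<open>A polynomial in the variable \<open>z $ i\<close> over the germs in the other variables:
  invariance under \<open>upd\<close> says that the coefficients ignore \<open>z $ i\<close>. As a
  function it is \<open>poly (R z) (z $ i)\<close>.\<close>

definition hol_poly :: "complex^'n \<Rightarrow> 'n \<Rightarrow> nat \<Rightarrow> (complex^'n \<Rightarrow> complex poly) \<Rightarrow> bool" where
  "hol_poly y i m R \<longleftrightarrow> (\<forall>l. hol_at y (\<lambda>z. coeff (R z) l)) \<and> (\<forall>z t. R (upd z i t) = R z) \<and> (\<forall>z. deg_lt m (R z))"

lemma hol_polyD:
  assumes "hol_poly y i m R"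
  shows "hol_at y (\<lambda>z. coeff (R z) l)" "R (upd z i t) = R z" "deg_lt m (R z)"
  using assms by (auto simp: hol_poly_def)

text \<open>The degree bound leaves finitely many coefficients to control, so finitely many
  neighbourhoods are intersected.\<close>

lemma hol_poly_nhds:
  assumes "hol_poly x i m R"
  shows "\<forall>\<^sub>F y in nhds x. hol_poly y i m R"
proof -
  have "\<forall>\<^sub>F y in nhds x. \<forall>l\<in>{..<m}. hol_at y (\<lambda>z. coeff (R z) l)"
    by (rule eventually_ball_finite) (use hol_at_nhds hol_polyD(1)[OF assms] in auto)
  then show ?thesis
  proof eventually_elim
    case (elim y)
    have "hol_at y (\<lambda>z. coeff (R z) l)" for l
    proof (cases "l < m")
      case False
      then have "(\<lambda>z. coeff (R z) l) = (\<lambda>z. 0)"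
        using hol_polyD(3)[OF assms] by (auto simp: deg_lt_def)
      then show ?thesis by simp
    qed (use elim in auto)
    then show ?case using assms by (auto simp: hol_poly_def)
  qed
qed

lemma hol_poly_value: "hol_poly y i m R \<Longrightarrow> hol_at y (\<lambda>z. poly (R z) (z $ i))"
  by (subst deg_lt_poly[OF hol_polyD(3)]) (auto intro!: hol_at_intros hol_polyD)

lemma hol_poly_mono: "hol_poly y i m R \<Longrightarrow> m \<le> n \<Longrightarrow> hol_poly y i n R"
  by (auto simp: hol_poly_def deg_lt_def)

lemma hol_poly_add: "hol_poly y i m R \<Longrightarrow> hol_poly y i m S \<Longrightarrow> hol_poly y i m (\<lambda>z. R z + S z)"
  by (auto simp: hol_poly_def deg_lt_def intro!: hol_at_add)

lemma hol_poly_uminus: "hol_poly y i m R \<Longrightarrow> hol_poly y i m (\<lambda>z. - R z)"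
  by (auto simp: hol_poly_def deg_lt_def intro!: hol_at_uminus)

lemma hol_poly_diff: "hol_poly y i m R \<Longrightarrow> hol_poly y i m S \<Longrightarrow> hol_poly y i m (\<lambda>z. R z - S z)"
  by (auto simp: hol_poly_def deg_lt_def intro!: hol_at_diff)

lemma hol_poly_sum: "(\<And>a. a \<in> A \<Longrightarrow> hol_poly y i m (R a)) \<Longrightarrow> hol_poly y i m (\<lambda>z. \<Sum>a\<in>A. R a z)"
  by (auto simp: hol_poly_def deg_lt_def coeff_sum intro!: hol_at_sum)

lemma hol_poly_mult:
  assumes "hol_poly y i m R" "hol_poly y i n S"
  shows "hol_poly y i (m + n - 1) (\<lambda>z. R z * S z)"
  unfolding hol_poly_def
proof (intro conjI allI deg_lt_mult hol_polyD(3)[OF assms(1)] hol_polyD(3)[OF assms(2)])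
  show "hol_at y (\<lambda>z. coeff (R z * S z) l)" for l
    unfolding coeff_mult by (intro hol_at_sum hol_at_mult hol_polyD(1)[OF assms(1)] hol_polyD(1)[OF assms(2)])
qed (simp add: hol_polyD(2)[OF assms(1)] hol_polyD(2)[OF assms(2)])

lemma hol_poly_monom: "hol_at y c \<Longrightarrow> (\<And>z t. c (upd z i t) = c z) \<Longrightarrow> hol_poly y i (Suc k) (\<lambda>z. monom (c z) k)"
  unfolding hol_poly_def
proof (intro conjI allI)
  show "hol_at y (\<lambda>z. coeff (monom (c z) k) l)" if "hol_at y c" for l
    using that by (cases "k = l") auto
qed (auto simp: deg_lt_def)

lemma hol_poly_const: "deg_lt m P \<Longrightarrow> hol_poly y i m (\<lambda>z. P)"
  by (auto simp: hol_poly_def)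

lemma deg_lt_linear_power: "deg_lt (Suc d) ([:a, 1:] ^ d)" "coeff ([:a, 1:] ^ d) d = 1"
proof -
  have "degree ([:a, 1:] ^ d) = d" by (simp add: degree_power_eq)
  moreover have "lead_coeff ([:a, 1:] ^ d) = 1" by (simp add: lead_coeff_power)
  ultimately show "deg_lt (Suc d) ([:a, 1:] ^ d)" "coeff ([:a, 1:] ^ d) d = 1"
    by (simp_all add: deg_lt_degree)
qed

text \<open>Ordinary long division: with leading coefficient 1 nothing is inverted, so the
  coefficients stay holomorphic and independent of \<open>z $ i\<close>.\<close>

lemma hol_poly_monic_division:
  assumes p: "hol_poly y i (Suc n) p" "\<And>z. coeff (p z) n = 1" and P: "hol_poly y i m P"
  shows "\<exists>S M. hol_poly y i (m - n) S \<and> hol_poly y i n M \<and> (\<forall>z. P z = p z * S z + M z)"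
  using P
proof (induction m arbitrary: P)
  case 0
  show ?case
    by (intro exI[of _ "\<lambda>z. 0"] exI[of _ P] conjI hol_poly_const hol_poly_mono[OF "0.prems"]) (auto simp: deg_lt_def)
next
  case (Suc m)
  show ?case
  proof (cases "n \<le> m")
    case False
    then show ?thesis
      by (intro exI[of _ "\<lambda>z. 0"] exI[of _ P] conjI hol_poly_const hol_poly_mono[OF Suc.prems]) (auto simp: deg_lt_def)
  next
    case True
    define c where "c z = coeff (P z) m" for z
    define T where "T z = monom (c z) (m - n)" for z
    have T: "hol_poly y i (Suc (m - n)) T"
      unfolding T_def using hol_polyD[OF Suc.prems] by (intro hol_poly_monom) (auto simp: c_def)
    define P' where "P' z = P z - p z * T z" for z
    have Tp: "hol_poly y i (Suc m) (\<lambda>z. p z * T z)"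
      using hol_poly_mult[OF p(1) T] True by (simp add: algebra_simps)
    have "hol_poly y i (Suc m) P'"
      unfolding P'_def by (intro hol_poly_diff Suc.prems Tp)
    moreover have "coeff (P' z) m = 0" for z
    proof -
      have "coeff (p z * T z) m = c z"
        using True p(2)[of z] by (simp add: T_def mult.commute[of "p z"] coeff_monom_mult)
      then show ?thesis by (simp add: P'_def c_def)
    qed
    ultimately have "hol_poly y i m P'"
      unfolding hol_poly_def deg_lt_def by (metis le_antisym not_less_eq_eq)
    from Suc.IH[OF this] obtain S M where SM: "hol_poly y i (m - n) S" "hol_poly y i n M"
      "\<And>z. P' z = p z * S z + M z" by blast
    have "hol_poly y i (Suc m - n) (\<lambda>z. S z + T z)"
      using True hol_poly_mono[OF SM(1), of "Suc m - n"] T by (intro hol_poly_add) (auto simp: Suc_diff_le)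
    moreover have "P z = p z * (S z + T z) + M z" for z
      using SM(3)[of z] by (simp add: P'_def algebra_simps)
    ultimately show ?thesis using SM(2) by blast
  qed
qed

text \<open>With the other coordinates fixed, \<open>P z\<close> is a single polynomial that
  vanishes on a whole disc of values of \<open>z $ i\<close>. This turns identities of functions
  into identities of coefficients.\<close>

lemma hol_poly_eventually_zero:
  assumes P: "\<And>z t. P (upd z i t) = P z" and ev: "\<forall>\<^sub>F z in nhds y. poly (P z) (z $ i) = (0::complex)"
  shows "\<forall>\<^sub>F z in nhds y. P z = 0"
proof -
  obtain W where W: "open W" "y \<in> W" "\<And>z. z \<in> W \<Longrightarrow> poly (P z) (z $ i) = 0"
    using ev unfolding eventually_nhds by blast
  obtain r where r: "r > 0" "pdisc y i r r \<subseteq> W" using pdisc_subset_open[OF W(1,2)] by (metis order_refl)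
  have "P z = 0" if z: "z \<in> pdisc y i r r" for z
  proof (rule ccontr)
    assume "P z \<noteq> 0"
    then have "finite {x. poly (P z) x = 0}" by (rule poly_roots_finite)
    moreover have "ball (y $ i) r \<subseteq> {x. poly (P z) x = 0}"
    proof
      fix x assume "x \<in> ball (y $ i) r"
      then have "upd z i x \<in> W"
        using upd_in_pdisc[OF z, of x] r(2) by (auto simp: dist_norm norm_minus_commute)
      from W(3)[OF this] show "x \<in> {x. poly (P z) x = 0}" by (simp add: P)
    qed
    ultimately have "finite (ball (y $ i) r)" using finite_subset by blast
    then show False
      using uncountable_ball[OF r(1)] countable_finite by blast
  qed
  then show ?thesis using pdisc_center[OF r(1) r(1)] open_pdisc
    unfolding eventually_nhds by (intro exI[of _ "pdisc y i r r"] conjI ballI)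
qed

text \<open>Remainders become polynomials in \<open>z $ i\<close> instead of
  \<open>z $ i - y $ i\<close>: the same polynomials are divided at different points
  \<open>y\<close>, so the centre has to disappear.\<close>

theorem weierstrass_division_poly:
  fixes f :: "complex^'n \<Rightarrow> complex"
  assumes f: "hol_at y f" and nz: "\<not> (\<forall>\<^sub>F t in nhds 0. f (upd y i (y $ i + t)) = 0)"
  obtains d u where "hol_at y u" "u y \<noteq> 0"
    "\<forall>\<^sub>F t in nhds 0. f (upd y i (y $ i + t)) = t ^ d * u (upd y i (y $ i + t))"
    "\<And>g. hol_at y g \<Longrightarrow> \<exists>q R. hol_at y q \<and> hol_poly y i d R \<and>
        (\<forall>\<^sub>F z in nhds y. g z = f z * q z + poly (R z) (z $ i))"
    "\<And>q R. hol_at y q \<Longrightarrow> hol_poly y i d R \<Longrightarrow>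
        \<forall>\<^sub>F z in nhds y. f z * q z + poly (R z) (z $ i) = 0 \<Longrightarrow> \<forall>\<^sub>F z in nhds y. q z = 0"
proof (rule weierstrass_division[OF f nz])
  fix d u
  assume u: "hol_at y u" "u y \<noteq> 0"
    "\<forall>\<^sub>F t in nhds 0. f (upd y i (y $ i + t)) = t ^ d * u (upd y i (y $ i + t))"
  assume E: "\<And>g. hol_at y g \<Longrightarrow> \<exists>q c. hol_at y q \<and> (\<forall>l. hol_at y (c l)) \<and> (\<forall>l z t. c l (upd z i t) = c l z) \<and>
        (\<forall>\<^sub>F z in nhds y. g z = f z * q z + (\<Sum>l<d. c l z * (z $ i - y $ i) ^ l))"
  assume U: "\<And>q c. hol_at y q \<Longrightarrow> (\<And>l z t. c l (upd z i t) = c l z) \<Longrightarrow>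
        \<forall>\<^sub>F z in nhds y. f z * q z + (\<Sum>l<d. c l z * (z $ i - y $ i) ^ l) = (0::complex) \<Longrightarrow>
        \<forall>\<^sub>F z in nhds y. q z = 0"
  show thesis
  proof (rule that[OF u])
    fix g :: "complex^'n \<Rightarrow> complex" assume "hol_at y g"
    from E[OF this] obtain q c where qc: "hol_at y q" "\<And>l. hol_at y (c l)" "\<And>l z t. c l (upd z i t) = c l z"
      "\<forall>\<^sub>F z in nhds y. g z = f z * q z + (\<Sum>l<d. c l z * (z $ i - y $ i) ^ l)" by blast
    define R where "R z = (\<Sum>l<d. monom (c l z) 0 * [:- (y $ i), 1:] ^ l)" for z
    have "hol_poly y i d R"
      unfolding R_def
    proof (rule hol_poly_sum)
      fix l assume "l \<in> {..<d}"
      have "hol_poly y i (Suc 0 + Suc l - 1) (\<lambda>z. monom (c l z) 0 * [:- (y $ i), 1:] ^ l)"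
        by (intro hol_poly_mult hol_poly_monom hol_poly_const deg_lt_linear_power qc)
      then show "hol_poly y i d (\<lambda>z. monom (c l z) 0 * [:- (y $ i), 1:] ^ l)"
        by (rule hol_poly_mono) (use \<open>l \<in> {..<d}\<close> in auto)
    qed
    moreover have "poly (R z) (z $ i) = (\<Sum>l<d. c l z * (z $ i - y $ i) ^ l)" for z
      by (simp add: R_def poly_sum poly_monom poly_power algebra_simps)
    ultimately show "\<exists>q R. hol_at y q \<and> hol_poly y i d R \<and> (\<forall>\<^sub>F z in nhds y. g z = f z * q z + poly (R z) (z $ i))"
      using qc(1,4) by (intro exI[of _ q] exI[of _ R]) simp
  next
    fix q R assume q: "hol_at y q" and R: "hol_poly y i d R"
      and ev: "\<forall>\<^sub>F z in nhds y. f z * q z + poly (R z) (z $ i) = 0"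
    have eq: "poly (R z) (z $ i) = (\<Sum>l<d. coeff (pcompose (R z) [:y $ i, 1:]) l * (z $ i - y $ i) ^ l)" for z
    proof -
      have "poly (R z) (z $ i) = poly (pcompose (R z) [:y $ i, 1:]) (z $ i - y $ i)"
        by (simp add: poly_pcompose)
      then show ?thesis
        using deg_lt_poly[OF deg_lt_pcompose_linear[OF hol_polyD(3)[OF R]]] by simp
    qed
    show "\<forall>\<^sub>F z in nhds y. q z = 0"
      by (rule U[OF q _ ev[unfolded eq]]) (simp add: hol_polyD(2)[OF R])
  qed
qed

text \<open>Oka's reduction at a point \<open>y\<close>. The polynomial \<open>F\<close> splits near \<open>y\<close> as \<open>p Q\<close> with \<open>p\<close> the
  Weierstrass polynomial of \<open>F\<close> at \<open>y\<close> and \<open>Q\<close> a unit (with inverse \<open>t\<close>): modulo Koszul relations the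
  coefficients of a relation can be reduced modulo \<open>p\<close>, and multiplying by \<open>Q\<close> then turns all of them
  into polynomials of degree less than \<open>deg F\<close>, a bound independent of \<open>y\<close>.\<close>

lemma oka_reduction:
  fixes F :: "complex^'n \<Rightarrow> complex poly" and G :: "'a \<Rightarrow> complex^'n \<Rightarrow> complex poly"
  assumes F: "hol_poly y i (Suc d) F" "\<And>z. coeff (F z) d = 1"
    and A: "finite A" and G: "\<And>\<alpha>. \<alpha> \<in> A \<Longrightarrow> hol_poly y i d (G \<alpha>)"
    and a: "\<And>\<alpha>. \<alpha> \<in> A \<Longrightarrow> hol_at y (a \<alpha>)" and b: "hol_at y b"
    and rel: "\<forall>\<^sub>F z in nhds y. (\<Sum>\<alpha>\<in>A. a \<alpha> z * poly (G \<alpha> z) (z $ i)) + b z * poly (F z) (z $ i) = 0"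
  obtains s t P S where "\<And>\<alpha>. \<alpha> \<in> A \<Longrightarrow> hol_at y (s \<alpha>)" "hol_at y t"
    "\<And>\<alpha>. \<alpha> \<in> A \<Longrightarrow> hol_poly y i d (P \<alpha>)" "hol_poly y i d S"
    "\<forall>\<^sub>F z in nhds y. (\<Sum>\<alpha>\<in>A. P \<alpha> z * G \<alpha> z) + S z * F z = 0"
    "\<And>\<alpha>. \<alpha> \<in> A \<Longrightarrow> \<forall>\<^sub>F z in nhds y. a \<alpha> z = s \<alpha> z * poly (F z) (z $ i) + t z * poly (P \<alpha> z) (z $ i)"
    "\<forall>\<^sub>F z in nhds y. b z = - (\<Sum>\<alpha>\<in>A. s \<alpha> z * poly (G \<alpha> z) (z $ i)) + t z * poly (S z) (z $ i)"
proof -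
  let ?v = "\<lambda>P z. poly (P z) (z $ i)"
  define f where "f = ?v F"
  have hf: "hol_at y f" unfolding f_def by (rule hol_poly_value[OF F(1)])
  have nz: "\<not> (\<forall>\<^sub>F t in nhds 0. f (upd y i (y $ i + t)) = 0)"
  proof
    assume "\<forall>\<^sub>F t in nhds 0. f (upd y i (y $ i + t)) = 0"
    then obtain r where r: "r > 0" "\<And>t. cmod t < r \<Longrightarrow> poly (F y) (y $ i + t) = 0"
      by (auto simp: eventually_nhds_metric dist_norm f_def hol_polyD(2)[OF F(1)])
    have "F y \<noteq> 0" using F(2)[of y] by auto
    then have "finite {x. poly (F y) x = 0}" by (rule poly_roots_finite)
    moreover have "ball (y $ i) r \<subseteq> {x. poly (F y) x = 0}"
    proof
      fix x assume "x \<in> ball (y $ i) r"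
      then show "x \<in> {x. poly (F y) x = 0}" using r(2)[of "x - y $ i"] by (simp add: dist_norm norm_minus_commute)
    qed
    ultimately have "finite (ball (y $ i) r)" using finite_subset by blast
    then show False using uncountable_ball[OF r(1)] countable_finite by blast
  qed
  show thesis
  proof (rule weierstrass_division_poly[OF hf nz])
    fix e u
    assume E: "\<And>g. hol_at y g \<Longrightarrow> \<exists>q R. hol_at y q \<and> hol_poly y i e R \<and>
          (\<forall>\<^sub>F z in nhds y. g z = f z * q z + ?v R z)"
      and U: "\<And>q R. hol_at y q \<Longrightarrow> hol_poly y i e R \<Longrightarrow>
          \<forall>\<^sub>F z in nhds y. f z * q z + ?v R z = 0 \<Longrightarrow> \<forall>\<^sub>F z in nhds y. q z = 0"
    \<comment> \<open>If \<open>e > d\<close>, then \<open>- F\<close> would be an admissible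
      remainder for the quotient 1, against uniqueness. So the local degree never exceeds
      \<open>d\<close>.\<close>
    have ed: "e \<le> d"
    proof (rule ccontr)
      assume "\<not> e \<le> d"
      then have "hol_poly y i e (\<lambda>z. - F z)" using hol_poly_uminus[OF hol_poly_mono[OF F(1)]] by simp
      from U[OF hol_at_const this, of 1] have "\<forall>\<^sub>F z in nhds y. (1::complex) = 0" by (simp add: f_def)
      then show False by simp
    qed
    \<comment> \<open>Dividing the monomial by \<open>f\<close> produces the Weierstrass polynomial:
      monomial minus remainder is \<open>f * t\<close>.\<close>
    have "hol_at y (\<lambda>z. (z $ i - y $ i) ^ e)" by (intro hol_at_intros)
    from E[OF this] obtain t R where t: "hol_at y t" and R: "hol_poly y i e R"
      and tR: "\<forall>\<^sub>F z in nhds y. (z $ i - y $ i) ^ e = f z * t z + ?v R z" by blast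
    define p where "p z = [:- (y $ i), 1:] ^ e - R z" for z
    have p: "hol_poly y i (Suc e) p"
      unfolding p_def by (intro hol_poly_diff hol_poly_const deg_lt_linear_power hol_poly_mono[OF R]) simp
    have p1: "coeff (p z) e = 1" for z
      using hol_polyD(3)[OF R, of z] by (simp add: p_def deg_lt_linear_power deg_lt_def)
    have pv: "\<forall>\<^sub>F z in nhds y. ?v p z = f z * t z"
      using tR by eventually_elim (simp add: p_def poly_power algebra_simps)
    obtain Q M where Q: "hol_poly y i (Suc d - e) Q" and M: "hol_poly y i e M"
      and QM: "\<And>z. F z = p z * Q z + M z"
      using hol_poly_monic_division[OF p p1 F(1)] by blast
    have fv: "f z = ?v p z * ?v Q z + ?v M z" for z by (simp add: f_def QM)
    \<comment> \<open>As \<open>p\<close> takes the values \<open>f * t\<close>, the splitting of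
      \<open>F\<close> reads \<open>f * (1 - t * Q) - M = 0\<close>, a division of 0 by
      \<open>f\<close>; uniqueness gives \<open>t * Q = 1\<close>, and then \<open>M\<close> has
      value 0.\<close>
    have "\<forall>\<^sub>F z in nhds y. 1 - t z * ?v Q z = 0"
    proof (rule U)
      show "hol_at y (\<lambda>z. 1 - t z * ?v Q z)" by (intro hol_at_intros t hol_poly_value[OF Q])
      show "hol_poly y i e (\<lambda>z. - M z)" by (rule hol_poly_uminus[OF M])
      show "\<forall>\<^sub>F z in nhds y. f z * (1 - t z * ?v Q z) + ?v (\<lambda>z. - M z) z = 0"
        using pv
      proof eventually_elim
        case (elim z)
        have "f z * (1 - t z * ?v Q z) = f z - ?v p z * ?v Q z" by (simp add: elim algebra_simps)
        then show ?case using fv[of z] by simp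
      qed
    qed
    then have tQ: "\<forall>\<^sub>F z in nhds y. t z * ?v Q z = 1" by eventually_elim simp
    have M0: "\<forall>\<^sub>F z in nhds y. ?v M z = 0"
      using tQ pv
    proof eventually_elim
      case (elim z)
      have "f z = f z * (t z * ?v Q z) + ?v M z" using fv[of z] elim(2) by (simp add: mult.assoc)
      then show ?case using elim(1) by simp
    qed
    have "\<forall>\<alpha>\<in>A. \<exists>q R. hol_at y q \<and> hol_poly y i e R \<and> (\<forall>\<^sub>F z in nhds y. a \<alpha> z = f z * q z + ?v R z)"
      using E[OF a] by blast
    from bchoice[OF this] obtain s where
      "\<forall>\<alpha>\<in>A. \<exists>R. hol_at y (s \<alpha>) \<and> hol_poly y i e R \<and> (\<forall>\<^sub>F z in nhds y. a \<alpha> z = f z * s \<alpha> z + ?v R z)" ..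
    from bchoice[OF this] obtain r where
      "\<forall>\<alpha>\<in>A. hol_at y (s \<alpha>) \<and> hol_poly y i e (r \<alpha>) \<and> (\<forall>\<^sub>F z in nhds y. a \<alpha> z = f z * s \<alpha> z + ?v (r \<alpha>) z)" ..
    then have s: "\<And>\<alpha>. \<alpha> \<in> A \<Longrightarrow> hol_at y (s \<alpha>)" and r: "\<And>\<alpha>. \<alpha> \<in> A \<Longrightarrow> hol_poly y i e (r \<alpha>)"
      and sr: "\<And>\<alpha>. \<alpha> \<in> A \<Longrightarrow> \<forall>\<^sub>F z in nhds y. a \<alpha> z = f z * s \<alpha> z + ?v (r \<alpha>) z" by auto
    \<comment> \<open>Subtracting \<open>s \<alpha>\<close> times the Koszul relation of
      \<open>F\<close> and \<open>G \<alpha>\<close> for every \<alpha> leaves the coefficients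
      \<open>r \<alpha>\<close> and, at \<open>F\<close>, this \<open>c\<close>.\<close>
    define c where "c z = b z + (\<Sum>\<alpha>\<in>A. s \<alpha> z * ?v (G \<alpha>) z)" for z
    have hc: "hol_at y c" unfolding c_def by (intro hol_at_intros b s hol_poly_value[OF G])
    define H where "H z = - (\<Sum>\<alpha>\<in>A. r \<alpha> z * G \<alpha> z)" for z
    have H: "hol_poly y i (e + d - 1) H"
      unfolding H_def by (intro hol_poly_uminus hol_poly_sum hol_poly_mult r G)
    have srA: "\<forall>\<^sub>F z in nhds y. \<forall>\<alpha>\<in>A. a \<alpha> z = f z * s \<alpha> z + ?v (r \<alpha>) z"
      by (rule eventually_ball_finite[OF A]) (use sr in blast)
    have cf: "\<forall>\<^sub>F z in nhds y. c z * f z = ?v H z"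
      using srA rel
    proof eventually_elim
      case (elim z)
      have "0 = (\<Sum>\<alpha>\<in>A. (f z * s \<alpha> z + ?v (r \<alpha>) z) * ?v (G \<alpha>) z) + b z * f z"
        using elim by (simp add: f_def)
      also have "\<dots> = c z * f z - ?v H z"
        by (simp add: c_def H_def poly_sum sum.distrib algebra_simps sum_distrib_left)
      finally show ?case by simp
    qed
    \<comment> \<open>\<open>c * f\<close> has the values of the polynomial \<open>H\<close>;
      division by \<open>p\<close> and uniqueness once more give \<open>c = t * S\<close>. The
      degree of \<open>S\<close> is below \<open>d\<close> because the bound for \<open>H\<close>
      exceeds \<open>e\<close> by at most \<open>d\<close>.\<close>
    obtain S N where S: "hol_poly y i (e + d - 1 - e) S" and N: "hol_poly y i e N" and SN: "\<And>z. H z = p z * S z + N z"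
      using hol_poly_monic_division[OF p p1 H] by blast
    have S': "hol_poly y i d S" by (rule hol_poly_mono[OF S]) simp
    have "\<forall>\<^sub>F z in nhds y. c z - t z * ?v S z = 0"
    proof (rule U)
      show "hol_at y (\<lambda>z. c z - t z * ?v S z)" by (intro hol_at_intros t hc hol_poly_value[OF S'])
      show "hol_poly y i e (\<lambda>z. - N z)" by (rule hol_poly_uminus[OF N])
      show "\<forall>\<^sub>F z in nhds y. f z * (c z - t z * ?v S z) + ?v (\<lambda>z. - N z) z = 0"
        using pv cf by eventually_elim (simp add: SN algebra_simps)
    qed
    then have ctS: "\<forall>\<^sub>F z in nhds y. c z = t z * ?v S z" by eventually_elim simp
    have N0: "\<forall>\<^sub>F z in nhds y. ?v N z = 0"
      using ctS cf pv by eventually_elim (simp add: SN algebra_simps)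
    \<comment> \<open>\<open>t * Q = 1\<close> gives \<open>r \<alpha> = t * P \<alpha>\<close> for
      the values; the factor \<open>Q\<close> raises the degree bound from \<open>e\<close> to
      \<open>(Suc d - e) + e - 1 = d\<close>.\<close>
    define P where "P \<alpha> z = Q z * r \<alpha> z" for \<alpha> z
    have P: "hol_poly y i d (P \<alpha>)" if "\<alpha> \<in> A" for \<alpha>
      using hol_poly_mult[OF Q r[OF that]] ed by (simp add: P_def[abs_def])
    \<comment> \<open>The combination equals \<open>S * M - Q * N\<close>, whose value vanishes near
      \<open>y\<close>. It is then lifted to an identity of polynomials, because the later linear
      equations concern coefficients.\<close>
    have relv: "\<forall>\<^sub>F z in nhds y. poly ((\<Sum>\<alpha>\<in>A. P \<alpha> z * G \<alpha> z) + S z * F z) (z $ i) = 0"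
      using M0 N0
    proof eventually_elim
      case (elim z)
      have "(\<Sum>\<alpha>\<in>A. P \<alpha> z * G \<alpha> z) = - (Q z * H z)"
        by (simp add: P_def H_def sum_distrib_left mult.assoc)
      then have "(\<Sum>\<alpha>\<in>A. P \<alpha> z * G \<alpha> z) + S z * F z = S z * M z - Q z * N z"
        by (simp add: SN QM algebra_simps)
      then show ?case using elim by simp
    qed
    show thesis
    proof (rule that[OF s t P S'])
      show "\<forall>\<^sub>F z in nhds y. (\<Sum>\<alpha>\<in>A. P \<alpha> z * G \<alpha> z) + S z * F z = 0"
      proof (rule hol_poly_eventually_zero[OF _ relv])
        show "(\<Sum>\<alpha>\<in>A. P \<alpha> (upd z i t) * G \<alpha> (upd z i t)) + S (upd z i t) * F (upd z i t) =
          (\<Sum>\<alpha>\<in>A. P \<alpha> z * G \<alpha> z) + S z * F z" for z t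
          using hol_polyD(2)[OF P] hol_polyD(2)[OF G] hol_polyD(2)[OF S'] hol_polyD(2)[OF F(1)]
          by (simp cong: sum.cong)
      qed
      show "\<forall>\<^sub>F z in nhds y. a \<alpha> z = s \<alpha> z * ?v F z + t z * ?v (P \<alpha>) z" if "\<alpha> \<in> A" for \<alpha>
        using sr[OF that] tQ
      proof eventually_elim
        case (elim z)
        have "t z * ?v (P \<alpha>) z = (t z * ?v Q z) * ?v (r \<alpha>) z" by (simp add: P_def)
        then show ?case using elim by (simp add: f_def)
      qed
      show "\<forall>\<^sub>F z in nhds y. b z = - (\<Sum>\<alpha>\<in>A. s \<alpha> z * ?v (G \<alpha>) z) + t z * ?v S z"
        using ctS by eventually_elim (simp add: c_def algebra_simps)
    qed
  qed
qed

section \<open>Finitely generated relations\<close>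

text \<open>The type fixes the dimension, so the variables in use are recorded by \<open>I\<close>;
  the dependence is demanded of the total function, not only of its germ.\<close>

definition depends_on :: "'n set \<Rightarrow> (complex^'n \<Rightarrow> 'b) \<Rightarrow> bool" where
  "depends_on I f \<longleftrightarrow> (\<forall>z w. (\<forall>i\<in>I. z $ i = w $ i) \<longrightarrow> f z = f w)"

lemma depends_onD: "depends_on I f \<Longrightarrow> (\<And>i. i \<in> I \<Longrightarrow> z $ i = w $ i) \<Longrightarrow> f z = f w"
  by (auto simp: depends_on_def)

lemma depends_on_const [simp]: "depends_on I (\<lambda>z. c)"
  by (auto simp: depends_on_def)

lemma depends_on_comp1: "depends_on I f \<Longrightarrow> depends_on I (\<lambda>z. h (f z))"
  unfolding depends_on_def by metis

lemma depends_on_comp2: "depends_on I f \<Longrightarrow> depends_on I g \<Longrightarrow> depends_on I (\<lambda>z. h (f z) (g z))"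
  unfolding depends_on_def by metis

lemma depends_on_mult: "depends_on I f \<Longrightarrow> depends_on I g \<Longrightarrow> depends_on I (\<lambda>z. f z * g z :: complex)"
  by (rule depends_on_comp2)

lemma depends_on_sum: "(\<And>a. a \<in> A \<Longrightarrow> depends_on I (f a)) \<Longrightarrow> depends_on I (\<lambda>z. \<Sum>a\<in>A. f a z)"
  unfolding depends_on_def by (intro allI impI sum.cong) auto

lemma depends_on_component: "i \<in> I \<Longrightarrow> depends_on I (\<lambda>z. z $ i)"
  by (auto simp: depends_on_def)

lemma depends_on_mono: "depends_on I f \<Longrightarrow> I \<subseteq> J \<Longrightarrow> depends_on J f"
  unfolding depends_on_def by blast

text \<open>The coefficients \<open>a\<close> may depend on all variables, even where the \<open>f r\<close> depend only on some of
  them; so the induction on the number of variables needs no change of the ring of coefficients.\<close>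

definition relation_at :: "'a set \<Rightarrow> 'r set \<Rightarrow> ('r \<Rightarrow> 'a \<Rightarrow> complex^'n \<Rightarrow> complex) \<Rightarrow> complex^'n
    \<Rightarrow> ('a \<Rightarrow> complex^'n \<Rightarrow> complex) \<Rightarrow> bool" where
  "relation_at A R f y a \<longleftrightarrow> (\<forall>\<alpha>\<in>A. hol_at y (a \<alpha>)) \<and>
     (\<forall>r\<in>R. \<forall>\<^sub>F z in nhds y. (\<Sum>\<alpha>\<in>A. a \<alpha> z * f r \<alpha> z) = 0)"

definition combination_at :: "'a set \<Rightarrow> 'j set \<Rightarrow> ('j \<Rightarrow> 'a \<Rightarrow> complex^'n \<Rightarrow> complex) \<Rightarrow> complex^'n
    \<Rightarrow> ('a \<Rightarrow> complex^'n \<Rightarrow> complex) \<Rightarrow> bool" where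
  "combination_at A J \<rho> y a \<longleftrightarrow> (\<exists>\<gamma>. (\<forall>j\<in>J. hol_at y (\<gamma> j)) \<and>
     (\<forall>\<alpha>\<in>A. \<forall>\<^sub>F z in nhds y. a \<alpha> z = (\<Sum>j\<in>J. \<gamma> j z * \<rho> j \<alpha> z)))"

text \<open>The last clause is the point: the finitely many germs \<rho> at \<open>x\<close>
  generate the relations at every \<open>y\<close> near \<open>x\<close>, though each relation may
  bring its own neighbourhood of \<open>y\<close>. This is finite type, expressed on stalks.\<close>

definition generators :: "'n set \<Rightarrow> complex^'n \<Rightarrow> 'a set \<Rightarrow> 'r set \<Rightarrow> ('r \<Rightarrow> 'a \<Rightarrow> complex^'n \<Rightarrow> complex)
    \<Rightarrow> 'j set \<Rightarrow> ('j \<Rightarrow> 'a \<Rightarrow> complex^'n \<Rightarrow> complex) \<Rightarrow> bool" where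
  "generators I x A R f J \<rho> \<longleftrightarrow> finite J \<and> (\<forall>j\<in>J. relation_at A R f x (\<rho> j)) \<and>
     (\<forall>j\<in>J. \<forall>\<alpha>\<in>A. depends_on I (\<rho> j \<alpha>)) \<and>
     (\<forall>\<^sub>F y in nhds x. \<forall>a. relation_at A R f y a \<longrightarrow> combination_at A J \<rho> y a)"

text \<open>A quantifier cannot range over index types, so \<open>J\<close> is a set of naturals;
  \<open>finite_relationsI\<close> renumbers any other index set.\<close>

definition finite_relations :: "'n set \<Rightarrow> complex^'n \<Rightarrow> 'a set \<Rightarrow> 'r set \<Rightarrow>
    ('r \<Rightarrow> 'a \<Rightarrow> complex^'n \<Rightarrow> complex) \<Rightarrow> bool" where
  "finite_relations I x A R f \<longleftrightarrow> (\<exists>(J :: nat set) \<rho>. generators I x A R f J \<rho>)"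

lemma finite_relationsI:
  fixes J :: "'j set"
  assumes "generators I x A R f J \<rho>"
  shows "finite_relations I x A R f"
proof -
  have J: "finite J" using assms by (simp add: generators_def)
  obtain h :: "nat \<Rightarrow> 'j" where h: "bij_betw h {..<card J} J"
    using bij_betw_from_nat_into_finite[OF J] by blast
  have "combination_at A {..<card J} (\<lambda>j. \<rho> (h j)) y a" if comb: "combination_at A J \<rho> y a" for y a
  proof -
    obtain \<gamma> where \<gamma>: "\<forall>j\<in>J. hol_at y (\<gamma> j)"
      "\<forall>\<alpha>\<in>A. \<forall>\<^sub>F z in nhds y. a \<alpha> z = (\<Sum>j\<in>J. \<gamma> j z * \<rho> j \<alpha> z)"
      using comb unfolding combination_at_def by blast
    show ?thesis
      unfolding combination_at_def
    proof (intro exI[of _ "\<lambda>j. \<gamma> (h j)"] conjI ballI)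
      show "hol_at y (\<gamma> (h j))" if "j \<in> {..<card J}" for j
        using \<gamma>(1) h that bij_betwE by blast
      show "\<forall>\<^sub>F z in nhds y. a \<alpha> z = (\<Sum>j<card J. \<gamma> (h j) z * \<rho> (h j) \<alpha> z)" if "\<alpha> \<in> A" for \<alpha>
        using bspec[OF \<gamma>(2) that] sum.reindex_bij_betw[OF h, of "\<lambda>j. \<gamma> j _ * \<rho> j \<alpha> _"] by simp
    qed
  qed
  then have "generators I x A R f {..<card J} (\<lambda>j. \<rho> (h j))"
    using assms h bij_betwE[OF h] unfolding generators_def
    by (auto elim!: eventually_mono)
  then show ?thesis unfolding finite_relations_def by blast
qed

lemma generatorsE:
  assumes "generators I x A R f J \<rho>"
  shows "finite J" "\<And>j. j \<in> J \<Longrightarrow> relation_at A R f x (\<rho> j)"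
    "\<And>j \<alpha>. j \<in> J \<Longrightarrow> \<alpha> \<in> A \<Longrightarrow> hol_at x (\<rho> j \<alpha>)"
    "\<And>j \<alpha>. j \<in> J \<Longrightarrow> \<alpha> \<in> A \<Longrightarrow> depends_on I (\<rho> j \<alpha>)"
    "\<forall>\<^sub>F y in nhds x. \<forall>a. relation_at A R f y a \<longrightarrow> combination_at A J \<rho> y a"
  using assms by (auto simp: generators_def relation_at_def)

lemma finite_relations_reindex:
  assumes h: "inj_on h A" and fr: "finite_relations I x (h ` A) (k ` R) f'"
    and f: "\<And>r \<alpha>. r \<in> R \<Longrightarrow> \<alpha> \<in> A \<Longrightarrow> f' (k r) (h \<alpha>) = f r \<alpha>"
  shows "finite_relations I x A R f"
proof -
  obtain J :: "nat set" and \<rho> where g: "generators I x (h ` A) (k ` R) f' J \<rho>"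
    using fr unfolding finite_relations_def by blast
  have rel: "relation_at A R f y (\<lambda>\<alpha>. a (h \<alpha>)) \<longleftrightarrow> relation_at (h ` A) (k ` R) f' y a" for y a
  proof -
    have "(\<Sum>\<beta>\<in>h ` A. a \<beta> z * f' (k r) \<beta> z) = (\<Sum>\<alpha>\<in>A. a (h \<alpha>) z * f r \<alpha> z)" if "r \<in> R" for r z
      using f that by (simp add: sum.reindex[OF h])
    then show ?thesis unfolding relation_at_def by simp
  qed
  have "generators I x A R f J (\<lambda>j \<alpha>. \<rho> j (h \<alpha>))"
    unfolding generators_def
  proof (intro conjI ballI)
    show "relation_at A R f x (\<lambda>\<alpha>. \<rho> j (h \<alpha>))" if "j \<in> J" for j
      using generatorsE(2)[OF g that] rel by simp
    show "depends_on I (\<rho> j (h \<alpha>))" if "j \<in> J" "\<alpha> \<in> A" for j \<alpha>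
      using generatorsE(4)[OF g] that by simp
    show "\<forall>\<^sub>F y in nhds x. \<forall>a. relation_at A R f y a \<longrightarrow> combination_at A J (\<lambda>j \<alpha>. \<rho> j (h \<alpha>)) y a"
      using generatorsE(5)[OF g]
    proof eventually_elim
      case (elim y)
      show ?case
      proof (intro allI impI)
        fix a assume a: "relation_at A R f y a"
        define b where "b \<beta> = a (inv_into A h \<beta>)" for \<beta>
        have b: "b (h \<alpha>) = a \<alpha>" if "\<alpha> \<in> A" for \<alpha> using that h by (simp add: b_def)
        have "relation_at A R f y (\<lambda>\<alpha>. b (h \<alpha>))"
          using a b unfolding relation_at_def by simp
        then have "combination_at (h ` A) J \<rho> y b" using rel elim by blast
        then show "combination_at A J (\<lambda>j \<alpha>. \<rho> j (h \<alpha>)) y a"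
          using b unfolding combination_at_def by simp
      qed
    qed
  qed (use generatorsE(1)[OF g] in simp)
  then show ?thesis unfolding finite_relations_def by blast
qed

lemma combination_at_unit_vectors:
  assumes "finite A" "\<And>\<alpha>. \<alpha> \<in> A \<Longrightarrow> hol_at y (a \<alpha>)"
  shows "combination_at A A (\<lambda>\<beta> \<alpha> z. if \<alpha> = \<beta> then 1 else 0) y a"
  unfolding combination_at_def
  by (intro exI[of _ a] conjI ballI always_eventually allI)
    (use assms in \<open>auto simp: if_distrib cong: if_cong\<close>)

lemma generators_no_equation:
  assumes "finite A"
    and "\<And>r \<alpha>. r \<in> R \<Longrightarrow> \<alpha> \<in> A \<Longrightarrow> \<forall>\<^sub>F z in nhds x. f r \<alpha> z = 0"
  shows "generators I x A R f A (\<lambda>\<beta> \<alpha> z. if \<alpha> = \<beta> then 1 else 0)"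
proof -
  have "\<forall>\<^sub>F z in nhds x. (\<Sum>\<alpha>\<in>A. (if \<alpha> = \<beta> then 1 else 0) * f r \<alpha> z) = 0"
    if "r \<in> R" "\<beta> \<in> A" for r \<beta>
    using assms(2)[OF that] by eventually_elim (use assms(1) in \<open>auto simp: if_distrib intro!: sum.neutral\<close>)
  then have "\<forall>\<beta>\<in>A. relation_at A R f x (\<lambda>\<alpha> z. if \<alpha> = \<beta> then 1 else 0)"
    unfolding relation_at_def by (auto simp: if_distrib[of "\<lambda>c. \<lambda>z. c"])
  moreover have "combination_at A A (\<lambda>\<beta> \<alpha> z. if \<alpha> = \<beta> then 1 else 0) y a" if "relation_at A R f y a" for y a
    by (rule combination_at_unit_vectors[OF assms(1)]) (use that in \<open>simp add: relation_at_def\<close>)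
  ultimately show ?thesis
    unfolding generators_def using assms(1) by (simp add: depends_on_def)
qed

text \<open>Several equations are solved one at a time: the relations of the last family are sought among the
  combinations of generators of the relations of the previous ones.\<close>

lemma finite_relations_several:
  fixes A :: "nat set" and f :: "'r \<Rightarrow> nat \<Rightarrow> complex^'n \<Rightarrow> complex"
  assumes single: "\<And>(A :: nat set) (g :: nat \<Rightarrow> complex^'n \<Rightarrow> complex). finite A \<Longrightarrow>
      (\<And>\<alpha>. \<alpha> \<in> A \<Longrightarrow> hol_at x (g \<alpha>) \<and> depends_on I (g \<alpha>)) \<Longrightarrow> finite_relations I x A {()} (\<lambda>_. g)"
    and "finite R" and A: "finite A" and f: "\<And>r \<alpha>. r \<in> R \<Longrightarrow> \<alpha> \<in> A \<Longrightarrow> hol_at x (f r \<alpha>) \<and> depends_on I (f r \<alpha>)"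
  shows "finite_relations I x A R f"
  using \<open>finite R\<close> f
proof (induction R)
  case empty
  show ?case by (rule finite_relationsI[OF generators_no_equation[OF A]]) simp
next
  case (insert r R)
  then obtain J :: "nat set" and \<rho> where g: "generators I x A R f J \<rho>"
    unfolding finite_relations_def by blast
  note J = generatorsE(1)[OF g]
  define h where "h j z = (\<Sum>\<alpha>\<in>A. \<rho> j \<alpha> z * f r \<alpha> z)" for j z
  have "finite_relations I x J {()} (\<lambda>_. h)"
  proof (rule single[OF J])
    fix j assume j: "j \<in> J"
    have "hol_at x (h j)"
      unfolding h_def using generatorsE(3)[OF g j] insert.prems by (intro hol_at_sum hol_at_mult) auto
    moreover have "depends_on I (h j)"
      unfolding h_def using generatorsE(4)[OF g j] insert.prems by (intro depends_on_sum depends_on_mult) auto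
    ultimately show "hol_at x (h j) \<and> depends_on I (h j)" ..
  qed
  then obtain K :: "nat set" and \<sigma> where s: "generators I x J {()} (\<lambda>_. h) K \<sigma>"
    unfolding finite_relations_def by blast
  note K = generatorsE(1)[OF s]
  define \<tau> where "\<tau> k \<alpha> z = (\<Sum>j\<in>J. \<sigma> k j z * \<rho> j \<alpha> z)" for k \<alpha> z
  have swap: "(\<Sum>\<alpha>\<in>A. (\<Sum>j\<in>J. c j z * \<rho> j \<alpha> z) * f r' \<alpha> z) = (\<Sum>j\<in>J. c j z * (\<Sum>\<alpha>\<in>A. \<rho> j \<alpha> z * f r' \<alpha> z))" for c r' z
  proof -
    have "(\<Sum>\<alpha>\<in>A. (\<Sum>j\<in>J. c j z * \<rho> j \<alpha> z) * f r' \<alpha> z) = (\<Sum>\<alpha>\<in>A. \<Sum>j\<in>J. c j z * \<rho> j \<alpha> z * f r' \<alpha> z)"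
      by (simp add: sum_distrib_right)
    also have "\<dots> = (\<Sum>j\<in>J. \<Sum>\<alpha>\<in>A. c j z * \<rho> j \<alpha> z * f r' \<alpha> z)" by (rule sum.swap)
    finally show ?thesis by (simp add: sum_distrib_left mult.assoc)
  qed
  have "generators I x A (insert r R) f K \<tau>"
    unfolding generators_def
  proof (intro conjI ballI)
    fix k assume k: "k \<in> K"
    show "depends_on I (\<tau> k \<alpha>)" if "\<alpha> \<in> A" for \<alpha>
      unfolding \<tau>_def using generatorsE(4)[OF g] generatorsE(4)[OF s k] that
      by (intro depends_on_sum depends_on_mult) auto
    show "relation_at A (insert r R) f x (\<tau> k)"
      unfolding relation_at_def
    proof (intro conjI ballI)
      show "hol_at x (\<tau> k \<alpha>)" if "\<alpha> \<in> A" for \<alpha>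
        unfolding \<tau>_def using generatorsE(3)[OF g] generatorsE(3)[OF s k] that
        by (intro hol_at_sum hol_at_mult) auto
      fix r' assume r': "r' \<in> insert r R"
      show "\<forall>\<^sub>F z in nhds x. (\<Sum>\<alpha>\<in>A. \<tau> k \<alpha> z * f r' \<alpha> z) = 0"
      proof (cases "r' = r")
        case True
        have "\<forall>\<^sub>F z in nhds x. (\<Sum>j\<in>J. \<sigma> k j z * h j z) = 0"
          using generatorsE(2)[OF s k] by (simp add: relation_at_def)
        then show ?thesis by eventually_elim (simp add: \<tau>_def swap True h_def)
      next
        case False
        then have "r' \<in> R" using r' by simp
        then have "\<forall>\<^sub>F z in nhds x. \<forall>j\<in>J. (\<Sum>\<alpha>\<in>A. \<rho> j \<alpha> z * f r' \<alpha> z) = 0"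
          using generatorsE(2)[OF g] by (intro eventually_ball_finite J) (auto simp: relation_at_def)
        then show ?thesis by eventually_elim (simp add: \<tau>_def swap)
      qed
    qed
  next
    have "\<forall>\<^sub>F y in nhds x. \<forall>j\<in>J. \<forall>\<alpha>\<in>A. hol_at y (\<rho> j \<alpha>)"
      by (intro eventually_ball_finite J A ballI hol_at_nhds generatorsE(3)[OF g])
    then show "\<forall>\<^sub>F y in nhds x. \<forall>a. relation_at A (insert r R) f y a \<longrightarrow> combination_at A K \<tau> y a"
      using generatorsE(5)[OF g] generatorsE(5)[OF s]
    proof eventually_elim
      case (elim y)
      show ?case
      proof (intro allI impI)
        fix a assume a: "relation_at A (insert r R) f y a"
        then have "relation_at A R f y a" by (simp add: relation_at_def)
        then obtain \<gamma> where \<gamma>: "\<forall>j\<in>J. hol_at y (\<gamma> j)"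
          "\<forall>\<alpha>\<in>A. \<forall>\<^sub>F z in nhds y. a \<alpha> z = (\<Sum>j\<in>J. \<gamma> j z * \<rho> j \<alpha> z)"
          using elim(2) unfolding combination_at_def by blast
        have aA: "\<forall>\<^sub>F z in nhds y. \<forall>\<alpha>\<in>A. a \<alpha> z = (\<Sum>j\<in>J. \<gamma> j z * \<rho> j \<alpha> z)"
          using \<gamma>(2) by (intro eventually_ball_finite A)
        have "\<forall>\<^sub>F z in nhds y. (\<Sum>\<alpha>\<in>A. a \<alpha> z * f r \<alpha> z) = 0" using a by (simp add: relation_at_def)
        with aA have "\<forall>\<^sub>F z in nhds y. (\<Sum>j\<in>J. \<gamma> j z * h j z) = 0"
          by eventually_elim (simp add: h_def flip: swap)
        then have "relation_at J {()} (\<lambda>_. h) y \<gamma>" using \<gamma>(1) by (simp add: relation_at_def)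
        then have "combination_at J K \<sigma> y \<gamma>" using elim(3) by blast
        then obtain \<delta> where \<delta>: "\<forall>k\<in>K. hol_at y (\<delta> k)"
          "\<forall>j\<in>J. \<forall>\<^sub>F z in nhds y. \<gamma> j z = (\<Sum>k\<in>K. \<delta> k z * \<sigma> k j z)"
          unfolding combination_at_def by blast
        have "\<forall>\<^sub>F z in nhds y. \<forall>j\<in>J. \<gamma> j z = (\<Sum>k\<in>K. \<delta> k z * \<sigma> k j z)"
          using \<delta>(2) by (intro eventually_ball_finite J)
        with aA have "\<forall>\<^sub>F z in nhds y. \<forall>\<alpha>\<in>A. a \<alpha> z = (\<Sum>k\<in>K. \<delta> k z * \<tau> k \<alpha> z)"
        proof eventually_elim
          case (elim z)
          show ?case
          proof
            fix \<alpha> assume "\<alpha> \<in> A"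
            then have "a \<alpha> z = (\<Sum>j\<in>J. (\<Sum>k\<in>K. \<delta> k z * \<sigma> k j z) * \<rho> j \<alpha> z)" using elim by simp
            also have "\<dots> = (\<Sum>j\<in>J. \<Sum>k\<in>K. \<delta> k z * \<sigma> k j z * \<rho> j \<alpha> z)" by (simp add: sum_distrib_right)
            also have "\<dots> = (\<Sum>k\<in>K. \<Sum>j\<in>J. \<delta> k z * \<sigma> k j z * \<rho> j \<alpha> z)" by (rule sum.swap)
            finally show "a \<alpha> z = (\<Sum>k\<in>K. \<delta> k z * \<tau> k \<alpha> z)"
              by (simp add: \<tau>_def sum_distrib_left mult.assoc)
          qed
        qed
        then show "combination_at A K \<tau> y a"
          using \<delta>(1) unfolding combination_at_def
          by (intro exI[of _ \<delta>]) (auto elim: eventually_mono)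
      qed
    qed
  qed (rule K)
  then show ?case by (rule finite_relationsI)
qed

text \<open>\<open>single\<close> speaks of natural indices, whereas the system for polynomial
  coefficients is indexed by pairs; an injection into the naturals bridges this.\<close>

lemma finite_relations_polymorphic:
  fixes A :: "'a set" and f :: "'r \<Rightarrow> 'a \<Rightarrow> complex^'n \<Rightarrow> complex"
  assumes single: "\<And>(A :: nat set) (g :: nat \<Rightarrow> complex^'n \<Rightarrow> complex). finite A \<Longrightarrow>
      (\<And>\<alpha>. \<alpha> \<in> A \<Longrightarrow> hol_at x (g \<alpha>) \<and> depends_on I (g \<alpha>)) \<Longrightarrow> finite_relations I x A {()} (\<lambda>_. g)"
    and R: "finite R" and A: "finite A"
    and f: "\<And>r \<alpha>. r \<in> R \<Longrightarrow> \<alpha> \<in> A \<Longrightarrow> hol_at x (f r \<alpha>) \<and> depends_on I (f r \<alpha>)"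
  shows "finite_relations I x A R f"
proof -
  obtain h :: "'a \<Rightarrow> nat" where h: "inj_on h A" using finite_imp_inj_to_nat_seg[OF A] by blast
  show ?thesis
  proof (rule finite_relations_reindex[OF h, of _ _ id])
    show "finite_relations I x (h ` A) (id ` R) (\<lambda>r \<beta>. f r (inv_into A h \<beta>))"
      by (rule finite_relations_several[OF single]) (use R A f h in auto)
  qed (use h in auto)
qed

section \<open>Oka's theorem\<close>

text \<open>The parameters t that keep the line inside \<open>B\<close> form a convex open set
  containing 0 and 1, so vanishing near 0 spreads to 1.\<close>

lemma holomorphic_line_identity:
  fixes f :: "complex^'n \<Rightarrow> complex"
  assumes f: "holomorphic_map B f" and B: "open B" "convex B" and x: "x \<in> B" "x + v \<in> B"
    and ev: "\<forall>\<^sub>F t in nhds 0. f (x + t *s v) = 0"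
  shows "f (x + v) = 0"
proof -
  define S where "S = {t. x + t *s v \<in> B}"
  have cont: "continuous_on UNIV (\<lambda>t. x + t *s v)"
    by (intro continuous_intros linear_continuous_on bounded_linear_smult_left)
  have oS: "open S" unfolding S_def using open_vimage[OF B(1) cont] by (simp add: vimage_def)
  have cS: "convex S"
  proof (rule convexI)
    fix s t :: complex and a b :: real
    assume "s \<in> S" "t \<in> S" "0 \<le> a" "0 \<le> b" "a + b = 1"
    then have "a *\<^sub>R (x + s *s v) + b *\<^sub>R (x + t *s v) \<in> B"
      using B(2) unfolding S_def by (auto intro: convexD)
    moreover have "a *\<^sub>R (x + s *s v) + b *\<^sub>R (x + t *s v) = (a + b) *\<^sub>R x + (a *\<^sub>R s + b *\<^sub>R t) *s v"
      by (simp add: vec_eq_iff algebra_simps)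
    ultimately show "a *\<^sub>R s + b *\<^sub>R t \<in> S" using \<open>a + b = 1\<close> by (simp add: S_def)
  qed
  obtain e where e: "e > 0" "\<And>t. cmod t < e \<Longrightarrow> f (x + t *s v) = 0"
    using ev by (auto simp: eventually_nhds_metric dist_norm)
  have "0 \<in> S" "1 \<in> S" using x by (auto simp: S_def)
  have "f (x + 1 *s v) = 0"
  proof (rule analytic_continuation_open[of "S \<inter> ball 0 e" S "\<lambda>t. f (x + t *s v)" "\<lambda>_. 0"])
    show "(\<lambda>t. f (x + t *s v)) holomorphic_on S"
      by (rule holomorphic_map_line[OF f B(1)]) (simp add: S_def)
    show "S \<inter> ball 0 e \<noteq> {}" using \<open>0 \<in> S\<close> e by auto
    show "f (x + z *s v) = 0" if "z \<in> S \<inter> ball 0 e" for z using that e(2) by auto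
  qed (use oS cS \<open>1 \<in> S\<close> in \<open>auto intro: convex_connected\<close>)
  then show ?thesis by simp
qed

section \<open>Invertible changes of the given functions\<close>

lemma elementary_change_sum:
  fixes c f F q :: "'a \<Rightarrow> complex"
  assumes A: "finite A" "k \<in> A" and f: "\<And>\<beta>. \<beta> \<in> A - {k} \<Longrightarrow> f \<beta> = F \<beta> + q \<beta> * f k" "F k = t * f k"
  shows "(\<Sum>\<alpha>\<in>A. (if \<alpha> = k then t * c k - (\<Sum>\<beta>\<in>A - {k}. q \<beta> * c \<beta>) else c \<alpha>) * f \<alpha>) = (\<Sum>\<alpha>\<in>A. c \<alpha> * F \<alpha>)"
proof -
  have "(\<Sum>\<alpha>\<in>A - {k}. (if \<alpha> = k then t * c k - (\<Sum>\<beta>\<in>A - {k}. q \<beta> * c \<beta>) else c \<alpha>) * f \<alpha>)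
      = (\<Sum>\<alpha>\<in>A - {k}. c \<alpha> * F \<alpha> + q \<alpha> * c \<alpha> * f k)"
    by (intro sum.cong) (auto simp: f(1) algebra_simps)
  also have "\<dots> = (\<Sum>\<alpha>\<in>A - {k}. c \<alpha> * F \<alpha>) + (\<Sum>\<beta>\<in>A - {k}. q \<beta> * c \<beta>) * f k"
    by (simp add: sum.distrib sum_distrib_right)
  finally show ?thesis
    unfolding sum.remove[OF A] by (simp add: f(2) algebra_simps)
qed

text \<open>\<open>f\<close> and \<open>F\<close> differ by an invertible matrix of germs: multiples
  of \<open>f k\<close> are subtracted from the others, and \<open>f k\<close> is multiplied by the
  unit \<open>t\<close>. Relations transform by the transposed matrix \<open>?T\<close>, which
  carries generators to generators.\<close>

lemma finite_relations_elementary_change: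
  fixes f F :: "nat \<Rightarrow> complex^'n \<Rightarrow> complex"
  assumes A: "finite A" "k \<in> A" and fr: "finite_relations I x A {()} (\<lambda>_. F)"
    and q: "\<And>\<beta>. \<beta> \<in> A - {k} \<Longrightarrow> hol_at x (q \<beta>)" "\<And>\<beta>. \<beta> \<in> A - {k} \<Longrightarrow> depends_on I (q \<beta>)"
    and t: "hol_at x t" "depends_on I t" "t x \<noteq> 0"
    and ev: "\<And>\<beta>. \<beta> \<in> A - {k} \<Longrightarrow> \<forall>\<^sub>F z in nhds x. f \<beta> z = F \<beta> z + q \<beta> z * f k z"
      "\<forall>\<^sub>F z in nhds x. F k z = t z * f k z"
  shows "finite_relations I x A {()} (\<lambda>_. f)"
proof -
  obtain J :: "nat set" and \<rho> where g: "generators I x A {()} (\<lambda>_. F) J \<rho>"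
    using fr unfolding finite_relations_def by blast
  let ?T = "\<lambda>c \<alpha> z. if \<alpha> = k then t z * c k z - (\<Sum>\<beta>\<in>A - {k}. q \<beta> z * c \<beta> z) else c \<alpha> z"
  have evA: "\<forall>\<^sub>F z in nhds x. (\<forall>\<beta>\<in>A - {k}. f \<beta> z = F \<beta> z + q \<beta> z * f k z) \<and> F k z = t z * f k z \<and> t z \<noteq> 0"
    using A(1) ev hol_at_nonzero_nhds[OF t(1,3)] by (intro eventually_conj eventually_ball_finite) auto
  have sums: "\<forall>\<^sub>F z in nhds x. \<forall>c. (\<Sum>\<alpha>\<in>A. ?T c \<alpha> z * f \<alpha> z) = (\<Sum>\<alpha>\<in>A. c \<alpha> z * F \<alpha> z)"
    using evA
  proof eventually_elim
    case (elim z)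
    show ?case
      by (rule allI, rule elementary_change_sum[OF A]) (use elim in auto)
  qed
  have T_hol: "hol_at y (?T c \<alpha>)" if "\<alpha> \<in> A" "\<And>\<beta>. \<beta> \<in> A \<Longrightarrow> hol_at y (c \<beta>)"
    "\<And>\<beta>. \<beta> \<in> A - {k} \<Longrightarrow> hol_at y (q \<beta>)" "hol_at y t" for y c \<alpha>
    using that A(2) by (cases "\<alpha> = k") (auto intro!: hol_at_diff hol_at_mult hol_at_sum)
  have "generators I x A {()} (\<lambda>_. f) J (\<lambda>j. ?T (\<rho> j))"
    unfolding generators_def
  proof (intro conjI ballI)
    fix j assume j: "j \<in> J"
    have "\<forall>\<^sub>F z in nhds x. (\<Sum>\<alpha>\<in>A. \<rho> j \<alpha> z * F \<alpha> z) = 0"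
      using generatorsE(2)[OF g j] by (simp add: relation_at_def)
    then have "\<forall>\<^sub>F z in nhds x. (\<Sum>\<alpha>\<in>A. ?T (\<rho> j) \<alpha> z * f \<alpha> z) = 0"
      using sums by eventually_elim simp
    moreover have "hol_at x (?T (\<rho> j) \<alpha>)" if "\<alpha> \<in> A" for \<alpha>
      using that by (rule T_hol[OF _ generatorsE(3)[OF g j] q(1) t(1)])
    ultimately show "relation_at A {()} (\<lambda>_. f) x (?T (\<rho> j))"
      unfolding relation_at_def by (intro conjI ballI)
    fix \<alpha> assume \<alpha>: "\<alpha> \<in> A"
    show "depends_on I (?T (\<rho> j) \<alpha>)"
    proof (cases "\<alpha> = k")
      case True
      have "depends_on I (\<lambda>z. t z * \<rho> j k z - (\<Sum>\<beta>\<in>A - {k}. q \<beta> z * \<rho> j \<beta> z))"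
        by (rule depends_on_comp2[where h = "(-)"])
          (use generatorsE(4)[OF g j] q(2) t(2) A(2) in \<open>auto intro!: depends_on_mult depends_on_sum\<close>)
      then show ?thesis by (simp add: True)
    qed (use generatorsE(4)[OF g j \<alpha>] in simp)
  next
    have "\<forall>\<^sub>F y in nhds x. \<forall>\<beta>\<in>A - {k}. hol_at y (q \<beta>)"
      using A(1) by (intro eventually_ball_finite ballI hol_at_nhds q(1)) auto
    moreover have "\<forall>\<^sub>F y in nhds x. hol_at y t" by (rule hol_at_nhds[OF t(1)])
    moreover have "\<forall>\<^sub>F y in nhds x. t y \<noteq> 0" by (rule hol_at_nonzero_nhds[OF t(1,3)])
    moreover have "\<forall>\<^sub>F y in nhds x. \<forall>\<^sub>F z in nhds y. \<forall>c. (\<Sum>\<alpha>\<in>A. ?T c \<alpha> z * f \<alpha> z) = (\<Sum>\<alpha>\<in>A. c \<alpha> z * F \<alpha> z)"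
      using sums by (simp add: eventually_eventually)
    ultimately show "\<forall>\<^sub>F y in nhds x. \<forall>a. relation_at A {()} (\<lambda>_. f) y a \<longrightarrow> combination_at A J (\<lambda>j. ?T (\<rho> j)) y a"
      using generatorsE(5)[OF g]
    proof eventually_elim
      case (elim y)
      show ?case
      proof (intro allI impI)
        fix a assume a: "relation_at A {()} (\<lambda>_. f) y a"
        \<comment> \<open>The inverse of \<open>?T\<close> applied to \<open>a\<close>; it exists
          near \<open>y\<close> because \<open>t\<close> has no zeros close to
          \<open>x\<close>.\<close>
        define b where "b \<alpha> z = (if \<alpha> = k then (a k z + (\<Sum>\<beta>\<in>A - {k}. q \<beta> z * a \<beta> z)) * inverse (t z) else a \<alpha> z)" for \<alpha> z
        have ha: "hol_at y (a \<alpha>)" if "\<alpha> \<in> A" for \<alpha> using a that by (simp add: relation_at_def)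
        have hb: "hol_at y (b \<alpha>)" if "\<alpha> \<in> A" for \<alpha>
        proof (cases "\<alpha> = k")
          case True
          have "hol_at y (\<lambda>z. (a k z + (\<Sum>\<beta>\<in>A - {k}. q \<beta> z * a \<beta> z)) * inverse (t z))"
            using elim ha A(2) by (intro hol_at_mult hol_at_add hol_at_sum hol_at_inverse) auto
          then show ?thesis by (simp add: b_def[abs_def] True)
        qed (use ha[OF that] in \<open>simp add: b_def[abs_def]\<close>)
        have tn: "\<forall>\<^sub>F z in nhds y. t z \<noteq> 0" using elim hol_at_nonzero_nhds by blast
        have ab: "\<forall>\<^sub>F z in nhds y. \<forall>\<alpha>. a \<alpha> z = ?T b \<alpha> z"
          using tn by eventually_elim (auto simp: b_def field_simps)
        have "\<forall>\<^sub>F z in nhds y. (\<Sum>\<alpha>\<in>A. a \<alpha> z * f \<alpha> z) = 0" using a by (simp add: relation_at_def)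
        then have "\<forall>\<^sub>F z in nhds y. (\<Sum>\<alpha>\<in>A. b \<alpha> z * F \<alpha> z) = 0"
          using ab elim(4)
        proof eventually_elim
          case (elim z)
          have "(\<Sum>\<alpha>\<in>A. b \<alpha> z * F \<alpha> z) = (\<Sum>\<alpha>\<in>A. ?T b \<alpha> z * f \<alpha> z)" using elim(3) by metis
          also have "\<dots> = (\<Sum>\<alpha>\<in>A. a \<alpha> z * f \<alpha> z)" by (simp only: spec[OF elim(2)])
          finally show ?case using elim(1) by simp
        qed
        then have "relation_at A {()} (\<lambda>_. F) y b" using hb by (simp add: relation_at_def)
        then have "combination_at A J \<rho> y b" using elim(5) by blast
        then obtain \<gamma> where \<gamma>: "\<forall>j\<in>J. hol_at y (\<gamma> j)"
          "\<forall>\<alpha>\<in>A. \<forall>\<^sub>F z in nhds y. b \<alpha> z = (\<Sum>j\<in>J. \<gamma> j z * \<rho> j \<alpha> z)"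
          unfolding combination_at_def by blast
        have "\<forall>\<^sub>F z in nhds y. \<forall>\<alpha>\<in>A. b \<alpha> z = (\<Sum>j\<in>J. \<gamma> j z * \<rho> j \<alpha> z)"
          using \<gamma>(2) by (intro eventually_ball_finite A)
        then have "\<forall>\<^sub>F z in nhds y. \<forall>\<alpha>\<in>A. a \<alpha> z = (\<Sum>j\<in>J. \<gamma> j z * ?T (\<rho> j) \<alpha> z)"
          using ab
        proof eventually_elim
          case (elim z)
          show ?case
          proof
            fix \<alpha> assume \<alpha>: "\<alpha> \<in> A"
            show "a \<alpha> z = (\<Sum>j\<in>J. \<gamma> j z * ?T (\<rho> j) \<alpha> z)"
            proof (cases "\<alpha> = k")
              case True
              have "(\<Sum>\<beta>\<in>A - {k}. q \<beta> z * b \<beta> z) = (\<Sum>\<beta>\<in>A - {k}. \<Sum>j\<in>J. \<gamma> j z * (q \<beta> z * \<rho> j \<beta> z))"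
                using elim(1) by (intro sum.cong) (auto simp: sum_distrib_left algebra_simps)
              also have "\<dots> = (\<Sum>j\<in>J. \<gamma> j z * (\<Sum>\<beta>\<in>A - {k}. q \<beta> z * \<rho> j \<beta> z))"
                unfolding sum_distrib_left by (rule sum.swap)
              finally have "t z * b k z - (\<Sum>\<beta>\<in>A - {k}. q \<beta> z * b \<beta> z)
                  = (\<Sum>j\<in>J. \<gamma> j z * (t z * \<rho> j k z - (\<Sum>\<beta>\<in>A - {k}. q \<beta> z * \<rho> j \<beta> z)))"
                using elim(1) A(2) by (simp add: right_diff_distrib sum_subtractf sum_distrib_left mult.left_commute)
              then show ?thesis using spec[OF elim(2), of k] by (simp add: True)
            next
              case False
              then show ?thesis using spec[OF elim(2), of \<alpha>] elim(1) \<alpha> by simp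
            qed
          qed
        qed
        then show "combination_at A J (\<lambda>j. ?T (\<rho> j)) y a"
          using \<gamma>(1) unfolding combination_at_def
          by (intro exI[of _ \<gamma>]) (auto elim: eventually_mono)
      qed
    qed
  qed (rule generatorsE(1)[OF g])
  then show ?thesis by (rule finite_relationsI)
qed

section \<open>Reduction to linear equations in fewer variables\<close>

lemma coeff_mult_deg_lt:
  assumes "deg_lt d P"
  shows "coeff (P * Q) m = (\<Sum>l<d. coeff P l * (if l \<le> m then coeff Q (m - l) else 0))"
proof -
  have "(\<Sum>l<d. coeff P l * (if l \<le> m then coeff Q (m - l) else 0)) = (\<Sum>l\<in>{..<d} \<inter> {..m}. coeff P l * coeff Q (m - l))"
    by (subst sum.inter_restrict) (auto intro!: sum.cong)
  also have "\<dots> = (\<Sum>l\<le>m. coeff P l * coeff Q (m - l))"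
    using assms by (intro sum.mono_neutral_left) (fastforce simp: deg_lt_def simp flip: not_le)+
  finally show ?thesis by (simp add: coeff_mult)
qed

lemma depends_on_remove:
  fixes G :: "complex^'n \<Rightarrow> 'b"
  assumes "depends_on I G" "\<And>z t. G (upd z i t) = G z"
  shows "depends_on (I - {i}) G"
  unfolding depends_on_def
proof (intro allI impI)
  fix z w :: "complex^'n" assume "\<forall>j\<in>I - {i}. z $ j = w $ j"
  then have "G (upd z i (w $ i)) = G w" by (intro depends_onD[OF assms(1)]) auto
  then show "G z = G w" by (simp add: assms(2))
qed

lemma relation_at_unit: "relation_at A {()} (\<lambda>_. f) y a \<longleftrightarrow>
    (\<forall>\<alpha>\<in>A. hol_at y (a \<alpha>)) \<and> (\<forall>\<^sub>F z in nhds y. (\<Sum>\<alpha>\<in>A. a \<alpha> z * f \<alpha> z) = 0)"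
  by (simp add: relation_at_def)

text \<open>The unknowns, indexed by \<open>B\<close>, are the coefficients of polynomials
  \<open>P \<alpha>\<close> of degree below \<open>d\<close>; the rows say that every coefficient of
  the sum of the \<open>P \<alpha> * G \<alpha>\<close> vanishes. Generators are the Koszul
  relations with the pivot \<open>k\<close> (\<open>Inl\<close>) and the solutions of this system
  read as polynomials (\<open>Inr\<close>).\<close>

lemma finite_relations_monic:
  fixes G :: "nat \<Rightarrow> complex^'n \<Rightarrow> complex poly"
  assumes several: "\<And>(B :: (nat \<times> nat) set) (R :: nat set) g. finite B \<Longrightarrow> finite R \<Longrightarrow>
      (\<And>r \<beta>. r \<in> R \<Longrightarrow> \<beta> \<in> B \<Longrightarrow> hol_at x (g r \<beta>) \<and> depends_on (I - {i}) (g r \<beta>)) \<Longrightarrow>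
      finite_relations (I - {i}) x B R g"
    and i: "i \<in> I" and A: "finite A" "k \<in> A"
    and F: "hol_poly x i (Suc d) (G k)" "\<And>z. coeff (G k z) d = 1"
    and G: "\<And>\<alpha>. \<alpha> \<in> A - {k} \<Longrightarrow> hol_poly x i d (G \<alpha>)"
    and dep: "\<And>\<alpha>. \<alpha> \<in> A \<Longrightarrow> depends_on I (G \<alpha>)"
  shows "finite_relations I x A {()} (\<lambda>_ \<alpha> z. poly (G \<alpha> z) (z $ i))"
proof -
  define B where "B = A \<times> {..<d}"
  \<comment> \<open>A product of degrees at most \<open>d - 1\<close> and \<open>d\<close> has no
    coefficients from \<open>2 * d\<close> on.\<close>
  define R where "R = {..<2 * d}"
  define row where "row m \<beta> z = (case \<beta> of (\<alpha>, l) \<Rightarrow> if l \<le> m then coeff (G \<alpha> z) (m - l) else 0)" for m :: nat and \<beta> z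
  let ?g = "\<lambda>\<alpha> z. poly (G \<alpha> z) (z $ i)"
  have Gall: "hol_poly x i (Suc d) (G \<alpha>)" if "\<alpha> \<in> A" for \<alpha>
    using F G[of \<alpha>] that hol_poly_mono[of x i d "G \<alpha>" "Suc d"] by (cases "\<alpha> = k") auto
  have finB: "finite B" "finite R" using A by (auto simp: B_def R_def)
  have rows: "(\<Sum>\<beta>\<in>B. (case \<beta> of (\<alpha>, l) \<Rightarrow> coeff (P \<alpha>) l) * row m \<beta> z) = coeff (\<Sum>\<alpha>\<in>A. P \<alpha> * G \<alpha> z) m"
    if "\<And>\<alpha>. \<alpha> \<in> A \<Longrightarrow> deg_lt d (P \<alpha>)" for P m z
  proof -
    have "coeff (\<Sum>\<alpha>\<in>A. P \<alpha> * G \<alpha> z) m = (\<Sum>\<alpha>\<in>A. \<Sum>l<d. coeff (P \<alpha>) l * row m (\<alpha>, l) z)"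
      unfolding coeff_sum row_def by (intro sum.cong) (simp_all add: coeff_mult_deg_lt[OF that])
    then show ?thesis unfolding B_def by (simp add: sum.cartesian_product split_def)
  qed
  have "finite_relations (I - {i}) x B R row"
  proof (rule several[OF finB])
    fix m \<beta> assume "\<beta> \<in> B"
    then obtain \<alpha> l where \<beta>: "\<beta> = (\<alpha>, l)" "\<alpha> \<in> A" by (auto simp: B_def)
    have "depends_on (I - {i}) (\<lambda>z. coeff (G \<alpha> z) (m - l))"
      by (rule depends_on_comp1[OF depends_on_remove[OF dep[OF \<beta>(2)] hol_polyD(2)[OF Gall[OF \<beta>(2)]]]])
    then show "hol_at x (row m \<beta>) \<and> depends_on (I - {i}) (row m \<beta>)"
      using hol_polyD(1)[OF Gall[OF \<beta>(2)]] by (cases "l \<le> m") (auto simp: row_def[abs_def] \<beta>(1))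
  qed
  then obtain J :: "nat set" and \<rho> where g: "generators (I - {i}) x B R row J \<rho>"
    unfolding finite_relations_def by blast
  note J = generatorsE(1)[OF g]
  define \<sigma> :: "nat + nat \<Rightarrow> nat \<Rightarrow> complex^'n \<Rightarrow> complex" where
    "\<sigma> s \<alpha> = (case s of Inl \<beta> \<Rightarrow> (\<lambda>z. if \<alpha> = \<beta> then ?g k z else if \<alpha> = k then - ?g \<beta> z else 0)
       | Inr j \<Rightarrow> (\<lambda>z. \<Sum>l<d. \<rho> j (\<alpha>, l) z * (z $ i) ^ l))" for s \<alpha>
  have hg: "hol_at x (?g \<alpha>)" if "\<alpha> \<in> A" for \<alpha> by (rule hol_poly_value[OF Gall[OF that]])
  have dg: "depends_on I (?g \<alpha>)" if "\<alpha> \<in> A" for \<alpha>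
    by (rule depends_on_comp2[OF dep[OF that] depends_on_component[OF i]])
  let ?S = "(A - {k}) <+> J"
  have "generators I x A {()} (\<lambda>_. ?g) ?S \<sigma>"
    unfolding generators_def
  proof (intro conjI ballI)
    show "finite ?S" using A J by simp
  next
    fix s assume s: "s \<in> ?S"
    show "relation_at A {()} (\<lambda>_. ?g) x (\<sigma> s)"
    proof (cases s)
      case (Inl \<beta>)
      then have \<beta>: "\<beta> \<in> A" "\<beta> \<noteq> k" using s by auto
      have "hol_at x (\<sigma> s \<alpha>)" if "\<alpha> \<in> A" for \<alpha>
        using hg[OF A(2)] hg[OF \<beta>(1)] hol_at_uminus
        by (cases "\<alpha> = \<beta>"; cases "\<alpha> = k") (auto simp: \<sigma>_def Inl)
      moreover have "(\<Sum>\<alpha>\<in>A. \<sigma> s \<alpha> z * ?g \<alpha> z) = 0" for z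
      proof -
        have "(\<Sum>\<alpha>\<in>A. \<sigma> s \<alpha> z * ?g \<alpha> z) = (\<Sum>\<alpha>\<in>{\<beta>, k}. \<sigma> s \<alpha> z * ?g \<alpha> z)"
          using \<beta> A by (intro sum.mono_neutral_right) (auto simp: \<sigma>_def Inl)
        then show ?thesis using \<beta> by (simp add: \<sigma>_def Inl)
      qed
      ultimately show ?thesis by (simp add: relation_at_unit)
    next
      case (Inr j)
      then have j: "j \<in> J" using s by auto
      have "hol_at x (\<sigma> s \<alpha>)" if "\<alpha> \<in> A" for \<alpha>
        unfolding \<sigma>_def Inr sum.case
        by (intro hol_at_sum hol_at_mult hol_at_power hol_at_component generatorsE(3)[OF g j])
          (use that in \<open>auto simp: B_def\<close>)
      moreover have "\<forall>\<^sub>F z in nhds x. (\<Sum>\<alpha>\<in>A. \<sigma> s \<alpha> z * ?g \<alpha> z) = 0"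
      proof -
        have "\<forall>\<^sub>F z in nhds x. \<forall>m\<in>R. (\<Sum>\<beta>\<in>B. \<rho> j \<beta> z * row m \<beta> z) = 0"
          by (rule eventually_ball_finite[OF finB(2)]) (use generatorsE(2)[OF g j] in \<open>simp add: relation_at_def\<close>)
        then show ?thesis
        proof eventually_elim
          case (elim z)
          define P where "P \<alpha> = (\<Sum>l<d. monom (\<rho> j (\<alpha>, l) z) l)" for \<alpha>
          have cP: "coeff (P \<alpha>) l = (if l < d then \<rho> j (\<alpha>, l) z else 0)" for \<alpha> l
            by (simp add: P_def coeff_sum if_distrib cong: if_cong)
          have degP: "deg_lt d (P \<alpha>)" for \<alpha> by (simp add: deg_lt_def cP)
          have "coeff (\<Sum>\<alpha>\<in>A. P \<alpha> * G \<alpha> z) m = 0" for m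
          proof (cases "m < 2 * d")
            case True
            have "(\<Sum>\<beta>\<in>B. (case \<beta> of (\<alpha>, l) \<Rightarrow> coeff (P \<alpha>) l) * row m \<beta> z) = (\<Sum>\<beta>\<in>B. \<rho> j \<beta> z * row m \<beta> z)"
              by (intro sum.cong) (auto simp: B_def cP)
            then show ?thesis using elim True rows[of P m z, OF degP] by (simp add: R_def)
          next
            case False
            have "coeff (P \<alpha> * G \<alpha> z) m = 0" if "\<alpha> \<in> A" for \<alpha>
              using deg_lt_mult[OF degP hol_polyD(3)[OF Gall[OF that]], of \<alpha> z] False
              by (simp add: deg_lt_def)
            then show ?thesis by (simp add: coeff_sum)
          qed
          then have "(\<Sum>\<alpha>\<in>A. P \<alpha> * G \<alpha> z) = 0" by (simp add: poly_eq_iff)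
          moreover have "(\<Sum>\<alpha>\<in>A. poly (P \<alpha>) (z $ i) * ?g \<alpha> z) = poly (\<Sum>\<alpha>\<in>A. P \<alpha> * G \<alpha> z) (z $ i)"
            by (simp add: poly_sum)
          ultimately have "(\<Sum>\<alpha>\<in>A. poly (P \<alpha>) (z $ i) * ?g \<alpha> z) = 0" by simp
          moreover have "poly (P \<alpha>) (z $ i) = \<sigma> s \<alpha> z" for \<alpha>
            by (simp add: P_def \<sigma>_def Inr poly_sum poly_monom)
          ultimately show ?case by simp
        qed
      qed
      ultimately show ?thesis by (simp add: relation_at_unit)
    qed
    fix \<alpha> assume \<alpha>: "\<alpha> \<in> A"
    show "depends_on I (\<sigma> s \<alpha>)"
    proof (cases s)
      case (Inl \<beta>)
      then have "\<beta> \<in> A" "\<beta> \<noteq> k" using s by auto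
      then show ?thesis
        using dg[OF A(2)] depends_on_comp1[OF dg, of \<beta> uminus]
        by (cases "\<alpha> = \<beta>"; cases "\<alpha> = k") (auto simp: \<sigma>_def Inl)
    next
      case (Inr j)
      then have j: "j \<in> J" using s by auto
      have "depends_on I (\<rho> j (\<alpha>, l))" if "l < d" for l
        by (rule depends_on_mono[OF generatorsE(4)[OF g j]]) (use \<alpha> that in \<open>auto simp: B_def\<close>)
      moreover have "depends_on I (\<lambda>z :: complex^'n. (z $ i) ^ l)" for l
        by (rule depends_on_comp1[OF depends_on_component[OF i]])
      ultimately show ?thesis
        unfolding \<sigma>_def Inr sum.case by (intro depends_on_sum depends_on_mult) auto
    qed
  next
    have "\<forall>\<^sub>F y in nhds x. \<forall>\<alpha>\<in>A - {k}. hol_poly y i d (G \<alpha>)"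
      using A(1) by (intro eventually_ball_finite ballI hol_poly_nhds G) auto
    moreover have "\<forall>\<^sub>F y in nhds x. hol_poly y i (Suc d) (G k)" by (rule hol_poly_nhds[OF F(1)])
    ultimately show "\<forall>\<^sub>F y in nhds x. \<forall>a. relation_at A {()} (\<lambda>_. ?g) y a \<longrightarrow> combination_at A ?S \<sigma> y a"
      using generatorsE(5)[OF g]
    proof eventually_elim
      case (elim y)
      show ?case
      proof (intro allI impI)
        fix a assume "relation_at A {()} (\<lambda>_. ?g) y a"
        then have a: "\<And>\<alpha>. \<alpha> \<in> A \<Longrightarrow> hol_at y (a \<alpha>)" "\<forall>\<^sub>F z in nhds y. (\<Sum>\<alpha>\<in>A. a \<alpha> z * ?g \<alpha> z) = 0"
          by (auto simp: relation_at_unit)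
        have rel: "\<forall>\<^sub>F z in nhds y. (\<Sum>\<alpha>\<in>A - {k}. a \<alpha> z * ?g \<alpha> z) + a k z * ?g k z = 0"
          using a(2) by eventually_elim (simp add: sum.remove[OF A] add.commute)
        have fA: "finite (A - {k})" using A by simp
        have hG: "hol_poly y i d (G \<alpha>)" if "\<alpha> \<in> A - {k}" for \<alpha> using elim that by blast
        have ha: "hol_at y (a \<alpha>)" if "\<alpha> \<in> A - {k}" for \<alpha> using a that by blast
        show "combination_at A ?S \<sigma> y a"
        proof (rule oka_reduction[OF elim(2) F(2) fA hG ha a(1)[OF A(2)] rel])
          fix s t P S
          assume s: "\<And>\<alpha>. \<alpha> \<in> A - {k} \<Longrightarrow> hol_at y (s \<alpha>)" and t: "hol_at y t"
            and P: "\<And>\<alpha>. \<alpha> \<in> A - {k} \<Longrightarrow> hol_poly y i d (P \<alpha>)" and S: "hol_poly y i d S"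
            and PS: "\<forall>\<^sub>F z in nhds y. (\<Sum>\<alpha>\<in>A - {k}. P \<alpha> z * G \<alpha> z) + S z * G k z = 0"
            and aP: "\<And>\<alpha>. \<alpha> \<in> A - {k} \<Longrightarrow> \<forall>\<^sub>F z in nhds y. a \<alpha> z = s \<alpha> z * ?g k z + t z * poly (P \<alpha> z) (z $ i)"
            and aS: "\<forall>\<^sub>F z in nhds y. a k z = - (\<Sum>\<alpha>\<in>A - {k}. s \<alpha> z * ?g \<alpha> z) + t z * poly (S z) (z $ i)"
          define T where "T = P(k := S)"
          have T: "hol_poly y i d (T \<alpha>)" if "\<alpha> \<in> A" for \<alpha> using P S that by (simp add: T_def)
          define c where "c \<beta> z = (case \<beta> of (\<alpha>, l) \<Rightarrow> coeff (T \<alpha> z) l)" for \<beta> z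
          have "relation_at B R row y c"
            unfolding relation_at_def
          proof (intro conjI ballI)
            show "hol_at y (c \<beta>)" if "\<beta> \<in> B" for \<beta>
              using that hol_polyD(1)[OF T] by (auto simp: c_def[abs_def] B_def)
            fix m
            show "\<forall>\<^sub>F z in nhds y. (\<Sum>\<beta>\<in>B. c \<beta> z * row m \<beta> z) = 0"
              using PS
            proof eventually_elim
              case (elim z)
              have "(\<Sum>\<alpha>\<in>A. T \<alpha> z * G \<alpha> z) = 0"
                using elim by (simp add: sum.remove[OF A] T_def add.commute)
              then show ?case
                unfolding c_def using rows[of "\<lambda>\<alpha>. T \<alpha> z" m z, OF hol_polyD(3)[OF T]] by simp
            qed
          qed
          then have "combination_at B J \<rho> y c" using elim(3) by blast
          then obtain \<gamma> where \<gamma>: "\<forall>j\<in>J. hol_at y (\<gamma> j)"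
            "\<forall>\<beta>\<in>B. \<forall>\<^sub>F z in nhds y. c \<beta> z = (\<Sum>j\<in>J. \<gamma> j z * \<rho> j \<beta> z)"
            unfolding combination_at_def by blast
          have cB: "\<forall>\<^sub>F z in nhds y. \<forall>\<beta>\<in>B. c \<beta> z = (\<Sum>j\<in>J. \<gamma> j z * \<rho> j \<beta> z)"
            using \<gamma>(2) by (intro eventually_ball_finite finB)
          have Tval: "\<forall>\<^sub>F z in nhds y. \<forall>\<alpha>\<in>A. poly (T \<alpha> z) (z $ i) = (\<Sum>j\<in>J. \<gamma> j z * \<sigma> (Inr j) \<alpha> z)"
            using cB
          proof eventually_elim
            case (elim z)
            show ?case
            proof
              fix \<alpha> assume \<alpha>: "\<alpha> \<in> A"
              have "poly (T \<alpha> z) (z $ i) = (\<Sum>l<d. c (\<alpha>, l) z * (z $ i) ^ l)"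
                by (simp add: deg_lt_poly[OF hol_polyD(3)[OF T[OF \<alpha>]]] c_def)
              also have "\<dots> = (\<Sum>l<d. \<Sum>j\<in>J. \<gamma> j z * (\<rho> j (\<alpha>, l) z * (z $ i) ^ l))"
                using elim \<alpha> by (intro sum.cong) (auto simp: B_def sum_distrib_right mult.assoc)
              also have "\<dots> = (\<Sum>j\<in>J. \<Sum>l<d. \<gamma> j z * (\<rho> j (\<alpha>, l) z * (z $ i) ^ l))" by (rule sum.swap)
              finally show "poly (T \<alpha> z) (z $ i) = (\<Sum>j\<in>J. \<gamma> j z * \<sigma> (Inr j) \<alpha> z)"
                by (simp add: \<sigma>_def sum_distrib_left)
            qed
          qed
          \<comment> \<open>The reduction supplies the multipliers: \<open>s\<close> weights the
            Koszul relations, and \<open>t\<close> multiplies the polynomial relation expanded by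
            \<gamma>.\<close>
          define \<delta> where "\<delta> e z = (case e of Inl \<beta> \<Rightarrow> s \<beta> z | Inr j \<Rightarrow> t z * \<gamma> j z)" for e z
          have h\<delta>: "hol_at y (\<delta> e)" if "e \<in> ?S" for e
            using that s \<gamma>(1) t by (cases e) (auto simp: \<delta>_def[abs_def] intro!: hol_at_mult)
          have split: "(\<Sum>e\<in>?S. \<delta> e z * \<sigma> e \<alpha> z)
              = (\<Sum>\<beta>\<in>A - {k}. s \<beta> z * \<sigma> (Inl \<beta>) \<alpha> z) + t z * (\<Sum>j\<in>J. \<gamma> j z * \<sigma> (Inr j) \<alpha> z)" for \<alpha> z
            using fA J by (simp add: sum.Plus \<delta>_def sum_distrib_left mult.assoc)
          have "\<forall>\<^sub>F z in nhds y. a \<alpha> z = (\<Sum>e\<in>?S. \<delta> e z * \<sigma> e \<alpha> z)" if \<alpha>: "\<alpha> \<in> A" for \<alpha>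
          proof (cases "\<alpha> = k")
            case True
            show ?thesis
              using aS Tval
            proof eventually_elim
              case (elim z)
              have "(\<Sum>\<beta>\<in>A - {k}. s \<beta> z * \<sigma> (Inl \<beta>) k z) = - (\<Sum>\<beta>\<in>A - {k}. s \<beta> z * ?g \<beta> z)"
                unfolding sum_negf[symmetric] by (intro sum.cong) (auto simp: \<sigma>_def)
              moreover have "poly (S z) (z $ i) = (\<Sum>j\<in>J. \<gamma> j z * \<sigma> (Inr j) k z)"
                using elim(2) A(2) by (auto simp: T_def)
              ultimately show ?case using elim(1) by (simp only: split True)
            qed
          next
            case False
            then have \<alpha>': "\<alpha> \<in> A - {k}" using \<alpha> by simp
            show ?thesis
              using aP[OF \<alpha>'] Tval
            proof eventually_elim
              case (elim z)
              have "(\<Sum>\<beta>\<in>A - {k}. s \<beta> z * \<sigma> (Inl \<beta>) \<alpha> z) = (\<Sum>\<beta>\<in>{\<alpha>}. s \<beta> z * \<sigma> (Inl \<beta>) \<alpha> z)"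
                using \<alpha>' fA by (intro sum.mono_neutral_right) (auto simp: \<sigma>_def)
              then have "(\<Sum>\<beta>\<in>A - {k}. s \<beta> z * \<sigma> (Inl \<beta>) \<alpha> z) = s \<alpha> z * ?g k z" by (simp add: \<sigma>_def)
              moreover have "poly (P \<alpha> z) (z $ i) = (\<Sum>j\<in>J. \<gamma> j z * \<sigma> (Inr j) \<alpha> z)"
                using bspec[OF elim(2) \<alpha>] False by (simp add: T_def)
              ultimately show ?case using elim(1) by (simp only: split)
            qed
          qed
          then show "combination_at A ?S \<sigma> y a"
            unfolding combination_at_def using h\<delta> by (intro exI[of _ \<delta>] conjI ballI)
        qed
      qed
    qed
  qed
  then show ?thesis by (rule finite_relationsI)
qed

section \<open>Freezing the coordinates outside \<open>I\<close>\<close>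

definition freeze :: "'n set \<Rightarrow> complex^'n \<Rightarrow> complex^'n \<Rightarrow> complex^'n" where
  "freeze I x z = (\<chi> j. if j \<in> I then z $ j else x $ j)"

lemma freeze_nth [simp]: "freeze I x z $ j = (if j \<in> I then z $ j else x $ j)"
  by (simp add: freeze_def)

lemma freeze_self [simp]: "freeze I x x = x"
  by (simp add: vec_eq_iff)

lemma freeze_upd: "i \<in> I \<Longrightarrow> freeze I x (upd z i t) = upd (freeze I x z) i t"
  by (auto simp: vec_eq_iff)

lemma freeze_has_derivative:
  fixes x z :: "complex^'n"
  shows "((freeze I x) has_derivative (freeze I 0)) (at z)"
proof -
  have "bounded_linear (freeze I (0 :: complex^'n))"
  proof (rule bounded_linear_intro[of _ 1])
    show "norm (freeze I 0 v) \<le> norm v * 1" for v :: "complex^'n"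
      unfolding norm_vec_def by (auto intro: L2_set_mono)
  qed (auto simp: vec_eq_iff)
  then have "((\<lambda>z. freeze I 0 z + freeze (- I) 0 x) has_derivative (\<lambda>v. freeze I 0 v + 0)) (at z)"
    by (intro has_derivative_add bounded_linear_imp_has_derivative has_derivative_const)
  moreover have "freeze I x = (\<lambda>z. freeze I 0 z + freeze (- I) 0 x)"
    by (auto simp: vec_eq_iff)
  ultimately show ?thesis by simp
qed

lemma freeze_smult: "freeze I 0 (c *s v) = c *s freeze I 0 v"
  by (simp add: vec_eq_iff)

lemma isCont_freeze: "isCont (freeze I x) z"
  using has_derivative_continuous[OF freeze_has_derivative] .

lemma hol_at_freeze: "hol_at x f \<Longrightarrow> hol_at x (\<lambda>z. f (freeze I x z))"
  by (rule hol_at_compose[OF _ freeze_has_derivative freeze_smult]) simp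

lemma depends_on_freeze: "depends_on I (\<lambda>z. f (freeze I x z))"
  unfolding depends_on_def by (auto intro!: arg_cong[of _ _ f] simp: vec_eq_iff)

lemma depends_on_freeze_eq: "depends_on I f \<Longrightarrow> f (freeze I x z) = f z"
  by (rule depends_onD) auto

lemma isCont_upd_param:
  fixes x :: "complex^'n"
  shows "isCont (\<lambda>s. upd x i (x $ i + s)) s"
proof -
  have "isCont (\<lambda>s. x + s *s axis i 1) s"
    by (intro continuous_intros linear_continuous_at bounded_linear_smult_left)
  then show ?thesis by (simp add: upd_line)
qed

text \<open>Dividing the other functions and the monomial by \<open>f k\<close> replaces the family
  by remainders of degree below \<open>d\<close> and a Weierstrass polynomial. This is an elementary
  change, after which the monic case applies.\<close>

lemma finite_relations_regular:
  fixes f :: "nat \<Rightarrow> complex^'n \<Rightarrow> complex"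
  assumes several: "\<And>(B :: (nat \<times> nat) set) (R :: nat set) g. finite B \<Longrightarrow> finite R \<Longrightarrow>
      (\<And>r \<beta>. r \<in> R \<Longrightarrow> \<beta> \<in> B \<Longrightarrow> hol_at x (g r \<beta>) \<and> depends_on (I - {i}) (g r \<beta>)) \<Longrightarrow>
      finite_relations (I - {i}) x B R g"
    and i: "i \<in> I" and A: "finite A" "k \<in> A"
    and f: "\<And>\<alpha>. \<alpha> \<in> A \<Longrightarrow> hol_at x (f \<alpha>)" "\<And>\<alpha>. \<alpha> \<in> A \<Longrightarrow> depends_on I (f \<alpha>)"
    and reg: "\<not> (\<forall>\<^sub>F t in nhds 0. f k (upd x i (x $ i + t)) = 0)"
  shows "finite_relations I x A {()} (\<lambda>_. f)"
proof (rule weierstrass_division_poly[OF f(1)[OF A(2)] reg])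
  fix d u
  assume u: "hol_at x u" "u x \<noteq> 0"
    and line: "\<forall>\<^sub>F s in nhds 0. f k (upd x i (x $ i + s)) = s ^ d * u (upd x i (x $ i + s))"
    and E: "\<And>g. hol_at x g \<Longrightarrow> \<exists>q R. hol_at x q \<and> hol_poly x i d R \<and>
        (\<forall>\<^sub>F z in nhds x. g z = f k z * q z + poly (R z) (z $ i))"
  \<comment> \<open>Division knows nothing of \<open>I\<close>; substituting
    \<open>freeze I x\<close> into its result leaves \<open>g\<close> and \<open>f k\<close>
    unchanged and makes quotient and remainder depend on \<open>I\<close> only.\<close>
  have EI: "\<exists>q R. hol_at x q \<and> depends_on I q \<and> hol_poly x i d R \<and> depends_on I R \<and>
        (\<forall>\<^sub>F z in nhds x. g z = f k z * q z + poly (R z) (z $ i))"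
    if g: "hol_at x g" "depends_on I g" for g
  proof -
    obtain q R where q: "hol_at x q" and R: "hol_poly x i d R"
      and ev: "\<forall>\<^sub>F z in nhds x. g z = f k z * q z + poly (R z) (z $ i)"
      using E[OF g(1)] by blast
    have "\<forall>\<^sub>F z in nhds x. g (freeze I x z) = f k (freeze I x z) * q (freeze I x z) + poly (R (freeze I x z)) (freeze I x z $ i)"
      by (rule eventually_nhds_compose[OF isCont_freeze]) (use ev in simp)
    then have "\<forall>\<^sub>F z in nhds x. g z = f k z * q (freeze I x z) + poly (R (freeze I x z)) (z $ i)"
      using depends_on_freeze_eq[OF g(2)] depends_on_freeze_eq[OF f(2)[OF A(2)]] i by simp
    moreover have "hol_poly x i d (\<lambda>z. R (freeze I x z))"
      unfolding hol_poly_def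
      using hol_polyD[OF R] hol_at_freeze[of x "\<lambda>z. coeff (R z) _"] freeze_upd[OF i] by auto
    ultimately show ?thesis
      using hol_at_freeze[OF q] depends_on_freeze[of I q x] depends_on_freeze[of I R x]
      by (intro exI[of _ "\<lambda>z. q (freeze I x z)"] exI[of _ "\<lambda>z. R (freeze I x z)"]) auto
  qed
  have "hol_at x (\<lambda>z. (z $ i - x $ i) ^ d)" by (intro hol_at_intros)
  moreover have "depends_on I (\<lambda>z. (z $ i - x $ i) ^ d)"
    using depends_on_comp1[OF depends_on_component[OF i], of "\<lambda>c. (c - x $ i) ^ d"] .
  ultimately obtain t R where t: "hol_at x t" "depends_on I t" and R: "hol_poly x i d R" "depends_on I R"
    and tR: "\<forall>\<^sub>F z in nhds x. (z $ i - x $ i) ^ d = f k z * t z + poly (R z) (z $ i)"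
    using EI by blast
  \<comment> \<open>On the slice through \<open>x\<close> the division of the monomial reads
    \<open>s ^ d = s ^ d * u * t\<close> plus lower terms in \<open>s\<close>; comparing orders at 0
    gives \<open>u x * t x = 1\<close>.\<close>
  have t0: "t x \<noteq> 0"
  proof -
    let ?l = "\<lambda>s. upd x i (x $ i + s)"
    let ?\<phi> = "\<lambda>s. u (?l s) * t (?l s) - 1"
    have lx: "?l 0 = x" by simp
    have cont: "isCont (\<lambda>s. h (?l s)) 0" if "hol_at x h" for h :: "complex^'n \<Rightarrow> complex"
      by (rule isCont_o2[OF isCont_upd_param]) (use hol_at_isCont[OF that] in simp)
    have c\<phi>: "isCont ?\<phi> 0" by (intro continuous_intros cont u t)
    define c where "c l = coeff (pcompose (R x) [:x $ i, 1:]) l" for l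
    have Rx: "poly (R x) (x $ i + s) = (\<Sum>l<d. c l * s ^ l)" for s
      using deg_lt_poly[OF deg_lt_pcompose_linear[OF hol_polyD(3)[OF R(1), of x]], of "x $ i" s]
      by (simp add: c_def poly_pcompose)
    have "\<forall>\<^sub>F s in nhds 0. s ^ d = f k (?l s) * t (?l s) + poly (R (?l s)) (?l s $ i)"
    proof -
      have "\<forall>\<^sub>F s in nhds 0. (?l s $ i - x $ i) ^ d = f k (?l s) * t (?l s) + poly (R (?l s)) (?l s $ i)"
        by (rule eventually_nhds_compose[OF isCont_upd_param, where P = "\<lambda>z. (z $ i - x $ i) ^ d = f k z * t z + poly (R z) (z $ i)"])
          (use tR in simp)
      then show ?thesis by simp
    qed
    then have ev: "\<forall>\<^sub>F s in nhds 0. s ^ d * ?\<phi> s + (\<Sum>l<d. c l * s ^ l) = 0"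
      using line
    proof eventually_elim
      case (elim s)
      have "poly (R (?l s)) (?l s $ i) = (\<Sum>l<d. c l * s ^ l)"
        using Rx hol_polyD(2)[OF R(1)] by simp
      moreover have "s ^ d * ?\<phi> s = f k (?l s) * t (?l s) - s ^ d"
        unfolding elim(2) by (simp add: right_diff_distrib mult.assoc)
      ultimately have "s ^ d * ?\<phi> s + (\<Sum>l<d. c l * s ^ l)
          = (f k (?l s) * t (?l s) + poly (R (?l s)) (?l s $ i)) - s ^ d" by simp
      also have "\<dots> = 0" using elim(1) by (simp only: diff_self)
      finally show ?case .
    qed
    then have ev0: "\<forall>\<^sub>F s in at 0. s ^ d * ?\<phi> s + (\<Sum>l<d. c l * s ^ l) = 0"
      by (simp add: eventually_nhds_conv_at)
    have c0: "c l = 0" if "l < d" for l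
      by (rule power_times_plus_low_degree_zero[OF c\<phi> ev0 that])
    have "\<forall>\<^sub>F s in at 0. ?\<phi> s = 0"
      using ev0 eventually_neq_at_within[of 0 0 UNIV] by eventually_elim (simp add: c0)
    then have "?\<phi> \<midarrow>0\<rightarrow> 0" by (rule tendsto_eventually)
    moreover have "?\<phi> \<midarrow>0\<rightarrow> ?\<phi> 0" using c\<phi> by (simp only: isCont_def)
    ultimately have "?\<phi> 0 = 0" using LIM_unique by blast
    then show ?thesis by auto
  qed
  have "\<forall>\<alpha>\<in>A. \<exists>q R. hol_at x q \<and> depends_on I q \<and> hol_poly x i d R \<and> depends_on I R \<and>
        (\<forall>\<^sub>F z in nhds x. f \<alpha> z = f k z * q z + poly (R z) (z $ i))"
    using EI f by blast
  from bchoice[OF this] obtain q where "\<forall>\<alpha>\<in>A. \<exists>R. hol_at x (q \<alpha>) \<and> depends_on I (q \<alpha>) \<and> hol_poly x i d R \<and> depends_on I R \<and>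
        (\<forall>\<^sub>F z in nhds x. f \<alpha> z = f k z * q \<alpha> z + poly (R z) (z $ i))" ..
  from bchoice[OF this] obtain S where "\<forall>\<alpha>\<in>A. hol_at x (q \<alpha>) \<and> depends_on I (q \<alpha>) \<and> hol_poly x i d (S \<alpha>) \<and> depends_on I (S \<alpha>) \<and>
        (\<forall>\<^sub>F z in nhds x. f \<alpha> z = f k z * q \<alpha> z + poly (S \<alpha> z) (z $ i))" ..
  then have q: "\<And>\<alpha>. \<alpha> \<in> A \<Longrightarrow> hol_at x (q \<alpha>)" "\<And>\<alpha>. \<alpha> \<in> A \<Longrightarrow> depends_on I (q \<alpha>)"
    and S: "\<And>\<alpha>. \<alpha> \<in> A \<Longrightarrow> hol_poly x i d (S \<alpha>)" "\<And>\<alpha>. \<alpha> \<in> A \<Longrightarrow> depends_on I (S \<alpha>)"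
    and qS: "\<And>\<alpha>. \<alpha> \<in> A \<Longrightarrow> \<forall>\<^sub>F z in nhds x. f \<alpha> z = f k z * q \<alpha> z + poly (S \<alpha> z) (z $ i)"
    by auto
  define G where "G \<alpha> z = (if \<alpha> = k then [:- (x $ i), 1:] ^ d - R z else S \<alpha> z)" for \<alpha> z
  have "finite_relations I x A {()} (\<lambda>_ \<alpha> z. poly (G \<alpha> z) (z $ i))"
  proof (rule finite_relations_monic[OF several i A, where d = d])
    have "hol_poly x i (Suc d) (\<lambda>z. [:- (x $ i), 1:] ^ d - R z)"
      by (intro hol_poly_diff hol_poly_const deg_lt_linear_power hol_poly_mono[OF R(1)]) simp
    then show "hol_poly x i (Suc d) (G k)" by (simp add: G_def[abs_def])
    show "coeff (G k z) d = 1" for z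
      using hol_polyD(3)[OF R(1), of z] by (simp add: G_def deg_lt_linear_power deg_lt_def)
    show "hol_poly x i d (G \<alpha>)" if "\<alpha> \<in> A - {k}" for \<alpha>
      using S(1)[of \<alpha>] that by (simp add: G_def[abs_def])
    show "depends_on I (G \<alpha>)" if "\<alpha> \<in> A" for \<alpha>
      using S(2)[OF that] depends_on_comp1[OF R(2), of "\<lambda>p. [:- (x $ i), 1:] ^ d - p"]
      by (cases "\<alpha> = k") (simp_all add: G_def[abs_def])
  qed
  then show ?thesis
  proof (rule finite_relations_elementary_change[OF A _ _ _ t t0])
    show "hol_at x (q \<beta>)" "depends_on I (q \<beta>)" if "\<beta> \<in> A - {k}" for \<beta> using q that by auto
    show "\<forall>\<^sub>F z in nhds x. f \<beta> z = poly (G \<beta> z) (z $ i) + q \<beta> z * f k z" if "\<beta> \<in> A - {k}" for \<beta>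
      using qS[of \<beta>] that by (auto simp: G_def elim: eventually_mono)
    show "\<forall>\<^sub>F z in nhds x. poly (G k z) (z $ i) = t z * f k z"
      using tR by eventually_elim (simp add: G_def poly_power algebra_simps)
  qed
qed

section \<open>Shears, which turn a complex line into a coordinate direction\<close>

definition shear :: "'n \<Rightarrow> complex^'n \<Rightarrow> complex^'n \<Rightarrow> complex^'n" where
  "shear i w z = z + (z $ i) *s w"

lemma shear_nth [simp]: "shear i w z $ j = z $ j + z $ i * w $ j"
  by (simp add: shear_def)

lemma shear_inverse: "w $ i = 0 \<Longrightarrow> shear i (- w) (shear i w z) = z" "w $ i = 0 \<Longrightarrow> shear i w (shear i (- w) z) = z"
  by (simp_all add: vec_eq_iff)

lemma shear_has_derivative: "((shear i w) has_derivative (shear i w)) (at z)"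
proof -
  have "norm ((x $ i) *s w) \<le> norm x * norm w" for x
    by (simp add: norm_vector_smult Finite_Cartesian_Product.norm_nth_le mult_right_mono)
  then have "bounded_linear (\<lambda>z. (z $ i) *s w)"
    by (intro bounded_linear_intro[of _ "norm w"]) (auto simp: vec_eq_iff algebra_simps)
  then have "bounded_linear (shear i w)"
    unfolding shear_def[abs_def] by (intro bounded_linear_add bounded_linear_ident)
  then show ?thesis by (rule bounded_linear_imp_has_derivative)
qed

lemma shear_smult: "shear i w (c *s v) = c *s shear i w v"
  by (simp add: vec_eq_iff algebra_simps)

lemma isCont_shear: "isCont (shear i w) z"
  using has_derivative_continuous[OF shear_has_derivative] .

text \<open>A shear adds multiples of \<open>z $ i\<close> only, so with \<open>i\<close> in
  \<open>I\<close> no variable outside \<open>I\<close> is introduced.\<close>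

lemma depends_on_shear:
  assumes "depends_on I f" "i \<in> I"
  shows "depends_on I (\<lambda>z. f (shear i w z))"
  unfolding depends_on_def using assms(2) by (auto intro!: depends_onD[OF assms(1)])

lemma finite_relations_shear:
  fixes f :: "nat \<Rightarrow> complex^'n \<Rightarrow> complex"
  assumes i: "i \<in> I" and w: "w $ i = 0"
    and fr: "finite_relations I (shear i (- w) x) A {()} (\<lambda>_ \<alpha> z. f \<alpha> (shear i w z))"
  shows "finite_relations I x A {()} (\<lambda>_. f)"
proof -
  let ?L = "shear i w" and ?M = "shear i (- w)"
  obtain J :: "nat set" and \<rho> where g: "generators I (?M x) A {()} (\<lambda>_ \<alpha> z. f \<alpha> (?L z)) J \<rho>"
    using fr unfolding finite_relations_def by blast
  have LM: "?L (?M z) = z" "?M (?L z) = z" for z using shear_inverse[OF w] by auto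
  have hM: "hol_at y (\<lambda>z. h (?M z))" if "hol_at (?M y) h" for h :: "complex^'n \<Rightarrow> complex" and y
    by (rule hol_at_compose[OF that shear_has_derivative shear_smult])
  have hL: "hol_at (?M y) (\<lambda>z. h (?L z))" if "hol_at y h" for h :: "complex^'n \<Rightarrow> complex" and y
    by (rule hol_at_compose[OF _ shear_has_derivative shear_smult]) (use that LM in simp)
  have evM: "\<forall>\<^sub>F z in nhds y. P (?M z)" if "\<forall>\<^sub>F z in nhds (?M y). P z" for P y
    by (rule eventually_nhds_compose[OF isCont_shear that])
  have evL: "\<forall>\<^sub>F z in nhds (?M y). P (?L z)" if "\<forall>\<^sub>F z in nhds y. P z" for P y
    by (rule eventually_nhds_compose[OF isCont_shear]) (use that LM in simp)
  have "generators I x A {()} (\<lambda>_. f) J (\<lambda>j \<alpha> z. \<rho> j \<alpha> (?M z))"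
    unfolding generators_def
  proof (intro conjI ballI)
    fix j assume j: "j \<in> J"
    have "\<forall>\<^sub>F z in nhds (?M x). (\<Sum>\<alpha>\<in>A. \<rho> j \<alpha> z * f \<alpha> (?L z)) = 0"
      using generatorsE(2)[OF g j] by (simp add: relation_at_def)
    from evM[OF this] show "relation_at A {()} (\<lambda>_. f) x (\<lambda>\<alpha> z. \<rho> j \<alpha> (?M z))"
      using generatorsE(3)[OF g j] by (auto simp: relation_at_unit LM intro: hM)
    show "depends_on I (\<lambda>z. \<rho> j \<alpha> (?M z))" if "\<alpha> \<in> A" for \<alpha>
      by (rule depends_on_shear[OF generatorsE(4)[OF g j that] i])
  next
    show "\<forall>\<^sub>F y in nhds x. \<forall>a. relation_at A {()} (\<lambda>_. f) y a \<longrightarrow> combination_at A J (\<lambda>j \<alpha> z. \<rho> j \<alpha> (?M z)) y a"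
      using evM[OF generatorsE(5)[OF g]]
    proof eventually_elim
      case (elim y)
      show ?case
      proof (intro allI impI)
        fix a assume "relation_at A {()} (\<lambda>_. f) y a"
        then have a: "\<forall>\<alpha>\<in>A. hol_at y (a \<alpha>)" "\<forall>\<^sub>F z in nhds y. (\<Sum>\<alpha>\<in>A. a \<alpha> z * f \<alpha> z) = 0"
          by (auto simp: relation_at_unit)
        have "relation_at A {()} (\<lambda>_ \<alpha> z. f \<alpha> (?L z)) (?M y) (\<lambda>\<alpha> z. a \<alpha> (?L z))"
          using a(1) evL[OF a(2)] by (auto simp: relation_at_unit intro: hL)
        then have "combination_at A J \<rho> (?M y) (\<lambda>\<alpha> z. a \<alpha> (?L z))" using elim by blast
        then obtain \<gamma> where \<gamma>: "\<forall>j\<in>J. hol_at (?M y) (\<gamma> j)"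
          "\<forall>\<alpha>\<in>A. \<forall>\<^sub>F z in nhds (?M y). a \<alpha> (?L z) = (\<Sum>j\<in>J. \<gamma> j z * \<rho> j \<alpha> z)"
          unfolding combination_at_def by blast
        show "combination_at A J (\<lambda>j \<alpha> z. \<rho> j \<alpha> (?M z)) y a"
          unfolding combination_at_def
        proof (intro exI[of _ "\<lambda>j z. \<gamma> j (?M z)"] conjI ballI)
          show "hol_at y (\<lambda>z. \<gamma> j (?M z))" if "j \<in> J" for j using \<gamma>(1) that by (intro hM) auto
          show "\<forall>\<^sub>F z in nhds y. a \<alpha> z = (\<Sum>j\<in>J. \<gamma> j (?M z) * \<rho> j \<alpha> (?M z))" if "\<alpha> \<in> A" for \<alpha>
            using evM[OF bspec[OF \<gamma>(2) that]] by (simp add: LM)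
        qed
      qed
    qed
  qed (rule generatorsE(1)[OF g])
  then show ?thesis by (rule finite_relationsI)
qed

text \<open>An elementary change with the factor \<open>inverse (f k)\<close> turns the family into
  the unit vector at \<open>k\<close>, whose relations are those with vanishing \<open>k\<close>-th
  coefficient.\<close>

lemma finite_relations_unit:
  fixes f :: "nat \<Rightarrow> complex^'n \<Rightarrow> complex"
  assumes A: "finite A" "k \<in> A" and f: "\<And>\<alpha>. \<alpha> \<in> A \<Longrightarrow> hol_at x (f \<alpha>)" "\<And>\<alpha>. \<alpha> \<in> A \<Longrightarrow> depends_on I (f \<alpha>)"
    and k: "f k x \<noteq> 0"
  shows "finite_relations I x A {()} (\<lambda>_. f)"
proof -
  define F where "F \<alpha> = (\<lambda>z :: complex^'n. if \<alpha> = k then 1 else 0 :: complex)" for \<alpha>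
  have sumF: "(\<Sum>\<alpha>\<in>A. c \<alpha> * F \<alpha> z) = c k" for c z
    using A by (simp add: F_def if_distrib cong: if_cong)
  let ?e = "\<lambda>\<beta> \<alpha> z. if \<alpha> = \<beta> then 1 else 0 :: complex"
  have "generators I x A {()} (\<lambda>_. F) (A - {k}) ?e"
    unfolding generators_def
  proof (intro conjI ballI always_eventually allI impI)
    show "relation_at A {()} (\<lambda>_. F) x (?e \<beta>)" if "\<beta> \<in> A - {k}" for \<beta>
      using that unfolding relation_at_unit sumF by auto
    fix y a assume a: "relation_at A {()} (\<lambda>_. F) y a"
    then have ak: "\<forall>\<^sub>F z in nhds y. a k z = 0" unfolding relation_at_unit sumF by blast
    show "combination_at A (A - {k}) ?e y a"
      unfolding combination_at_def
    proof (intro exI[of _ a] conjI ballI)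
      show "hol_at y (a j)" if "j \<in> A - {k}" for j using a that by (simp add: relation_at_unit)
      show "\<forall>\<^sub>F z in nhds y. a \<alpha> z = (\<Sum>\<beta>\<in>A - {k}. a \<beta> z * ?e \<beta> \<alpha> z)" if "\<alpha> \<in> A" for \<alpha>
        using ak by eventually_elim (use A that in \<open>auto simp: if_distrib cong: if_cong\<close>)
    qed
  qed (use A in auto)
  then have FF: "finite_relations I x A {()} (\<lambda>_. F)" by (rule finite_relationsI)
  have hk: "hol_at x (\<lambda>z. inverse (f k z))" by (rule hol_at_inverse[OF f(1)[OF A(2)] k])
  have dk: "depends_on I (\<lambda>z. inverse (f k z))" by (rule depends_on_comp1[OF f(2)[OF A(2)]])
  have nz: "\<forall>\<^sub>F z in nhds x. f k z \<noteq> 0" by (rule hol_at_nonzero_nhds[OF f(1)[OF A(2)] k])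
  show ?thesis
  proof (rule finite_relations_elementary_change[OF A FF _ _ hk dk])
    fix \<beta> assume \<beta>: "\<beta> \<in> A - {k}"
    show "hol_at x (\<lambda>z. f \<beta> z * inverse (f k z))" using f(1)[of \<beta>] \<beta> hk by (intro hol_at_mult) auto
    show "depends_on I (\<lambda>z. f \<beta> z * inverse (f k z))" using f(2)[of \<beta>] \<beta> dk by (intro depends_on_mult) auto
    show "\<forall>\<^sub>F z in nhds x. f \<beta> z = F \<beta> z + f \<beta> z * inverse (f k z) * f k z"
      using nz by eventually_elim (use \<beta> in \<open>simp add: F_def\<close>)
  next
    show "inverse (f k x) \<noteq> 0" using k by simp
    show "\<forall>\<^sub>F z in nhds x. F k z = inverse (f k z) * f k z"
      using nz by eventually_elim (simp add: F_def)
  qed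
qed

text \<open>Without variables the functions are constant, so only the first two cases occur: this is
  the base of the induction. In the third case the vanishing of \<open>f k\<close> at
  \<open>x\<close> ensures that the direction \<open>v\<close> is nonzero.\<close>

theorem finite_relations_holomorphic:
  fixes f :: "nat \<Rightarrow> complex^'n \<Rightarrow> complex"
  assumes "finite A" "\<And>\<alpha>. \<alpha> \<in> A \<Longrightarrow> hol_at x (f \<alpha>) \<and> depends_on I (f \<alpha>)"
  shows "finite_relations I x A {()} (\<lambda>_. f)"
  using assms
proof (induction "card I" arbitrary: I x A f rule: less_induct)
  case less
  have hf: "\<And>\<alpha>. \<alpha> \<in> A \<Longrightarrow> hol_at x (f \<alpha>)" and df: "\<And>\<alpha>. \<alpha> \<in> A \<Longrightarrow> depends_on I (f \<alpha>)"
    using less.prems by auto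
  consider (zero) "\<forall>\<alpha>\<in>A. \<forall>\<^sub>F z in nhds x. f \<alpha> z = 0" | (unit) k where "k \<in> A" "f k x \<noteq> 0"
    | (main) k where "k \<in> A" "f k x = 0" "\<not> (\<forall>\<^sub>F z in nhds x. f k z = 0)"
    by blast
  then show ?case
  proof cases
    case zero
    then show ?thesis
      by (intro finite_relationsI[OF generators_no_equation[OF less.prems(1)]]) auto
  next
    case unit
    then show ?thesis by (intro finite_relations_unit[where k = k, OF less.prems(1)]) (use hf df in auto)
  next
    case main
    obtain U where U: "open U" "x \<in> U" "holomorphic_map U (f k)"
      using hf[OF main(1)] unfolding hol_at_def by blast
    obtain r where r: "r > 0" "ball x r \<subseteq> U" using U open_contains_ball by blast
    have hol: "holomorphic_map (ball x r) (f k)" using holomorphic_map_subset[OF U(3) r(2)] .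
    \<comment> \<open>\<open>f k\<close> ignores the coordinates outside \<open>I\<close>, so a
      point where it is nonzero may be frozen to those of \<open>x\<close>; the direction from
      \<open>x\<close> to that point then involves \<open>I\<close> only.\<close>
    have fb: "\<forall>\<^sub>F z in nhds x. freeze I x z \<in> ball x r"
      by (rule eventually_nhds_compose[OF isCont_freeze]) (use r eventually_nhds_in_open[of "ball x r" x] in simp)
    have "\<not> (\<forall>z. freeze I x z \<in> ball x r \<longrightarrow> f k z = 0)"
    proof
      assume all: "\<forall>z. freeze I x z \<in> ball x r \<longrightarrow> f k z = 0"
      have "\<forall>\<^sub>F z in nhds x. f k z = 0" using fb by eventually_elim (use all in blast)
      then show False using main(3) by blast
    qed
    then obtain z where z: "freeze I x z \<in> ball x r" "f k z \<noteq> 0" by blast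
    define v where "v = freeze I x z - x"
    have xv: "x + v = freeze I x z" by (simp add: v_def)
    have fv: "f k (x + v) \<noteq> 0"
      using z(2) depends_on_freeze_eq[OF df[OF main(1)]] by (simp add: xv)
    then have "v \<noteq> 0" using main(2) by auto
    then obtain i where vi: "v $ i \<noteq> 0" by (auto simp: vec_eq_iff)
    then have i: "i \<in> I" by (auto simp: v_def split: if_splits)
    \<comment> \<open>Chosen so that the shear sends the \<open>i\<close>-th unit vector to
      \<open>v\<close> divided by \<open>v $ i\<close>.\<close>
    define w where "w = (\<chi> j. if j = i then 0 else v $ j / v $ i)"
    have w: "w $ i = 0" by (simp add: w_def)
    define x' where "x' = shear i (- w) x"
    have x': "shear i w x' = x" using shear_inverse(2)[OF w] by (simp add: x'_def)
    have line: "shear i w (upd x' i (x' $ i + s)) = x + (s / v $ i) *s v" for s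
    proof -
      have "shear i w (upd x' i (x' $ i + s)) $ j = (x + (s / v $ i) *s v) $ j" for j
        using vi by (cases "j = i") (simp_all add: x'_def w_def algebra_simps add_divide_distrib)
      then show ?thesis by (simp add: vec_eq_iff)
    qed
    \<comment> \<open>The sheared axis is the line from \<open>x\<close> towards
      \<open>x + v\<close>; vanishing near \<open>x\<close> on it would spread to
      \<open>x + v\<close> by the identity theorem.\<close>
    have reg: "\<not> (\<forall>\<^sub>F s in nhds 0. f k (shear i w (upd x' i (x' $ i + s))) = 0)"
    proof
      assume "\<forall>\<^sub>F s in nhds 0. f k (shear i w (upd x' i (x' $ i + s))) = 0"
      then have ev: "\<forall>\<^sub>F s in nhds 0. f k (x + (s / v $ i) *s v) = 0" by (simp add: line)
      have "\<forall>\<^sub>F t in nhds 0. f k (x + (t * v $ i / v $ i) *s v) = 0"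
        by (rule eventually_nhds_compose[where L = "\<lambda>t. t * v $ i" and x = 0, OF _ _]) (use ev in \<open>auto intro!: continuous_intros\<close>)
      then have "\<forall>\<^sub>F t in nhds 0. f k (x + t *s v) = 0" using vi by simp
      then have "f k (x + v) = 0"
        by (intro holomorphic_line_identity[OF hol]) (use r z(1) xv in auto)
      then show False using fv by simp
    qed
    have "finite_relations I x' A {()} (\<lambda>_ \<alpha> z. f \<alpha> (shear i w z))"
    proof (rule finite_relations_regular[where f = "\<lambda>\<alpha> z. f \<alpha> (shear i w z)", OF _ i less.prems(1) main(1) _ _ reg])
      fix B :: "(nat \<times> nat) set" and R :: "nat set" and g :: "nat \<Rightarrow> nat \<times> nat \<Rightarrow> complex^'n \<Rightarrow> complex"
      assume g: "finite B" "finite R"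
        "\<And>r \<beta>. r \<in> R \<Longrightarrow> \<beta> \<in> B \<Longrightarrow> hol_at x' (g r \<beta>) \<and> depends_on (I - {i}) (g r \<beta>)"
      have "card (I - {i}) < card I" using i by (intro psubset_card_mono) auto
      from less.hyps[OF this] show "finite_relations (I - {i}) x' B R g"
        by (rule finite_relations_polymorphic[OF _ g(2,1,3)])
    next
      show "hol_at x' (\<lambda>z. f \<alpha> (shear i w z))" if "\<alpha> \<in> A" for \<alpha>
        by (rule hol_at_compose[OF _ shear_has_derivative shear_smult]) (use hf[OF that] x' in simp)
      show "depends_on I (\<lambda>z. f \<alpha> (shear i w z))" if "\<alpha> \<in> A" for \<alpha>
        by (rule depends_on_shear[OF df[OF that] i])
    qed
    then show ?thesis
      unfolding x'_def by (rule finite_relations_shear[OF i w])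
  qed
qed

section \<open>Functionals on Banach spaces\<close>

text \<open>Partial functionals are represented by graphs, that is subspaces of the product with the
  reals. Extension is then inclusion and the upper bound of a chain is its union; domination by the
  norm already forces such a graph to be single valued.\<close>

lemma maximal_dominated_graph:
  fixes v :: "'e::real_normed_vector"
  obtains M :: "('e \<times> real) set" where "subspace M" "(v, norm v) \<in> M" "\<And>x a. (x, a) \<in> M \<Longrightarrow> a \<le> norm x"
    "\<And>N. subspace N \<Longrightarrow> (\<And>x a. (x, a) \<in> N \<Longrightarrow> a \<le> norm x) \<Longrightarrow> M \<subseteq> N \<Longrightarrow> N = M"
proof -
  define P where "P G \<longleftrightarrow> subspace G \<and> (v, norm v) \<in> G \<and> (\<forall>(x, a)\<in>G. a \<le> norm x)" for G :: "('e \<times> real) set"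
  have "\<exists>M\<in>Collect P. \<forall>X\<in>Collect P. M \<subseteq> X \<longrightarrow> X = M"
  proof (rule subset_Zorn_nonempty)
    have "P (span {(v, norm v)})"
    proof -
      have "a \<le> norm x" if "(x, a) \<in> span {(v, norm v)}" for x a
        using that by (auto simp: span_singleton mult_right_mono)
      then show ?thesis unfolding P_def by (auto intro: span_base subspace_span)
    qed
    then show "Collect P \<noteq> {}" by blast
  next
    fix C assume C: "C \<noteq> {}" "subset.chain (Collect P) C"
    then have PC: "\<And>G. G \<in> C \<Longrightarrow> P G" and tot: "\<And>G H. G \<in> C \<Longrightarrow> H \<in> C \<Longrightarrow> G \<subseteq> H \<or> H \<subseteq> G"
      unfolding subset.chain_def by auto
    have sub: "\<And>G. G \<in> C \<Longrightarrow> subspace G" using PC by (simp add: P_def)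
    have "subspace (\<Union>C)"
    proof (rule subspaceI)
      obtain G where "G \<in> C" using C by blast
      then show "0 \<in> \<Union>C" using sub subspace_0 by blast
    next
      fix x y assume "x \<in> \<Union>C" "y \<in> \<Union>C"
      then obtain G H where "G \<in> C" "H \<in> C" "x \<in> G" "y \<in> H" by blast
      then obtain K where "K \<in> C" "x \<in> K" "y \<in> K" using tot[of G H] by blast
      then show "x + y \<in> \<Union>C" using sub subspace_add by blast
    next
      fix c x assume "x \<in> \<Union>C"
      then show "c *\<^sub>R x \<in> \<Union>C" using sub subspace_scale by blast
    qed
    moreover have "(v, norm v) \<in> \<Union>C" using C PC unfolding P_def by blast
    moreover have "\<forall>(x, a)\<in>\<Union>C. a \<le> norm x" using PC unfolding P_def by blast
    ultimately show "\<Union>C \<in> Collect P" by (simp add: P_def)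
  qed
  then obtain M where M: "P M" "\<And>X. P X \<Longrightarrow> M \<subseteq> X \<Longrightarrow> X = M" by blast
  show thesis
  proof (rule that[of M])
    show "N = M" if "subspace N" "\<And>x a. (x, a) \<in> N \<Longrightarrow> a \<le> norm x" "M \<subseteq> N" for N
      using that M(1) by (intro M(2)) (auto simp: P_def)
  qed (use M(1) in \<open>auto simp: P_def\<close>)
qed

text \<open>The one-dimensional step of Hahn-Banach: \<open>c\<close> must lie above all
  \<open>a - norm (y - x)\<close> and below all \<open>norm (z + x) - b\<close>, which is possible
  by the triangle inequality. General \<open>t\<close> follows by scaling.\<close>

lemma dominated_extension_value:
  fixes M :: "('e::real_normed_vector \<times> real) set"
  assumes M: "subspace M" and dom: "\<And>y a. (y, a) \<in> M \<Longrightarrow> a \<le> norm y"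
  obtains c where "\<And>y a t. (y, a) \<in> M \<Longrightarrow> a + t * c \<le> norm (y + t *\<^sub>R x)"
proof -
  define S where "S = {a - norm (y - x) | y a. (y, a) \<in> M}"
  have le: "a - norm (y - x) \<le> norm (z + x) - b" if "(y, a) \<in> M" "(z, b) \<in> M" for y a z b
  proof -
    have "(y + z, a + b) \<in> M" using subspace_add[OF M that] by simp
    then have "a + b \<le> norm ((y - x) + (z + x))" using dom by fastforce
    also have "\<dots> \<le> norm (y - x) + norm (z + x)" by (rule norm_triangle_ineq)
    finally show ?thesis by simp
  qed
  have M0: "(0, 0) \<in> M" using subspace_0[OF M] by (simp add: zero_prod_def)
  then have ne: "S \<noteq> {}" by (auto simp: S_def)
  have bdd: "bdd_above S" using le[OF _ M0] by (intro bdd_aboveI[of _ "norm (0 + x) - 0"]) (auto simp: S_def)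
  define c where "c = Sup S"
  have c1: "a - norm (y - x) \<le> c" if "(y, a) \<in> M" for y a
    unfolding c_def using that by (intro cSup_upper bdd) (auto simp: S_def)
  have c2: "c \<le> norm (z + x) - b" if "(z, b) \<in> M" for z b
    unfolding c_def using le that by (intro cSup_least ne) (auto simp: S_def)
  show thesis
  proof (rule that[of c])
    fix y :: 'e and a t :: real assume ya: "(y, a) \<in> M"
    have sc: "((1 / s) *\<^sub>R y, (1 / s) * a) \<in> M" for s using subspace_scale[OF M ya, of "1 / s"] by simp
    have scale: "s * norm w = norm (s *\<^sub>R w)" if "s > 0" for s and w :: 'e using that by simp
    consider "t = 0" | "t > 0" | "t < 0" by linarith
    then show "a + t * c \<le> norm (y + t *\<^sub>R x)"
    proof cases
      case 1
      then show ?thesis using dom[OF ya] by simp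
    next
      case 2
      have "t * c \<le> t * (norm ((1 / t) *\<^sub>R y + x) - (1 / t) * a)"
        using c2[OF sc[of t]] 2 by (intro mult_left_mono) auto
      also have "\<dots> = norm (t *\<^sub>R ((1 / t) *\<^sub>R y + x)) - a"
        using 2 scale[OF 2] by (simp add: right_diff_distrib)
      also have "t *\<^sub>R ((1 / t) *\<^sub>R y + x) = y + t *\<^sub>R x" using 2 by (simp add: scaleR_add_right)
      finally show ?thesis by simp
    next
      case 3
      define s where "s = - t"
      have s: "s > 0" using 3 by (simp add: s_def)
      have e1: "s * ((1 / s) * a - norm ((1 / s) *\<^sub>R y - x)) \<le> s * c"
        using c1[OF sc[of s]] s by (intro mult_left_mono) auto
      have e2: "s * ((1 / s) * a - norm ((1 / s) *\<^sub>R y - x)) = a - norm (s *\<^sub>R ((1 / s) *\<^sub>R y - x))"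
        using s scale[OF s] by (simp add: right_diff_distrib)
      have e3: "s *\<^sub>R ((1 / s) *\<^sub>R y - x) = y + t *\<^sub>R x"
        using s by (simp add: scaleR_diff_right s_def)
      have "a - norm (y + t *\<^sub>R x) \<le> s * c" using e1 unfolding e2 e3 .
      moreover have "t * c = - (s * c)" by (simp add: s_def)
      ultimately show ?thesis by linarith
    qed
  qed
qed

text \<open>A maximal graph is defined everywhere, since otherwise a line could be added, and it has
  the value \<open>norm v\<close> at \<open>v\<close>. Domination at \<open>x\<close> and at
  \<open>- x\<close> makes the functional bounded.\<close>

lemma real_functional_separates:
  fixes v :: "'e::real_normed_vector"
  assumes "v \<noteq> 0"
  obtains u :: "'e \<Rightarrow> real" where "bounded_linear u" "u v \<noteq> 0"
proof -
  obtain M :: "('e \<times> real) set" where M: "subspace M" "(v, norm v) \<in> M"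
    and dom: "\<And>x a. (x, a) \<in> M \<Longrightarrow> a \<le> norm x"
    and max: "\<And>N. subspace N \<Longrightarrow> (\<And>x a. (x, a) \<in> N \<Longrightarrow> a \<le> norm x) \<Longrightarrow> M \<subseteq> N \<Longrightarrow> N = M"
    using maximal_dominated_graph[of v] by blast
  have unique: "a = b" if "(x, a) \<in> M" "(x, b) \<in> M" for x a b
  proof -
    have "(0, a - b) \<in> M" "(0, b - a) \<in> M"
      using subspace_diff[OF M(1) that] subspace_diff[OF M(1) that(2,1)] by auto
    then show ?thesis using dom[of 0 "a - b"] dom[of 0 "b - a"] by simp
  qed
  have total: "\<exists>a. (x, a) \<in> M" for x
  proof -
    obtain c where c: "\<And>y a t. (y, a) \<in> M \<Longrightarrow> a + t * c \<le> norm (y + t *\<^sub>R x)"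
      using dominated_extension_value[OF M(1) dom] by metis
    \<comment> \<open>The graph extended along \<open>x\<close> by the value \<open>c\<close>;
      maximality makes it equal to \<open>M\<close>, so \<open>x\<close> was in the domain
      already.\<close>
    define N where "N = {p + q | p q. p \<in> M \<and> q \<in> span {(x, c)}}"
    have "subspace N" unfolding N_def by (rule subspace_sums[OF M(1) subspace_span])
    moreover have "a \<le> norm y" if "(y, a) \<in> N" for y a
      using that c by (auto simp: N_def span_singleton)
    moreover have "M \<subseteq> N" 
    proof
      fix p assume "p \<in> M"
      then have "p + 0 \<in> N" unfolding N_def using span_zero by blast
      then show "p \<in> N" by simp
    qed
    ultimately have "N = M" by (rule max)
    moreover have "0 + (x, c) \<in> N"
      unfolding N_def using subspace_0[OF M(1)] span_base[of "(x, c)" "{(x, c)}"] by blast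
    ultimately show ?thesis by auto
  qed
  define u where "u x = (SOME a. (x, a) \<in> M)" for x
  have uM: "(x, u x) \<in> M" for x unfolding u_def using total by (rule someI_ex)
  have "u (x + y) = u x + u y" for x y
    using unique[OF uM] subspace_add[OF M(1) uM uM, of x y] by simp
  moreover have sc: "u (r *\<^sub>R x) = r *\<^sub>R u x" for r x
    using unique[OF uM] subspace_scale[OF M(1) uM, of r x] by simp
  moreover have "norm (u x) \<le> norm x * 1" for x
    using dom[OF uM, of x] dom[OF uM, of "- x"] sc[of "-1" x] by simp
  ultimately have "bounded_linear u" by (rule bounded_linear_intro)
  moreover have "u v = norm v" using unique[OF uM M(2)] .
  ultimately show thesis using that assms by simp
qed

section \<open>Complex functionals from real ones\<close>

lemma scaleC_Re_Im: "c *\<^sub>C (x::'e::complex_banach) = Re c *\<^sub>R x + Im c *\<^sub>R (\<i> *\<^sub>C x)"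
proof -
  have "c = complex_of_real (Re c) + complex_of_real (Im c) * \<i>" by (simp add: complex_eq_iff)
  then have "c *\<^sub>C x = (complex_of_real (Re c) + complex_of_real (Im c) * \<i>) *\<^sub>C x" by simp
  then show ?thesis by (simp only: scaleC_add_left scaleR_scaleC scaleC_scaleC)
qed

lemma complex_functional_separates:
  fixes v :: "'e::complex_banach"
  assumes "v \<noteq> 0"
  obtains l :: "'e \<Rightarrow> complex" where "bounded_linear l" "\<And>c x. l (c *\<^sub>C x) = c * l x" "l v \<noteq> 0"
proof -
  obtain u :: "'e \<Rightarrow> real" where u: "bounded_linear u" "u v \<noteq> 0"
    using real_functional_separates[OF assms] by blast
  interpret u: bounded_linear u by fact
  \<comment> \<open>The complex functional with real part \<open>u\<close>: complex linearity
    dictates \<open>Im (l x) = - Re (l (\<i> *\<^sub>C x))\<close>.\<close>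
  define l where "l x = complex_of_real (u x) - \<i> * complex_of_real (u (\<i> *\<^sub>C x))" for x
  have bi: "bounded_linear (\<lambda>x::'e. \<i> *\<^sub>C x)"
    by (rule bounded_bilinear.bounded_linear_right[OF bounded_bilinear_scaleC])
  have "bounded_linear l"
    unfolding l_def[abs_def]
    by (intro bounded_linear_sub bounded_linear_const_mult bounded_linear_compose[OF bounded_linear_of_real]
        bounded_linear_compose[OF u(1)] bounded_linear_ident bi)
  moreover have "l (c *\<^sub>C x) = c * l x" for c x
  proof -
    have ii: "\<i> *\<^sub>C \<i> *\<^sub>C x = - x"
      using scaleR_scaleC[of "-1" x] by (simp add: scaleC_scaleC)
    have "u (c *\<^sub>C x) = Re c * u x + Im c * u (\<i> *\<^sub>C x)"
      by (subst scaleC_Re_Im) (simp add: u.add u.scaleR)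
    moreover have "u (\<i> *\<^sub>C c *\<^sub>C x) = Re c * u (\<i> *\<^sub>C x) - Im c * u x"
    proof -
      have "\<i> *\<^sub>C c *\<^sub>C x = c *\<^sub>C (\<i> *\<^sub>C x)" by (simp add: scaleC_scaleC mult.commute)
      also have "u \<dots> = Re c * u (\<i> *\<^sub>C x) - Im c * u x"
        by (subst scaleC_Re_Im) (simp add: u.add u.diff u.scaleR linear_neg[OF u.linear] ii)
      finally show ?thesis .
    qed
    ultimately show ?thesis by (simp add: l_def complex_eq_iff algebra_simps)
  qed
  moreover have "l v \<noteq> 0" using u(2) by (simp add: l_def complex_eq_iff)
  ultimately show thesis using that by blast
qed

section \<open>Elimination in Banach valued relations\<close>

lemma nonzero_holomorphic_nowhere_locally_zero:
  fixes h :: "complex^'n \<Rightarrow> complex"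
  assumes h: "holomorphic_map (ball x r) h" and z: "z \<in> ball x r" "h z \<noteq> 0" and y: "y \<in> ball x r"
  shows "\<not> (\<forall>\<^sub>F w in nhds y. h w = 0)"
proof
  assume ev: "\<forall>\<^sub>F w in nhds y. h w = 0"
  have "isCont (\<lambda>t. y + t *s (z - y)) 0"
    by (intro continuous_intros linear_continuous_at bounded_linear_smult_left)
  then have "\<forall>\<^sub>F t in nhds 0. h (y + t *s (z - y)) = 0"
    by (rule eventually_nhds_compose) (use ev in simp)
  then have "h (y + (z - y)) = 0"
    by (intro holomorphic_line_identity[OF h]) (use y z in auto)
  then show False using z by simp
qed

text \<open>One step of Gaussian elimination without fractions, with pivot \<open>l (g k)\<close>.
  Up to cancelling the pivot, a relation amounts to one scalar equation and a relation among the
  vectors \<open>l (g k) *\<^sub>C g \<alpha> - l (g \<alpha>) *\<^sub>C g k\<close>, which are one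
  fewer.\<close>

lemma elimination_identity:
  fixes g :: "'a \<Rightarrow> 'e::complex_banach" and l :: "'e \<Rightarrow> complex"
  assumes "finite A" "k \<notin> A"
  shows "l (g k) *\<^sub>C (\<Sum>\<alpha>\<in>insert k A. a \<alpha> *\<^sub>C g \<alpha>)
    = (\<Sum>\<alpha>\<in>A. a \<alpha> *\<^sub>C (l (g k) *\<^sub>C g \<alpha> - l (g \<alpha>) *\<^sub>C g k)) + (\<Sum>\<alpha>\<in>insert k A. a \<alpha> * l (g \<alpha>)) *\<^sub>C g k"
proof -
  note dr = bounded_bilinear.diff_right[OF bounded_bilinear_scaleC]
  note sl = bounded_bilinear.sum_left[OF bounded_bilinear_scaleC]
  note sr = bounded_bilinear.sum_right[OF bounded_bilinear_scaleC]
  show ?thesis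
    using assms by (simp add: dr sl sr scaleC_add_left scaleC_add_right scaleC_scaleC sum_subtractf mult.commute)
qed

text \<open>As in \<open>generators\<close>, one system fixed at \<open>x\<close> must describe the
  relations at every \<open>y\<close> near \<open>x\<close>.\<close>

definition scalar_system :: "complex^'n \<Rightarrow> 'a set \<Rightarrow> ('a \<Rightarrow> complex^'n \<Rightarrow> 'e::complex_banach) \<Rightarrow> 'r set
    \<Rightarrow> ('r \<Rightarrow> 'a \<Rightarrow> complex^'n \<Rightarrow> complex) \<Rightarrow> bool" where
  "scalar_system x A g R f \<longleftrightarrow> finite R \<and> (\<forall>r\<in>R. \<forall>\<alpha>\<in>A. hol_at x (f r \<alpha>)) \<and>
    (\<forall>\<^sub>F y in nhds x. \<forall>a. (\<forall>\<alpha>\<in>A. hol_at y (a \<alpha>)) \<longrightarrow>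
       (\<forall>\<^sub>F z in nhds y. (\<Sum>\<alpha>\<in>A. a \<alpha> z *\<^sub>C g \<alpha> z) = 0) = relation_at A R f y a)"

lemma scalar_systemD:
  assumes "scalar_system x A g R f"
  shows "finite R" "\<forall>r\<in>R. \<forall>\<alpha>\<in>A. hol_at x (f r \<alpha>)"
    "\<forall>\<^sub>F y in nhds x. \<forall>a. (\<forall>\<alpha>\<in>A. hol_at y (a \<alpha>)) \<longrightarrow>
       (\<forall>\<^sub>F z in nhds y. (\<Sum>\<alpha>\<in>A. a \<alpha> z *\<^sub>C g \<alpha> z) = 0) = relation_at A R f y a"
  using assms[unfolded scalar_system_def, THEN conjunct1]
    assms[unfolded scalar_system_def, THEN conjunct2, THEN conjunct1]
    assms[unfolded scalar_system_def, THEN conjunct2, THEN conjunct2] .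

text \<open>Eliminating one vector at a time by a functional turns a relation between Banach valued functions
  into finitely many scalar equations. The converse holds off the zero set of the pivot, hence everywhere
  by continuity.\<close>

lemma banach_relations_scalar:
  fixes g :: "'a \<Rightarrow> complex^'n \<Rightarrow> 'e::complex_banach"
  assumes "finite A" "\<And>\<alpha>. \<alpha> \<in> A \<Longrightarrow> hol_at x (g \<alpha>)"
  shows "\<exists>(R :: nat set) f. scalar_system x A g R f"
  using assms
proof (induction A arbitrary: g rule: finite_induct)
  case empty
  show ?case by (intro exI[of _ "{}"]) (simp add: relation_at_def scalar_system_def)
next
  case (insert k A)
  let ?I = "insert k A"
  have gk: "hol_at x (g k)" and gA: "\<And>\<alpha>. \<alpha> \<in> A \<Longrightarrow> hol_at x (g \<alpha>)" using insert.prems by auto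
  have ext: "relation_at ?I R (\<lambda>r \<alpha> z. if \<alpha> = k then 0 else f r \<alpha> z) y a \<longleftrightarrow> relation_at A R f y a"
    if "hol_at y (a k)" for R :: "'r set" and f :: "'r \<Rightarrow> 'a \<Rightarrow> complex^'n \<Rightarrow> complex" and y a
  proof -
    have "(\<Sum>\<alpha>\<in>A. a \<alpha> z * (if \<alpha> = k then 0 else f r \<alpha> z)) = (\<Sum>\<alpha>\<in>A. a \<alpha> z * f r \<alpha> z)" for r z
      using insert.hyps(2) by (intro sum.cong) auto
    then show ?thesis using insert.hyps that by (simp add: relation_at_def)
  qed
  have ext_hol: "hol_at x (\<lambda>z. if \<alpha> = k then 0 else f \<alpha> z)"
    if "\<alpha> \<in> ?I" "\<And>\<alpha>. \<alpha> \<in> A \<Longrightarrow> hol_at x (f \<alpha>)" for \<alpha> and f :: "'a \<Rightarrow> complex^'n \<Rightarrow> complex"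
    using that by (cases "\<alpha> = k") auto
  show ?case
  proof (cases "\<forall>\<^sub>F z in nhds x. g k z = 0")
    case True
    obtain R :: "nat set" and f where sys: "scalar_system x A g R f"
      using insert.IH[of g] gA by blast
    note R = scalar_systemD(1,2)[OF sys] and eqv = scalar_systemD(3)[OF sys]
    have "\<forall>\<^sub>F y in nhds x. \<forall>\<^sub>F z in nhds y. g k z = 0" using True by (simp add: eventually_eventually)
    with eqv have "\<forall>\<^sub>F y in nhds x. \<forall>a. (\<forall>\<alpha>\<in>?I. hol_at y (a \<alpha>)) \<longrightarrow>
       (\<forall>\<^sub>F z in nhds y. (\<Sum>\<alpha>\<in>?I. a \<alpha> z *\<^sub>C g \<alpha> z) = 0)
         = relation_at ?I R (\<lambda>r \<alpha> z. if \<alpha> = k then 0 else f r \<alpha> z) y a"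
    proof eventually_elim
      case (elim y)
      show ?case
      proof (intro allI impI)
        fix a :: "'a \<Rightarrow> complex^'n \<Rightarrow> complex" assume a: "\<forall>\<alpha>\<in>?I. hol_at y (a \<alpha>)"
        have z: "c *\<^sub>C (0::'e) = 0" for c using norm_scaleC[of c "0::'e"] by simp
        have "\<forall>\<^sub>F z in nhds y. (\<Sum>\<alpha>\<in>?I. a \<alpha> z *\<^sub>C g \<alpha> z) = (\<Sum>\<alpha>\<in>A. a \<alpha> z *\<^sub>C g \<alpha> z)"
          using elim(2) by eventually_elim (use insert.hyps z in simp)
        then have "(\<forall>\<^sub>F z in nhds y. (\<Sum>\<alpha>\<in>?I. a \<alpha> z *\<^sub>C g \<alpha> z) = 0)
          = (\<forall>\<^sub>F z in nhds y. (\<Sum>\<alpha>\<in>A. a \<alpha> z *\<^sub>C g \<alpha> z) = 0)"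
          by (rule eventually_cong) simp
        then show "(\<forall>\<^sub>F z in nhds y. (\<Sum>\<alpha>\<in>?I. a \<alpha> z *\<^sub>C g \<alpha> z) = 0)
         = relation_at ?I R (\<lambda>r \<alpha> z. if \<alpha> = k then 0 else f r \<alpha> z) y a"
          using elim(1) a ext[of y a R f] by simp
      qed
    qed
    moreover have "\<forall>r\<in>R. \<forall>\<alpha>\<in>?I. hol_at x (\<lambda>z. if \<alpha> = k then 0 else f r \<alpha> z)"
      using R(2) ext_hol by (intro ballI) blast
    ultimately show ?thesis
      unfolding scalar_system_def using R(1) by (intro exI[of _ R] exI[of _ "\<lambda>r \<alpha> z. if \<alpha> = k then 0 else f r \<alpha> z"] conjI)
  next
    case False
    obtain U where U: "open U" "x \<in> U" "holomorphic_map U (g k)" using gk unfolding hol_at_def by blast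
    obtain r where r: "r > 0" "ball x r \<subseteq> U" using U open_contains_ball by blast
    have "\<exists>z\<in>ball x r. g k z \<noteq> 0"
    proof (rule ccontr)
      assume "\<not> (\<exists>z\<in>ball x r. g k z \<noteq> 0)"
      then have "\<forall>\<^sub>F z in nhds x. g k z = 0"
        using r unfolding eventually_nhds by (intro exI[of _ "ball x r"]) auto
      then show False using False by blast
    qed
    then obtain z0 where z0: "z0 \<in> ball x r" "g k z0 \<noteq> 0" by blast
    \<comment> \<open>\<open>g k\<close> may vanish at \<open>x\<close>, so the functional is chosen
      at the nearby point \<open>z0\<close>; by the identity theorem its composite with
      \<open>g k\<close> then vanishes on no open subset of the ball.\<close>
    obtain l :: "'e \<Rightarrow> complex" where l: "bounded_linear l" "\<And>c v. l (c *\<^sub>C v) = c * l v" "l (g k z0) \<noteq> 0"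
      using complex_functional_separates[OF z0(2)] by blast
    interpret l: bounded_linear l by (rule l(1))
    have hl: "hol_at y (\<lambda>z. l (h z))" if "hol_at y h" for y and h :: "complex^'n \<Rightarrow> 'e"
      using that holomorphic_map_bounded_linear[OF _ l(1,2)] unfolding hol_at_def by blast
    have hB: "holomorphic_map (ball x r) (\<lambda>z. l (g k z))"
      by (rule holomorphic_map_bounded_linear[OF holomorphic_map_subset[OF U(3) r(2)] l(1,2)])
    have nz: "\<forall>\<^sub>F y in nhds x. \<not> (\<forall>\<^sub>F w in nhds y. l (g k w) = 0)"
      unfolding eventually_nhds
      using nonzero_holomorphic_nowhere_locally_zero[OF hB z0(1) l(3)] r(1)
      by (intro exI[of _ "ball x r"]) (auto simp: eventually_nhds)
    define g' where "g' \<alpha> z = l (g k z) *\<^sub>C g \<alpha> z - l (g \<alpha> z) *\<^sub>C g k z" for \<alpha> z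
    have "hol_at x (g' \<alpha>)" if "\<alpha> \<in> A" for \<alpha>
      unfolding g'_def using gk gA[OF that] by (intro hol_at_diff hol_at_scaleC hl)
    then obtain R :: "nat set" and f where sys: "scalar_system x A g' R f"
      using insert.IH[of g'] by blast
    note R = scalar_systemD(1,2)[OF sys] and eqv = scalar_systemD(3)[OF sys]
    \<comment> \<open>Index 0 is the new scalar equation; the equations for \<open>g'\<close> are
      shifted by one and receive the coefficient 0 at \<open>k\<close>.\<close>
    define R' where "R' = insert 0 (Suc ` R)"
    define F where "F s \<alpha> = (case s of 0 \<Rightarrow> (\<lambda>z. l (g \<alpha> z)) | Suc r \<Rightarrow> (\<lambda>z. if \<alpha> = k then 0 else f r \<alpha> z))" for s \<alpha>
    have rel': "relation_at ?I R' F y a \<longleftrightarrow> (\<forall>\<^sub>F z in nhds y. (\<Sum>\<alpha>\<in>?I. a \<alpha> z * l (g \<alpha> z)) = 0) \<and>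
        relation_at ?I R (\<lambda>r \<alpha> z. if \<alpha> = k then 0 else f r \<alpha> z) y a" for y a
      unfolding relation_at_def R'_def F_def by auto
    have "\<forall>\<^sub>F y in nhds x. \<forall>\<alpha>\<in>?I. hol_at y (g \<alpha>)"
      using insert.hyps(1) insert.prems by (intro eventually_ball_finite ballI hol_at_nhds) auto
    \<comment> \<open>Wanted at all points \<open>z\<close> near each \<open>y\<close>, since the
      continuity argument below is carried out at such \<open>z\<close>.\<close>
    moreover have "\<forall>\<^sub>F y in nhds x. \<forall>\<^sub>F z in nhds y. \<not> (\<forall>\<^sub>F w in nhds z. l (g k w) = 0)"
      using nz by (simp add: eventually_eventually)
    ultimately have "\<forall>\<^sub>F y in nhds x. \<forall>a. (\<forall>\<alpha>\<in>?I. hol_at y (a \<alpha>)) \<longrightarrow>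
       (\<forall>\<^sub>F z in nhds y. (\<Sum>\<alpha>\<in>?I. a \<alpha> z *\<^sub>C g \<alpha> z) = 0) = relation_at ?I R' F y a"
      using eqv
    proof eventually_elim
      case (elim y)
      show ?case
      proof (intro allI impI)
        fix a :: "'a \<Rightarrow> complex^'n \<Rightarrow> complex" assume a: "\<forall>\<alpha>\<in>?I. hol_at y (a \<alpha>)"
        let ?s = "\<lambda>z. \<Sum>\<alpha>\<in>?I. a \<alpha> z *\<^sub>C g \<alpha> z"
        have key: "l (g k z) *\<^sub>C ?s z = (\<Sum>\<alpha>\<in>A. a \<alpha> z *\<^sub>C g' \<alpha> z) + (\<Sum>\<alpha>\<in>?I. a \<alpha> z * l (g \<alpha> z)) *\<^sub>C g k z" for z
          unfolding g'_def by (rule elimination_identity[OF insert.hyps])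
        have ls: "l (?s z) = (\<Sum>\<alpha>\<in>?I. a \<alpha> z * l (g \<alpha> z))" for z
          by (simp only: l.sum l(2))
        have zr: "c *\<^sub>C (0::'e) = 0" for c using norm_scaleC[of c "0::'e"] by simp
        have zl: "0 *\<^sub>C (w::'e) = 0" for w using norm_scaleC[of 0 w] by simp
        have "(\<forall>\<^sub>F z in nhds y. ?s z = 0) \<longleftrightarrow> (\<forall>\<^sub>F z in nhds y. (\<Sum>\<alpha>\<in>?I. a \<alpha> z * l (g \<alpha> z)) = 0) \<and>
            (\<forall>\<^sub>F z in nhds y. (\<Sum>\<alpha>\<in>A. a \<alpha> z *\<^sub>C g' \<alpha> z) = 0)" (is "?lhs \<longleftrightarrow> ?r1 \<and> ?r2")
        proof
          assume L: ?lhs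
          then have r1: ?r1
          proof eventually_elim
            case (elim z)
            then show ?case using ls[of z] l.zero by simp
          qed
          have ?r2
            using L r1
          proof eventually_elim
            case (elim z)
            then show ?case using key[of z] by (simp only: zl zr add_0_right)
          qed
          with r1 show "?r1 \<and> ?r2" by blast
        next
          assume "?r1 \<and> ?r2"
          then have r1: ?r1 and r2: ?r2 by auto
          have "\<forall>\<^sub>F z in nhds y. l (g k z) *\<^sub>C ?s z = 0"
            using r1 r2
          proof eventually_elim
            case (elim z)
            then show ?case using key[of z] by (simp only: zl add_0_right)
          qed
          then have ev: "\<forall>\<^sub>F z in nhds y. \<forall>\<^sub>F w in nhds z. l (g k w) *\<^sub>C ?s w = 0"
            by (simp add: eventually_eventually)
          have "hol_at y ?s" using a elim(1) by (intro hol_at_sum hol_at_scaleC) auto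
          from hol_at_nhds[OF this] show ?lhs
            using ev elim(2)
          proof eventually_elim
            case (elim z)
            show ?case
            \<comment> \<open>A nonzero value of the sum persists nearby and would force the pivot
              to vanish on a neighbourhood of \<open>z\<close>.\<close>
            proof (rule ccontr)
              assume "?s z \<noteq> 0"
              from hol_at_nonzero_nhds[OF elim(1) this] elim(2)
              have "\<forall>\<^sub>F w in nhds z. l (g k w) = 0"
              proof eventually_elim
                case (elim w)
                then have "cmod (l (g k w)) * norm (?s w) = 0" by (simp only: norm_zero flip: norm_scaleC)
                then show ?case using elim(1) by simp
              qed
              then show False using elim(3) by blast
            qed
          qed
        qed
        also have "?r2 \<longleftrightarrow> relation_at A R f y a" using elim(3) a by simp
        also have "\<dots> \<longleftrightarrow> relation_at ?I R (\<lambda>r \<alpha> z. if \<alpha> = k then 0 else f r \<alpha> z) y a"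
          using ext[of y a R f] a by simp
        finally show "(\<forall>\<^sub>F z in nhds y. ?s z = 0) = relation_at ?I R' F y a" by (simp only: rel')
      qed
    qed
    moreover have "\<forall>r\<in>R'. \<forall>\<alpha>\<in>?I. hol_at x (F r \<alpha>)"
    proof (intro ballI)
      fix s \<alpha> assume "s \<in> R'" "\<alpha> \<in> ?I"
      show "hol_at x (F s \<alpha>)"
      proof (cases s)
        case 0
        then show ?thesis using hl[OF insert.prems[OF \<open>\<alpha> \<in> ?I\<close>]] by (simp add: F_def)
      next
        case (Suc r)
        then have "r \<in> R" using \<open>s \<in> R'\<close> by (auto simp: R'_def)
        then show ?thesis using ext_hol[OF \<open>\<alpha> \<in> ?I\<close>, of "f r"] R(2) by (simp add: F_def Suc)
      qed
    qed
    moreover have "finite R'" using R(1) by (simp add: R'_def)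
    ultimately show ?thesis
      unfolding scalar_system_def by (intro exI[of _ R'] exI[of _ F] conjI)
  qed
qed

text \<open>Both reductions meet here: the scalar system is solved with all coordinates as
  variables, and the equivalence, used at \<open>x\<close> itself, turns the scalar generators back
  into relations between the \<open>g \<alpha>\<close>.\<close>

theorem banach_relations_finitely_generated:
  fixes g :: "nat \<Rightarrow> complex^'n \<Rightarrow> 'e::complex_banach"
  assumes A: "finite A" and g: "\<And>\<alpha>. \<alpha> \<in> A \<Longrightarrow> hol_at x (g \<alpha>)"
  obtains J :: "nat set" and \<rho> where "finite J" "\<And>j \<alpha>. j \<in> J \<Longrightarrow> \<alpha> \<in> A \<Longrightarrow> hol_at x (\<rho> j \<alpha>)"
    "\<And>j. j \<in> J \<Longrightarrow> \<forall>\<^sub>F z in nhds x. (\<Sum>\<alpha>\<in>A. \<rho> j \<alpha> z *\<^sub>C g \<alpha> z) = 0"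
    "\<forall>\<^sub>F y in nhds x. \<forall>a. (\<forall>\<alpha>\<in>A. hol_at y (a \<alpha>)) \<and> (\<forall>\<^sub>F z in nhds y. (\<Sum>\<alpha>\<in>A. a \<alpha> z *\<^sub>C g \<alpha> z) = 0)
       \<longrightarrow> combination_at A J \<rho> y a"
proof -
  obtain R :: "nat set" and f where sys: "scalar_system x A g R f"
    using banach_relations_scalar[of A x g] A g by blast
  note R = scalar_systemD(1,2)[OF sys] and eqv = scalar_systemD(3)[OF sys]
  have "depends_on UNIV h" for h :: "complex^'n \<Rightarrow> complex"
    unfolding depends_on_def by (simp flip: vec_eq_iff)
  then have "finite_relations UNIV x A R f"
    by (intro finite_relations_polymorphic[OF finite_relations_holomorphic R(1) A]) (use R(2) in auto)
  then obtain J :: "nat set" and \<rho> where gen: "generators UNIV x A R f J \<rho>"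
    unfolding finite_relations_def by blast
  show thesis
  proof (rule that[of J \<rho>])
    show "finite J" "\<And>j \<alpha>. j \<in> J \<Longrightarrow> \<alpha> \<in> A \<Longrightarrow> hol_at x (\<rho> j \<alpha>)"
      using generatorsE(1,3)[OF gen] by auto
    show "\<forall>\<^sub>F z in nhds x. (\<Sum>\<alpha>\<in>A. \<rho> j \<alpha> z *\<^sub>C g \<alpha> z) = 0" if "j \<in> J" for j
      using eventually_nhds_x_imp_x[OF eqv] generatorsE(2,3)[OF gen that] by blast
    show "\<forall>\<^sub>F y in nhds x. \<forall>a. (\<forall>\<alpha>\<in>A. hol_at y (a \<alpha>)) \<and> (\<forall>\<^sub>F z in nhds y. (\<Sum>\<alpha>\<in>A. a \<alpha> z *\<^sub>C g \<alpha> z) = 0)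
       \<longrightarrow> combination_at A J \<rho> y a"
      using eqv generatorsE(5)[OF gen] by eventually_elim blast
  qed
qed

section \<open>Coherence\<close>

lemma free_sheaf_simps:
  "carrier (sections (free_sheaf k) W) = ({..<k} \<rightarrow>\<^sub>E hol_maps W)"
  "s \<oplus>\<^bsub>sections (free_sheaf k) W\<^esub> t = (\<lambda>i\<in>{..<k}. \<lambda>z\<in>W. s i z + t i z)"
  "a \<odot>\<^bsub>sections (free_sheaf k) W\<^esub> s = (\<lambda>i\<in>{..<k}. \<lambda>z\<in>W. a z * s i z)"
  "restr (free_sheaf k) W W' s = (\<lambda>i\<in>{..<k}. restrict (s i) W')"
  by (simp_all add: free_sheaf_def direct_power_def plain_sheaf_def scaleC_complex_def)

lemma subsheaf_simps:
  "carrier (sections (subsheaf F S) W) = S W"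
  "s \<oplus>\<^bsub>sections (subsheaf F S) W\<^esub> t = s \<oplus>\<^bsub>sections F W\<^esub> t"
  "a \<odot>\<^bsub>sections (subsheaf F S) W\<^esub> s = a \<odot>\<^bsub>sections F W\<^esub> s"
  "\<zero>\<^bsub>sections (subsheaf F S) W\<^esub> = \<zero>\<^bsub>sections F W\<^esub>"
  "restr (subsheaf F S) = restr F"
  by (simp_all add: subsheaf_def)

lemma plain_sheaf_simps:
  fixes f g :: "complex^'n \<Rightarrow> 'e::complex_banach"
  shows "carrier (sections plain_sheaf W) = (hol_maps W :: (complex^'n \<Rightarrow> 'e) set)"
  "f \<oplus>\<^bsub>sections plain_sheaf W\<^esub> g = (\<lambda>z\<in>W. f z + g z)"
  "a \<odot>\<^bsub>sections plain_sheaf W\<^esub> f = (\<lambda>z\<in>W. a z *\<^sub>C f z)"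
  "\<zero>\<^bsub>sections plain_sheaf W\<^esub> = (\<lambda>z\<in>W. 0 :: 'e)"
  "restr plain_sheaf W W' f = restrict f W'"
  by (simp_all add: plain_sheaf_def)

lemma carrier_hol_ring: "carrier (hol_ring W) = hol_maps W"
  by (simp add: hol_ring_def)

lemma hol_maps_hol_at: "f \<in> hol_maps W \<Longrightarrow> open W \<Longrightarrow> y \<in> W \<Longrightarrow> hol_at y f"
  using hol_mapsD holomorphic_map_iff_hol_at by blast

lemma hol_maps_restrict_iff: "open W \<Longrightarrow> (\<lambda>z\<in>W. f z) \<in> hol_maps W \<longleftrightarrow> (\<forall>y\<in>W. hol_at y f)"
  by (simp add: hol_maps_restrict holomorphic_map_iff_hol_at)

lemma hol_maps_const: "(\<lambda>z\<in>W. c) \<in> hol_maps W"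
  by (rule hol_maps_intros(5))

text \<open>The unit sections exist over all of \<open>U\<close>, and compatibility with restriction
  makes their images over \<open>U\<close> determine \<phi> over every smaller \<open>W\<close> by
  linearity.\<close>

lemma hom_free_eq_combination:
  fixes S :: "(complex^'n) set \<Rightarrow> (complex^'n \<Rightarrow> 'e::complex_banach) set"
  assumes hom: "O_hom U (free_sheaf k) (subsheaf plain_sheaf S) \<phi>" and U: "open U"
    and S: "\<And>W. open W \<Longrightarrow> W \<subseteq> U \<Longrightarrow> S W \<subseteq> hol_maps W"
    and W: "open W" "W \<subseteq> U" and s: "s \<in> ({..<k} \<rightarrow>\<^sub>E hol_maps W)"
  shows "\<phi> W s = (\<lambda>z\<in>W. \<Sum>i<k. s i z *\<^sub>C \<phi> U (\<lambda>j\<in>{..<k}. \<lambda>z\<in>U. if j = i then 1 else 0) z)"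
proof -
  define e where "e W i = (\<lambda>j\<in>{..<k}. \<lambda>z\<in>W. if j = i then 1 else 0 :: complex)" for W :: "(complex^'n) set" and i
  define g where "g i = \<phi> U (e U i)" for i
  have e: "e W i \<in> ({..<k} \<rightarrow>\<^sub>E hol_maps W)" for W i
    unfolding e_def by (auto simp: hol_maps_const)
  have hd: "t \<in> ({..<k} \<rightarrow>\<^sub>E hol_maps W) \<Longrightarrow> \<phi> W t \<in> hol_maps W"
    "t \<in> ({..<k} \<rightarrow>\<^sub>E hol_maps W) \<Longrightarrow> t' \<in> ({..<k} \<rightarrow>\<^sub>E hol_maps W) \<Longrightarrow>
       \<phi> W (\<lambda>i\<in>{..<k}. \<lambda>z\<in>W. t i z + t' i z) = (\<lambda>z\<in>W. \<phi> W t z + \<phi> W t' z)"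
    "a \<in> hol_maps W \<Longrightarrow> t \<in> ({..<k} \<rightarrow>\<^sub>E hol_maps W) \<Longrightarrow>
       \<phi> W (\<lambda>i\<in>{..<k}. \<lambda>z\<in>W. a z * t i z) = (\<lambda>z\<in>W. a z *\<^sub>C \<phi> W t z)" for t t' a
    using O_homD(1,2,3)[OF hom W] S[OF W]
    by (auto simp: free_sheaf_simps subsheaf_simps plain_sheaf_simps carrier_hol_ring)
  have ge: "\<phi> W (e W i) = restrict (g i) W" for i
  proof -
    have "\<phi> W (restr (free_sheaf k) U W (e U i)) = restr (subsheaf plain_sheaf S) U W (\<phi> U (e U i))"
      by (rule O_homD(4)[OF hom U order_refl W]) (simp add: free_sheaf_simps e)
    moreover have "restr (free_sheaf k) U W (e U i) = e W i"
      using W(2) by (auto simp: free_sheaf_simps e_def fun_eq_iff)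
    ultimately show ?thesis by (simp add: subsheaf_simps plain_sheaf_simps g_def)
  qed
  have si: "s i \<in> hol_maps W" if "i < k" for i using s that by auto
  have zl: "0 *\<^sub>C (w::'e) = 0" for w using norm_scaleC[of 0 w] by simp
  \<comment> \<open>The tuple \<open>s\<close> with the entries from \<open>m\<close> on replaced by
    0: additivity is available for two summands, so the sum is built entry by entry.\<close>
  define tr where "tr m = (\<lambda>i\<in>{..<k}. if i < m then s i else (\<lambda>z\<in>W. 0))" for m
  have tr: "tr m \<in> ({..<k} \<rightarrow>\<^sub>E hol_maps W)" for m
    unfolding tr_def using si by (auto simp: hol_maps_const)
  have "\<phi> W (tr m) = (\<lambda>z\<in>W. \<Sum>i<m. s i z *\<^sub>C g i z)" if "m \<le> k" for m
    using that
  proof (induction m)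
    case 0
    \<comment> \<open>The zero tuple is 0 times itself, so homogeneity gives it the value 0.\<close>
    have "tr 0 = (\<lambda>i\<in>{..<k}. \<lambda>z\<in>W. (\<lambda>z\<in>W. 0) z * tr 0 i z)"
      by (auto simp: tr_def fun_eq_iff)
    then have "\<phi> W (tr 0) = (\<lambda>z\<in>W. (\<lambda>z\<in>W. 0) z *\<^sub>C \<phi> W (tr 0) z)"
      using hd(3)[OF hol_maps_const tr, of 0 0] by simp
    also have "\<dots> = (\<lambda>z\<in>W. 0)" by (auto simp: fun_eq_iff zl)
    finally show ?case by simp
  next
    case (Suc m)
    have sm: "s m \<in> hol_maps W" using Suc.prems si by simp
    have me: "(\<lambda>i\<in>{..<k}. \<lambda>z\<in>W. s m z * e W m i z) \<in> ({..<k} \<rightarrow>\<^sub>E hol_maps W)"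
      using hol_maps_intros(4)[OF sm] e by (auto simp: PiE_mem)
    have "tr (Suc m) = (\<lambda>i\<in>{..<k}. \<lambda>z\<in>W. tr m i z + (\<lambda>i\<in>{..<k}. \<lambda>z\<in>W. s m z * e W m i z) i z)"
    proof
      fix i
      show "tr (Suc m) i = (\<lambda>i\<in>{..<k}. \<lambda>z\<in>W. tr m i z + (\<lambda>i\<in>{..<k}. \<lambda>z\<in>W. s m z * e W m i z) i z) i"
      proof (cases "i < k")
        case True
        have "s i z = undefined" if "z \<notin> W" for z
          using si[OF True] that by (auto simp: hol_maps_def extensional_def)
        then show ?thesis using True by (auto simp: tr_def e_def fun_eq_iff less_Suc_eq)
      qed (simp add: tr_def)
    qed
    then have "\<phi> W (tr (Suc m)) = (\<lambda>z\<in>W. \<phi> W (tr m) z + (\<lambda>z\<in>W. s m z *\<^sub>C \<phi> W (e W m) z) z)"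
      using hd(2)[OF tr me, of m] hd(3)[OF sm e, of m] by simp
    also have "\<dots> = (\<lambda>z\<in>W. \<Sum>i<Suc m. s i z *\<^sub>C g i z)"
      using Suc by (auto simp: fun_eq_iff ge)
    finally show ?case .
  qed
  from this[of k] have "\<phi> W (tr k) = (\<lambda>z\<in>W. \<Sum>i<k. s i z *\<^sub>C g i z)" by simp
  moreover have "tr k = s" using s by (auto simp: tr_def fun_eq_iff PiE_def extensional_def)
  ultimately show ?thesis by (simp add: g_def e_def)
qed

text \<open>The kernel is the sheaf of relations between the images \<open>g i\<close> of the unit
  sections. Germs generating these relations at every point near \<open>x\<close> become sections
  over one \<open>V\<close> and define a homomorphism onto the kernel there.\<close>

lemma kernel_locally_finitely_generated:
  fixes S :: "(complex^'n) set \<Rightarrow> (complex^'n \<Rightarrow> 'e::complex_banach) set"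
  assumes hom: "O_hom U (free_sheaf k) (subsheaf plain_sheaf S) \<phi>" and U: "open U"
    and S: "\<And>W. open W \<Longrightarrow> W \<subseteq> U \<Longrightarrow> S W \<subseteq> hol_maps W"
  shows "locally_finitely_generated U
    (subsheaf (free_sheaf k) (hom_kernel (free_sheaf k) (subsheaf plain_sheaf S) \<phi>))"
proof -
  let ?N = "hom_kernel (free_sheaf k) (subsheaf plain_sheaf S) \<phi>"
  define g where "g i = \<phi> U (\<lambda>j\<in>{..<k}. \<lambda>z\<in>U. if j = i then 1 else 0)" for i
  have kernel: "?N W = {s \<in> {..<k} \<rightarrow>\<^sub>E hol_maps W. \<forall>z\<in>W. (\<Sum>i<k. s i z *\<^sub>C g i z) = 0}"
    if "open W" "W \<subseteq> U" for W
    using hom_free_eq_combination[OF hom U S that]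
    by (auto simp: hom_kernel_def free_sheaf_simps subsheaf_simps plain_sheaf_simps g_def restrict_def fun_eq_iff)
  have hg: "hol_at y (g i)" if "y \<in> U" for y i
  proof -
    have "(\<lambda>j\<in>{..<k}. \<lambda>z\<in>U. if j = i then 1 else 0 :: complex) \<in> ({..<k} \<rightarrow>\<^sub>E hol_maps U)"
      by (auto simp: hol_maps_const)
    moreover have "\<phi> U \<in> ({..<k} \<rightarrow>\<^sub>E hol_maps U) \<rightarrow> S U"
      using O_homD(1)[OF hom U order_refl] by (simp add: free_sheaf_simps subsheaf_simps)
    ultimately have "g i \<in> hol_maps U"
      unfolding g_def using S[OF U order_refl] by blast
    then show ?thesis using U that by (rule hol_maps_hol_at)
  qed
  show ?thesis
    unfolding locally_finitely_generated_def
  proof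
    fix x assume x: "x \<in> U"
    obtain J :: "nat set" and \<rho> where J: "finite J"
      and \<rho>: "\<And>j i. j \<in> J \<Longrightarrow> i \<in> {..<k} \<Longrightarrow> hol_at x (\<rho> j i)"
      and rel: "\<And>j. j \<in> J \<Longrightarrow> \<forall>\<^sub>F z in nhds x. (\<Sum>i<k. \<rho> j i z *\<^sub>C g i z) = 0"
      and gen: "\<forall>\<^sub>F y in nhds x. \<forall>a. (\<forall>i\<in>{..<k}. hol_at y (a i)) \<and> (\<forall>\<^sub>F z in nhds y. (\<Sum>i<k. a i z *\<^sub>C g i z) = 0)
         \<longrightarrow> combination_at {..<k} J \<rho> y a"
      by (rule banach_relations_finitely_generated[of "{..<k}" x g, OF finite_lessThan hg[OF x]]) (assumption | rule that)+
    \<comment> \<open>A free sheaf is indexed by an initial segment of the naturals, so the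
      generators are renumbered.\<close>
    define m where "m = card J"
    obtain h :: "nat \<Rightarrow> nat" where h: "bij_betw h {..<m} J"
      using bij_betw_from_nat_into_finite[OF J] m_def by blast
    have hJ: "h j \<in> J" if "j < m" for j using h that bij_betwE by blast
    have "\<forall>\<^sub>F y in nhds x. \<forall>j\<in>J. \<forall>i\<in>{..<k}. hol_at y (\<rho> j i)"
      by (intro eventually_ball_finite J ballI hol_at_nhds \<rho>) auto
    moreover have "\<forall>\<^sub>F y in nhds x. \<forall>j\<in>J. (\<Sum>i<k. \<rho> j i y *\<^sub>C g i y) = 0"
      by (intro eventually_ball_finite J ballI rel)
    moreover have "\<forall>\<^sub>F y in nhds x. y \<in> U" using U x by (rule eventually_nhds_in_open)
    ultimately have "\<forall>\<^sub>F y in nhds x. y \<in> U \<and> (\<forall>j\<in>J. \<forall>i\<in>{..<k}. hol_at y (\<rho> j i)) \<and>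
       (\<forall>j\<in>J. (\<Sum>i<k. \<rho> j i y *\<^sub>C g i y) = 0) \<and>
       (\<forall>a. (\<forall>i\<in>{..<k}. hol_at y (a i)) \<and> (\<forall>\<^sub>F z in nhds y. (\<Sum>i<k. a i z *\<^sub>C g i z) = 0)
         \<longrightarrow> combination_at {..<k} J \<rho> y a)" (is "eventually ?P _")
      using gen by eventually_elim (intro conjI)
    then obtain V where V: "open V" "x \<in> V" and VP: "\<forall>y\<in>V. ?P y"
      unfolding eventually_nhds[of ?P] by (elim exE conjE) (rule that)
    have P: "?P y" if "y \<in> V" for y by (rule bspec[OF VP that])
    have VU: "V \<subseteq> U" using P by blast
    have \<rho>V: "hol_at y (\<rho> j i)" if "y \<in> V" "j \<in> J" "i < k" for y j i
      using P[OF that(1)] that(2,3) by simp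
    have relV: "(\<Sum>i<k. \<rho> j i y *\<^sub>C g i y) = 0" if "y \<in> V" "j \<in> J" for y j
      using P[OF that(1)] that(2) by simp
    have genV: "combination_at {..<k} J \<rho> y a" if "y \<in> V" "\<And>i. i < k \<Longrightarrow> hol_at y (a i)"
         "\<forall>\<^sub>F z in nhds y. (\<Sum>i<k. a i z *\<^sub>C g i z) = 0" for y a
      using P[OF that(1)] that(2,3) by simp
    define \<psi> where "\<psi> W c = (\<lambda>i\<in>{..<k}. \<lambda>z\<in>W. \<Sum>j<m. c j z * \<rho> (h j) i z)"
      for W :: "(complex^'n) set" and c :: "nat \<Rightarrow> complex^'n \<Rightarrow> complex"
    have \<psi>N: "\<psi> W c \<in> ?N W" if W: "open W" "W \<subseteq> V" and c: "c \<in> ({..<m} \<rightarrow>\<^sub>E hol_maps W)" for W c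
    proof -
      have "hol_at y (\<lambda>z. \<Sum>j<m. c j z * \<rho> (h j) i z)" if "i < k" "y \<in> W" for i y
      proof (intro hol_at_sum hol_at_mult)
        fix j assume "j \<in> {..<m}"
        then show "hol_at y (c j)" using c W that(2) by (auto intro!: hol_maps_hol_at[of _ W])
        show "hol_at y (\<rho> (h j) i)" using \<open>j \<in> {..<m}\<close> that W hJ by (intro \<rho>V) auto
      qed
      then have "\<psi> W c \<in> ({..<k} \<rightarrow>\<^sub>E hol_maps W)"
        using W by (auto simp: \<psi>_def hol_maps_restrict_iff)
      moreover have "(\<Sum>i<k. \<psi> W c i z *\<^sub>C g i z) = 0" if "z \<in> W" for z
      proof -
        note bb = bounded_bilinear_scaleC[where 'e = 'e]
        have "(\<Sum>i<k. \<psi> W c i z *\<^sub>C g i z) = (\<Sum>i<k. \<Sum>j<m. c j z *\<^sub>C (\<rho> (h j) i z *\<^sub>C g i z))"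
          using that by (simp add: \<psi>_def bounded_bilinear.sum_left[OF bb] scaleC_scaleC)
        also have "\<dots> = (\<Sum>j<m. c j z *\<^sub>C (\<Sum>i<k. \<rho> (h j) i z *\<^sub>C g i z))"
          unfolding bounded_bilinear.sum_right[OF bb] by (rule sum.swap)
        also have "\<dots> = 0"
          using relV[of z] hJ that W(2) by (auto simp: bounded_bilinear.zero_right[OF bb] subset_iff)
        finally show ?thesis .
      qed
      ultimately show ?thesis using kernel[OF W(1)] W(2) VU by auto
    qed
    have \<psi>hom: "O_hom V (free_sheaf m) (subsheaf (free_sheaf k) ?N) \<psi>"
      unfolding O_hom_def
    proof (intro allI impI conjI ballI)
      fix W assume "open W \<and> W \<subseteq> V"
      then have W: "open W" "W \<subseteq> V" by auto
      show "\<psi> W \<in> carrier (sections (free_sheaf m) W) \<rightarrow> carrier (sections (subsheaf (free_sheaf k) ?N) W)"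
        using \<psi>N[OF W] by (auto simp: free_sheaf_simps subsheaf_simps)
      show "\<psi> W (s \<oplus>\<^bsub>sections (free_sheaf m) W\<^esub> t) = \<psi> W s \<oplus>\<^bsub>sections (subsheaf (free_sheaf k) ?N) W\<^esub> \<psi> W t" for s t
        by (auto simp: free_sheaf_simps subsheaf_simps \<psi>_def fun_eq_iff algebra_simps sum.distrib)
      show "\<psi> W (a \<odot>\<^bsub>sections (free_sheaf m) W\<^esub> s) = a \<odot>\<^bsub>sections (subsheaf (free_sheaf k) ?N) W\<^esub> \<psi> W s" for a s
        by (auto simp: free_sheaf_simps subsheaf_simps \<psi>_def fun_eq_iff sum_distrib_left mult.assoc)
      show "\<psi> W' (restr (free_sheaf m) W W' s) = restr (subsheaf (free_sheaf k) ?N) W W' (\<psi> W s)"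
        if "open W' \<and> W' \<subseteq> W" for W' s
        using that by (auto simp: free_sheaf_simps subsheaf_simps \<psi>_def fun_eq_iff subset_iff)
    qed
    have "hom_image (free_sheaf m) (subsheaf (free_sheaf k) ?N) \<psi> W = carrier (sections (subsheaf (free_sheaf k) ?N) W)"
      if W: "open W" "W \<subseteq> V" for W
    proof
      show "carrier (sections (subsheaf (free_sheaf k) ?N) W) \<subseteq> hom_image (free_sheaf m) (subsheaf (free_sheaf k) ?N) \<psi> W"
      proof
        fix s assume s: "s \<in> carrier (sections (subsheaf (free_sheaf k) ?N) W)"
        have WU: "W \<subseteq> U" using W VU by blast
        have sk: "s \<in> ({..<k} \<rightarrow>\<^sub>E hol_maps W)" and s0: "\<And>z. z \<in> W \<Longrightarrow> (\<Sum>i<k. s i z *\<^sub>C g i z) = 0"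
          using s kernel[OF W(1) WU] by (auto simp: subsheaf_simps)
        have "\<exists>V'. open V' \<and> y \<in> V' \<and> V' \<subseteq> W \<and>
            restr (subsheaf (free_sheaf k) ?N) W V' s \<in> \<psi> V' ` carrier (sections (free_sheaf m) V')" if y: "y \<in> W" for y
        proof -
          have "combination_at {..<k} J \<rho> y s"
          proof (rule genV)
            show "y \<in> V" using y W by blast
            show "hol_at y (s i)" if "i < k" for i using sk that W y by (auto intro!: hol_maps_hol_at[of _ W])
            show "\<forall>\<^sub>F z in nhds y. (\<Sum>i<k. s i z *\<^sub>C g i z) = 0"
              using eventually_nhds_in_open[OF W(1) y] by eventually_elim (rule s0)
          qed
          then obtain \<gamma> where \<gamma>: "\<forall>j\<in>J. hol_at y (\<gamma> j)"
            "\<forall>i\<in>{..<k}. \<forall>\<^sub>F z in nhds y. s i z = (\<Sum>j\<in>J. \<gamma> j z * \<rho> j i z)"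
            unfolding combination_at_def by blast
          have "\<forall>\<^sub>F z in nhds y. \<forall>j\<in>J. hol_at z (\<gamma> j)"
            using \<gamma>(1) by (intro eventually_ball_finite J ballI hol_at_nhds) auto
          moreover have "\<forall>\<^sub>F z in nhds y. \<forall>i\<in>{..<k}. s i z = (\<Sum>j\<in>J. \<gamma> j z * \<rho> j i z)"
            using \<gamma>(2) by (intro eventually_ball_finite) auto
          moreover have "\<forall>\<^sub>F z in nhds y. z \<in> W" by (rule eventually_nhds_in_open[OF W(1) y])
          ultimately have "\<forall>\<^sub>F z in nhds y. (\<forall>j\<in>J. hol_at z (\<gamma> j)) \<and>
              (\<forall>i\<in>{..<k}. s i z = (\<Sum>j\<in>J. \<gamma> j z * \<rho> j i z)) \<and> z \<in> W"
            by eventually_elim (intro conjI)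
          \<comment> \<open>The multipliers \<gamma> exist only near \<open>y\<close>; this suffices
            because the image of a sheaf homomorphism is defined locally.\<close>
          then obtain V' where V': "open V'" "y \<in> V'" "V' \<subseteq> W"
            and \<gamma>V: "\<And>z j. z \<in> V' \<Longrightarrow> j \<in> J \<Longrightarrow> hol_at z (\<gamma> j)"
            and sV: "\<And>z i. z \<in> V' \<Longrightarrow> i < k \<Longrightarrow> s i z = (\<Sum>j\<in>J. \<gamma> j z * \<rho> j i z)"
            unfolding eventually_nhds by auto
          define c where "c = (\<lambda>j\<in>{..<m}. \<lambda>z\<in>V'. \<gamma> (h j) z)"
          have "c \<in> carrier (sections (free_sheaf m) V')"
            using \<gamma>V hJ V'(1) by (auto simp: c_def free_sheaf_simps hol_maps_restrict_iff)
          moreover have "restr (subsheaf (free_sheaf k) ?N) W V' s = \<psi> V' c"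
          proof -
            have "(\<Sum>j<m. \<gamma> (h j) z * \<rho> (h j) i z) = s i z" if "z \<in> V'" "i < k" for i z
              using sum.reindex_bij_betw[OF h, of "\<lambda>j. \<gamma> j z * \<rho> j i z"] sV[OF that] by simp
            then show ?thesis
              by (auto simp: free_sheaf_simps subsheaf_simps \<psi>_def c_def fun_eq_iff)
          qed
          ultimately show ?thesis using V' by blast
        qed
        then show "s \<in> hom_image (free_sheaf m) (subsheaf (free_sheaf k) ?N) \<psi> W"
          using s by (simp add: hom_image_def)
      qed
    qed (auto simp: hom_image_def)
    then have "finitely_generated V (subsheaf (free_sheaf k) ?N)"
      unfolding finitely_generated_def using \<psi>hom by blast
    then show "\<exists>V. open V \<and> x \<in> V \<and> V \<subseteq> U \<and> finitely_generated V (subsheaf (free_sheaf k) ?N)"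
      using V VU by blast
  qed
qed

theorem corollary4p2:
  fixes \<Omega> :: "(complex^'n) set"
    and \<G> :: "(complex^'n) set \<Rightarrow> (complex^'n \<Rightarrow> 'e::complex_banach) set"
  assumes "open \<Omega>"
    and "O_submodule \<Omega> plain_sheaf \<G>"
    and "finitely_generated \<Omega> (subsheaf plain_sheaf \<G>)"
  shows "coherent_sheaf \<Omega> (subsheaf plain_sheaf \<G>)"
  unfolding coherent_sheaf_def
proof (intro conjI allI impI)
  show "O_module \<Omega> (subsheaf plain_sheaf \<G>)"
    by (rule subsheaf_O_module[OF plain_sheaf_O_module[OF assms(1)] assms(2)])
  show "locally_finitely_generated \<Omega> (subsheaf plain_sheaf \<G>)"
    unfolding locally_finitely_generated_def using assms(1,3) by blast
next
  fix U k \<phi>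
  assume "open U \<and> U \<subseteq> \<Omega> \<and> O_hom U (free_sheaf k) (subsheaf plain_sheaf \<G>) \<phi>"
  then have U: "open U" "U \<subseteq> \<Omega>" and hom: "O_hom U (free_sheaf k) (subsheaf plain_sheaf \<G>) \<phi>" by auto
  have "\<G> W \<subseteq> hol_maps W" if "open W" "W \<subseteq> U" for W
    using module.submoduleE(1)[OF plain_sections_module O_submoduleD(1)[OF assms(2) that(1)]] that U
    by (auto simp: plain_sheaf_simps)
  then show "locally_finitely_generated U
      (subsheaf (free_sheaf k) (hom_kernel (free_sheaf k) (subsheaf plain_sheaf \<G>) \<phi>))"
    by (intro kernel_locally_finitely_generated[OF hom U(1)])
qed

end
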